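(* Let $\Gamma$ be a countably infinite discrete amenable group acting by homeomorphisms on a compact metrizable space $X$, and suppose that the action $\Gamma\curvearrowright X$ has good subgroups. Then $\Gamma\curvearrowright X$ has comparison. In addition, if $\Gamma\curvearrowright X$ is free, then it is almost finite.
   Context: All actions are by homeomorphisms. Below, $G$ denotes an arbitrary countable (possibly finite) discrete group acting on a compact metrizable space $X$; the notions are applied to $\Gamma$ and, for restricted actions, to subgroups of $\Gamma$. $M^{G}(X)$ denotes the set of $G$-invariant regular Borel probability measures on $X$. The notation $F\subset\!\subset G$ means that $F$ is a finite subset of $G$. **Subequivalence.** For subsets $A,B\subseteq X$, write $A\precsim_G B$ if for every closed set $C\subseteq A$ there are a finite open cover $\mathcal U$ of $C$ and elements $s_U\in G$ ($U\in\mathcal U$) such that the sets $s_UU$, $U\in\mathcal U$, are pairwise disjoint and contained in $B$. This extends to finite formal sums (multisets): $\sum_{i=1}^n[A_i]\precsim_G\sum_{j=1}^m[B_j]$ means that for all closed sets $C_i\subseteq A_i$ ($i=1,\dots,n$) there are, for each $i$, a finite open cover $\mathcal U_i$ of $C_i$ and, for each $U\in\mathcal U_i$, an element $s_{i,U}\in G$ and an index $k_{i,U}\in\{1,\dots,m\}$ such that the sets $s_{i,U}U\times\{k_{i,U}\}$ (over all $i$ and all $U\in\mathcal U_i$) are pairwise disjoint subsets of $\bigsqcup_{j=1}^m B_j\times\{j\}$. A single set $A$ is identified with the formal sum $[A]$, and $k[B]$ denotes $[B]+\dots+[B]$ ($k$ times; the zero sum, i.e. $[\emptyset]$, if $k=0$).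 **Comparison.** The action of $G$ on $X$ has *comparison* if for all open sets $U,V\subseteq X$: if $\mu(U)<\mu(V)$ for all $\mu\in M^G(X)$, then $U\precsim_G V$. It has *comparison on multisets* if for all open sets $U_1,\dots,U_n,V_1,\dots,V_m\subseteq X$: if $\sum_{i=1}^n\mu(U_i)<\sum_{j=1}^m\mu(V_j)$ for all $\mu\in M^G(X)$, then $\sum_{i=1}^n[U_i]\precsim_G\sum_{j=1}^m[V_j]$. **Towers and castles.** A *tower* is a pair $(S,V)$ with $S\subset\!\subset G$ and $V\subseteq X$ open such that the sets $sV$, $s\in S$ (its *levels* ), are pairwise disjoint. A *castle* is a finite collection of towers $\{(S_i,V_i)\}_{i=1}^n$ such that all the levels $sV_i$ ($s\in S_i$, $i=1,\dots,n$) are pairwise disjoint. **Almost finite.** Fix a metric on $X$ compatible with the topology. The action of $G$ on $X$ is *almost finite* if for all $F\subset\!\subset G$ and all $\varepsilon>0$ there is a castle $\{(S_i,V_i)\}_{i=1}^n$ such that 1. each $S_i$ is $(F,\varepsilon)$-invariant, i.e. $|S_i\triangle FS_i|<\varepsilon|S_i|$; 2. $\operatorname{diam}(sV_i)<\varepsilon$ for every $i$ and every $s\in S_i$; 3. $X\setminus\bigsqcup_{i=1}^nS_iV_i\precsim_G\sum_{i=1}^n\lfloor\varepsilon|S_i|\rfloor[V_i]$. **Good subgroups.** The action $\Gamma\curvearrowright X$ has *good subgroups* if for every finite set $F\subset\Gamma$ and every $N\in\mathbb N$ there are subgroups $\Lambda_1\le\Lambda_2\le\Gamma$ of cardinality at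 least $N$ such that 1. the restricted action $\Lambda_1\curvearrowright X$ is almost finite; 2. the restricted action $\Lambda_2\curvearrowright X$ has comparison on multisets; 3. $f\Lambda_1f^{-1}\subseteq\Lambda_2$ for every $f\in F$. *)

theory Defs
  imports
    "HOL-Algebra.Group_Action"
    "HOL-Probability.Probability_Measure"
begin

text \<open>
  The group \<open>G\<close> is a HOL-Algebra group and the space is a type \<open>'x\<close> of class
  \<^class>\<open>metric_space\<close>, compactness being the assumption \<open>compact UNIV\<close>. So \<^const>\<open>dist\<close>
  is the fixed metric compatible with the topology. An action is a map
  \<open>\<alpha>\<close> taking group elements to self-maps of \<open>'x\<close>; every notion below uses \<open>\<alpha>\<close> on
  \<open>carrier G\<close> only, so that the restricted action of a subgroup \<open>H\<close> is the same \<open>\<alpha>\<close>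
  taken over \<open>G\<lparr>carrier := H\<rparr>\<close>.
\<close>

definition homeo_action :: "('g, 'm) monoid_scheme \<Rightarrow> ('g \<Rightarrow> 'x::topological_space \<Rightarrow> 'x) \<Rightarrow> bool"
  where "homeo_action G \<alpha> \<longleftrightarrow>
    group_action G UNIV \<alpha> \<and> (\<forall>g\<in>carrier G. \<exists>h. homeomorphism UNIV UNIV (\<alpha> g) h)"

definition free_action :: "('g, 'm) monoid_scheme \<Rightarrow> ('g \<Rightarrow> 'x \<Rightarrow> 'x) \<Rightarrow> bool"
  where "free_action G \<alpha> \<longleftrightarrow> (\<forall>x. stabilizer G \<alpha> x = {\<one>\<^bsub>G\<^esub>})"

definition approx_invariant :: "('g, 'm) monoid_scheme \<Rightarrow> 'g set \<Rightarrow> real \<Rightarrow> 'g set \<Rightarrow> bool"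
  where "approx_invariant G F \<epsilon> S \<longleftrightarrow>
    real (card (sym_diff S (F <#>\<^bsub>G\<^esub> S))) < \<epsilon> * real (card S)"

text \<open>
  Amenability of a discrete group, in Folner's form. The test set \<open>F\<close> has to be nonempty, here
  and in \<open>almost_finite\<close>: for \<open>F = {}\<close> and \<open>\<epsilon> \<le> 1\<close> no set \<open>S\<close> satisfies
  \<open>approx_invariant G F \<epsilon> S\<close>. The strict inequality forces \<open>S\<close> to be nonempty.
\<close>

definition amenable :: "('g, 'm) monoid_scheme \<Rightarrow> bool"
  where "amenable G \<longleftrightarrow>
    (\<forall>F \<epsilon>. finite F \<and> F \<noteq> {} \<and> F \<subseteq> carrier G \<and> 0 < \<epsilon> \<longrightarrow>
      (\<exists>S. finite S \<and> S \<subseteq> carrier G \<and> approx_invariant G F \<epsilon> S))"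

definition regular_measure :: "'x::topological_space measure \<Rightarrow> bool"
  where "regular_measure \<mu> \<longleftrightarrow>
    (\<forall>A\<in>sets \<mu>.
      emeasure \<mu> A = (SUP K\<in>{K. K \<subseteq> A \<and> compact K}. emeasure \<mu> K) \<and>
      emeasure \<mu> A = (INF U\<in>{U. A \<subseteq> U \<and> open U}. emeasure \<mu> U))"

definition invariant_measures ::
    "('g, 'm) monoid_scheme \<Rightarrow> ('g \<Rightarrow> 'x::topological_space \<Rightarrow> 'x) \<Rightarrow> 'x measure set"
  where "invariant_measures G \<alpha> =
    {\<mu>. sets \<mu> = sets borel \<and> prob_space \<mu> \<and> regular_measure \<mu> \<and>
        (\<forall>g\<in>carrier G. \<forall>A\<in>sets \<mu>. measure \<mu> (\<alpha> g ` A) = measure \<mu> A)}"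

definition subeq ::
    "('g, 'm) monoid_scheme \<Rightarrow> ('g \<Rightarrow> 'x::topological_space \<Rightarrow> 'x) \<Rightarrow> 'x set \<Rightarrow> 'x set \<Rightarrow> bool"
  where "subeq G \<alpha> A B \<longleftrightarrow>
    (\<forall>C. closed C \<and> C \<subseteq> A \<longrightarrow>
      (\<exists>\<U> s. finite \<U> \<and> (\<forall>U\<in>\<U>. open U) \<and> C \<subseteq> \<Union>\<U> \<and> s \<in> \<U> \<rightarrow> carrier G \<and>
        disjoint_family_on (\<lambda>U. \<alpha> (s U) ` U) \<U> \<and> (\<forall>U\<in>\<U>. \<alpha> (s U) ` U \<subseteq> B)))"

text \<open>
  Finite formal sums of sets are lists. The empty list plays the role of \<open>[\<emptyset>]\<close>: each is subequivalent
  to everything, and \<open>A\<close> is subequivalent to either of them only if its closed subsets are empty.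
\<close>

definition subeq_sum ::
    "('g, 'm) monoid_scheme \<Rightarrow> ('g \<Rightarrow> 'x::topological_space \<Rightarrow> 'x) \<Rightarrow> 'x set list \<Rightarrow> 'x set list \<Rightarrow> bool"
  where "subeq_sum G \<alpha> As Bs \<longleftrightarrow>
    (\<forall>C. (\<forall>i<length As. closed (C i) \<and> C i \<subseteq> As ! i) \<longrightarrow>
      (\<exists>\<U> s k.
        (\<forall>i<length As. finite (\<U> i) \<and> (\<forall>U\<in>\<U> i. open U) \<and> C i \<subseteq> \<Union>(\<U> i) \<and>
          (\<forall>U\<in>\<U> i. s i U \<in> carrier G \<and> k i U < length Bs)) \<and>
        disjoint_family_on (\<lambda>(i, U). (\<alpha> (s i U) ` U) \<times> {k i U}) (SIGMA i:{..<length As}. \<U> i) \<and>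
        (\<forall>i<length As. \<forall>U\<in>\<U> i.
          (\<alpha> (s i U) ` U) \<times> {k i U} \<subseteq> (\<Union>j<length Bs. (Bs ! j) \<times> {j}))))"

definition comparison :: "('g, 'm) monoid_scheme \<Rightarrow> ('g \<Rightarrow> 'x::topological_space \<Rightarrow> 'x) \<Rightarrow> bool"
  where "comparison G \<alpha> \<longleftrightarrow>
    (\<forall>U V. open U \<and> open V \<and> (\<forall>\<mu>\<in>invariant_measures G \<alpha>. measure \<mu> U < measure \<mu> V) \<longrightarrow>
      subeq G \<alpha> U V)"

definition comparison_on_multisets ::
    "('g, 'm) monoid_scheme \<Rightarrow> ('g \<Rightarrow> 'x::topological_space \<Rightarrow> 'x) \<Rightarrow> bool"
  where "comparison_on_multisets G \<alpha> \<longleftrightarrow>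
    (\<forall>Us Vs. (\<forall>U\<in>set Us. open U) \<and> (\<forall>V\<in>set Vs. open V) \<and>
        (\<forall>\<mu>\<in>invariant_measures G \<alpha>.
          (\<Sum>i<length Us. measure \<mu> (Us ! i)) < (\<Sum>j<length Vs. measure \<mu> (Vs ! j))) \<longrightarrow>
      subeq_sum G \<alpha> Us Vs)"

definition tower ::
    "('g, 'm) monoid_scheme \<Rightarrow> ('g \<Rightarrow> 'x::topological_space \<Rightarrow> 'x) \<Rightarrow> 'g set \<Rightarrow> 'x set \<Rightarrow> bool"
  where "tower G \<alpha> S V \<longleftrightarrow>
    finite S \<and> S \<subseteq> carrier G \<and> open V \<and> disjoint_family_on (\<lambda>s. \<alpha> s ` V) S"

definition castle ::
    "('g, 'm) monoid_scheme \<Rightarrow> ('g \<Rightarrow> 'x::topological_space \<Rightarrow> 'x) \<Rightarrow> ('g set \<times> 'x set) list \<Rightarrow> bool"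
  where "castle G \<alpha> c \<longleftrightarrow>
    (\<forall>(S, V)\<in>set c. tower G \<alpha> S V) \<and>
    disjoint_family_on (\<lambda>(i, s). \<alpha> s ` snd (c ! i)) (SIGMA i:{..<length c}. fst (c ! i))"

definition almost_finite :: "('g, 'm) monoid_scheme \<Rightarrow> ('g \<Rightarrow> 'x::metric_space \<Rightarrow> 'x) \<Rightarrow> bool"
  where "almost_finite G \<alpha> \<longleftrightarrow>
    (\<forall>F \<epsilon>. finite F \<and> F \<noteq> {} \<and> F \<subseteq> carrier G \<and> 0 < \<epsilon> \<longrightarrow>
      (\<exists>c. castle G \<alpha> c \<and>
        (\<forall>(S, V)\<in>set c. approx_invariant G F \<epsilon> S \<and> (\<forall>s\<in>S. diameter (\<alpha> s ` V) < \<epsilon>)) \<and>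
        subeq_sum G \<alpha>
          [UNIV - (\<Union>(S, V)\<in>set c. \<Union>s\<in>S. \<alpha> s ` V)]
          (concat (map (\<lambda>(S, V). replicate (nat \<lfloor>\<epsilon> * real (card S)\<rfloor>) V) c))))"

definition good_subgroups :: "('g, 'm) monoid_scheme \<Rightarrow> ('g \<Rightarrow> 'x::metric_space \<Rightarrow> 'x) \<Rightarrow> bool"
  where "good_subgroups G \<alpha> \<longleftrightarrow>
    (\<forall>F N. finite F \<and> F \<subseteq> carrier G \<longrightarrow>
      (\<exists>\<Lambda>1 \<Lambda>2. subgroup \<Lambda>1 G \<and> subgroup \<Lambda>2 G \<and> \<Lambda>1 \<subseteq> \<Lambda>2 \<and>
        (infinite \<Lambda>1 \<or> N \<le> card \<Lambda>1) \<and> (infinite \<Lambda>2 \<or> N \<le> card \<Lambda>2) \<and>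
        almost_finite (G\<lparr>carrier := \<Lambda>1\<rparr>) \<alpha> \<and>
        comparison_on_multisets (G\<lparr>carrier := \<Lambda>2\<rparr>) \<alpha> \<and>
        (\<forall>f\<in>F. (f <#\<^bsub>G\<^esub> \<Lambda>1) #>\<^bsub>G\<^esub> (inv\<^bsub>G\<^esub> f) \<subseteq> \<Lambda>2)))"

end

theory Submission
  imports Defs
begin

text \<open>
  Comparison. If \<open>\<mu> C < \<mu> V\<close> for all invariant \<open>\<mu>\<close>, then a compactness argument with finitely additive
  means gives a Folner set \<open>S\<close> such that every \<open>S\<close>-orbit segment meets \<open>V\<close> more often than \<open>C\<close> by a
  definite proportion. Good subgroups \<open>\<Lambda>\<^sub>1 \<le> \<Lambda>\<^sub>2\<close> are taken for the inverses of \<open>S\<close>. Dealing the levels of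
  a fine \<open>\<Lambda>\<^sub>1\<close>-castle out evenly splits \<open>C\<close> and \<open>V\<close> into \<open>|S|\<close> pieces of nearly equal measure, the piece
  with label \<open>s\<close> is moved by \<open>s\<^sup>-\<^sup>1\<close>, and comparison on multisets for \<open>\<Lambda>\<^sub>2\<close> applies to the moved pieces.

  Almost finiteness. The \<open>\<Lambda>\<^sub>1\<close>-castles cut the space into small open pieces up to small measure, and
  iterating this gives neighbourhoods with boundaries null for every invariant measure. With these the
  Ornstein-Weiss quasi-tiling argument can be run with open towers: each round of greedy tiling by one
  Folner shape shrinks the uncovered measure by a fixed factor, uniformly in the invariant measure. The
  closed remainder is absorbed by comparison.
\<close>

section \<open>Invariant measures from finitely additive means\<close>

text \<open>A limit of orbit counts is only finitely additive, so the strict inequality needs slack: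
  C is thickened to a closed C' and V is thinned to a closed K. Means on all subsets live in a
  product of intervals, so their limits come from Tychonoff's theorem. The conjugation clause of
  good subgroups enters through push-forwards. Moving a piece by \<open>inv x\<close> and applying a
  \<Lambda>2-invariant measure is the same as applying its push-forward under x to the piece itself,
  and that push-forward is \<Lambda>1-invariant. One \<Lambda>1-castle therefore splits the sets
  evenly for all these measures at once. Many elements in \<Lambda>1 force long towers, so that
  rounding by one level per tower is cheap. In the quasi-tiling the bases have to be open, which
  loses the points that are moved onto the frontier of what is already covered; hence the null
  boundaries. A shape placed late is chosen before the earlier tiles, because those must be almost
  invariant under its inverses. Finally, an infinite group allows tiles so large that a small
  proportion of one is at least a whole level.\<close>

lemma compact_shrink:
  fixes U :: "'i \<Rightarrow> 'x::metric_space set"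
  assumes "finite I" "compact K" "\<And>i. i \<in> I \<Longrightarrow> open (U i)" "K \<subseteq> (\<Union>i\<in>I. U i)"
  shows "\<exists>D. (\<forall>i\<in>I. compact (D i) \<and> D i \<subseteq> U i) \<and> K = (\<Union>i\<in>I. D i)"
  using assms
proof (induction I arbitrary: K rule: finite_induct)
  case empty
  then show ?case by auto
next
  case (insert i I)
  let ?V = "\<Union>j\<in>I. U j"
  have op: "open (U i)" "open ?V"
    using insert by auto
  have "closed (K - ?V)" "closed (K - U i)" "(K - ?V) \<inter> (K - U i) = {}"
    using insert op compact_imp_closed[OF insert.prems(1)] by (auto intro: closed_Diff)
  \<comment> \<open>Removing O1 from K leaves a compact part of the other sets, removing O2 leaves a
    compact part of \<open>U i\<close>, and nothing is lost because O1 and O2 are disjoint.\<close>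
  then obtain O1 O2 where O: "open O1" "open O2" "K - ?V \<subseteq> O1" "K - U i \<subseteq> O2" "O1 \<inter> O2 = {}"
    using t4_space[of "K - ?V" "K - U i"] by blast
  have "compact (K - O1)" "K - O1 \<subseteq> ?V"
    using O insert by (auto simp: compact_diff)
  then obtain D where D: "\<forall>j\<in>I. compact (D j) \<and> D j \<subseteq> U j" "K - O1 = (\<Union>j\<in>I. D j)"
    using insert.IH[of "K - O1"] insert.prems by auto
  let ?D = "D(i := K - O2)"
  have "\<forall>j\<in>insert i I. compact (?D j) \<and> ?D j \<subseteq> U j"
    using D O insert by (auto simp: compact_diff)
  moreover have "K = (\<Union>j\<in>insert i I. ?D j)"
  proof -
    have "(\<Union>j\<in>insert i I. ?D j) = (K - O2) \<union> (\<Union>j\<in>I. D j)"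
      using insert.hyps by auto
    also have "\<dots> = K"
      using D(2) O(5) by auto
    finally show ?thesis by simp
  qed
  ultimately show ?case by blast
qed

text \<open>The classical outer measure of a content on compact sets: inner approximation on open
  sets, then outer approximation for the rest. Only the values of m on compact sets enter, which is
  why finite additivity of m suffices.\<close>

definition content_outer :: "('x::topological_space set \<Rightarrow> real) \<Rightarrow> 'x set \<Rightarrow> ennreal"
  where "content_outer m A =
    (INF U\<in>{U. open U \<and> A \<subseteq> U}. SUP K\<in>{K. compact K \<and> K \<subseteq> U}. ennreal (m K))"

text \<open>A mean is defined on the whole power set, so that no measurability has to survive a
  limit and each axiom is a closed condition on finitely many coordinates.\<close>

locale finite_mean =
  fixes m :: "'x::metric_space set \<Rightarrow> real"
  assumes compact_space: "compact (UNIV :: 'x set)"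
    and mean_nonneg: "0 \<le> m A"
    and mean_Un: "A \<inter> B = {} \<Longrightarrow> m (A \<union> B) = m A + m B"
    and mean_UNIV: "m UNIV = 1"
begin

lemma mean_empty: "m {} = 0"
  using mean_Un[of "{}" "{}"] by simp

lemma mean_mono: "A \<subseteq> B \<Longrightarrow> m A \<le> m B"
  using mean_Un[of A "B - A"] mean_nonneg[of "B - A"] by (simp add: Un_absorb1)

lemma mean_subadd: "m (A \<union> B) \<le> m A + m B"
  using mean_Un[of A "B - A"] mean_mono[of "B - A" B] by simp

lemma mean_UN_le: "finite I \<Longrightarrow> m (\<Union>i\<in>I. D i) \<le> (\<Sum>i\<in>I. m (D i))"
proof (induction I rule: finite_induct)
  case empty then show ?case by (simp add: mean_empty)
next
  case (insert i I)
  then show ?case using mean_subadd[of "D i" "\<Union>i\<in>I. D i"] by simp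
qed

abbreviation inner_content :: "'x set \<Rightarrow> ennreal"
  where "inner_content U \<equiv> SUP K\<in>{K. compact K \<and> K \<subseteq> U}. ennreal (m K)"

lemma inner_content_mono: "U \<subseteq> V \<Longrightarrow> inner_content U \<le> inner_content V"
  by (rule SUP_subset_mono) auto

lemma content_outer_open: "open U \<Longrightarrow> content_outer m U = inner_content U"
  unfolding content_outer_def
  by (rule antisym) (auto intro!: INF_lower INF_greatest inner_content_mono)

lemma content_outer_mono: "A \<subseteq> B \<Longrightarrow> content_outer m A \<le> content_outer m B"
  unfolding content_outer_def by (rule INF_superset_mono) auto

lemma content_outer_le: "open U \<Longrightarrow> A \<subseteq> U \<Longrightarrow> content_outer m A \<le> inner_content U"
  unfolding content_outer_def by (rule INF_lower) auto

lemma content_outer_UNIV: "content_outer m UNIV = 1"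
proof -
  have "inner_content UNIV = 1"
  proof (rule antisym)
    show "inner_content UNIV \<le> 1"
      using mean_mono[of _ UNIV] mean_UNIV by (auto intro!: SUP_least)
    show "1 \<le> inner_content UNIV"
      by (rule SUP_upper2[of UNIV]) (auto simp: compact_space mean_UNIV)
  qed
  then show ?thesis by (simp add: content_outer_open)
qed

text \<open>Compactness turns finite additivity into countable subadditivity: a compact set in the
  union meets only finitely many of the open sets essentially, and \<open>compact_shrink\<close>
  cuts it into compact pieces, one inside each.\<close>

lemma inner_content_UN:
  fixes U :: "nat \<Rightarrow> 'x set"
  assumes op: "\<And>n. open (U n)"
  shows "inner_content (\<Union>n. U n) \<le> (\<Sum>n. inner_content (U n))"
proof (rule SUP_least)
  fix K assume "K \<in> {K. compact K \<and> K \<subseteq> (\<Union>n. U n)}"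
  then have K: "compact K" "K \<subseteq> (\<Union>n. U n)" by auto
  obtain I where I: "finite I" "K \<subseteq> (\<Union>n\<in>I. U n)"
    using compactE_image[OF K(1), of UNIV U] op K(2) by auto
  obtain D where D: "\<forall>n\<in>I. compact (D n) \<and> D n \<subseteq> U n" "K = (\<Union>n\<in>I. D n)"
    using compact_shrink[OF I(1) K(1) op I(2)] by blast
  have "ennreal (m K) \<le> ennreal (\<Sum>n\<in>I. m (D n))"
    using mean_UN_le[OF I(1)] D(2) by (auto intro!: ennreal_leI)
  also have "\<dots> = (\<Sum>n\<in>I. ennreal (m (D n)))"
    by (simp add: mean_nonneg)
  also have "\<dots> \<le> (\<Sum>n\<in>I. inner_content (U n))"
    using D by (intro sum_mono SUP_upper) auto
  also have "\<dots> \<le> (\<Sum>n. inner_content (U n))"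
    by (rule sum_le_suminf) (auto simp: I)
  finally show "ennreal (m K) \<le> (\<Sum>n. inner_content (U n))" .
qed

lemma content_outer_subadditive: "content_outer m (\<Union>n. A n) \<le> (\<Sum>n. content_outer m (A n))"
  for A :: "nat \<Rightarrow> 'x set"
proof (rule ennreal_le_epsilon)
  fix e :: real assume e: "e > 0" "(\<Sum>n. content_outer m (A n)) < top_class.top"
  have "\<exists>U. open U \<and> A n \<subseteq> U \<and> inner_content U \<le> content_outer m (A n) + ennreal (e * (1/2)^Suc n)" for n
  proof -
    have fin: "content_outer m (A n) < \<infinity>"
      using content_outer_mono[of "A n" UNIV] content_outer_UNIV
      by (simp add: less_top[symmetric] top_unique)
         (metis ennreal_one_less_top leD)
    have "content_outer m (A n) < content_outer m (A n) + ennreal (e * (1/2)^Suc n)"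
    proof (cases "content_outer m (A n)" rule: ennreal_cases)
      case (real r)
      have "ennreal r < ennreal (r + e * (1/2)^Suc n)"
        using real(1) e(1) by (intro ennreal_lessI add_nonneg_pos) auto
      also have "\<dots> = ennreal r + ennreal (e * (1/2)^Suc n)"
        using real(1) e(1) by (intro ennreal_plus) auto
      finally show ?thesis by (simp only: real(2))
    qed (use fin in auto)
    then show ?thesis
      unfolding content_outer_def[of m "A n"] INF_less_iff
      by (metis (lifting) less_imp_le mem_Collect_eq)
  qed
  then obtain U where U: "\<And>n. open (U n)" "\<And>n. A n \<subseteq> U n"
    "\<And>n. inner_content (U n) \<le> content_outer m (A n) + ennreal (e * (1/2)^Suc n)"
    by metis
  have "content_outer m (\<Union>n. A n) \<le> inner_content (\<Union>n. U n)"
    using U by (intro content_outer_le) auto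
  also have "\<dots> \<le> (\<Sum>n. inner_content (U n))"
    using U by (intro inner_content_UN)
  also have "\<dots> \<le> (\<Sum>n. content_outer m (A n) + ennreal (e * (1/2)^Suc n))"
    using U by (intro suminf_le) auto
  also have "\<dots> = (\<Sum>n. content_outer m (A n)) + (\<Sum>n. ennreal (e * (1/2)^Suc n))"
    by (rule suminf_add[symmetric]) auto
  also have "(\<Sum>n. ennreal (e * (1/2)^Suc n)) = ennreal e"
  proof -
    have "(\<lambda>n. e * (1/2)^Suc n) sums (e * 1)"
      by (intro sums_mult power_half_series)
    then show ?thesis
      using e by (intro suminf_ennreal_eq) auto
  qed
  finally show "content_outer m (\<Union>n. A n) \<le> (\<Sum>n. content_outer m (A n)) + ennreal e" .
qed

lemma outer_measure_content_outer: "outer_measure_space UNIV (content_outer m)"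
  unfolding outer_measure_space_def positive_def increasing_def countably_subadditive_def
  using content_outer_mono content_outer_subadditive
  by (auto simp: content_outer_open mean_empty)

text \<open>This is the nontrivial half of the Caratheodory condition for open U. For K compact in W
  and U, the set W - K is an open neighbourhood of A - U, and its compact subsets are disjoint from
  K, so m adds up on them.\<close>

lemma content_outer_split:
  assumes "open U"
  shows "content_outer m (A \<inter> U) + content_outer m (A - U) \<le> content_outer m A"
  unfolding content_outer_def[of m A]
proof (rule INF_greatest)
  fix W assume "W \<in> {W. open W \<and> A \<subseteq> W}"
  then have W: "open W" "A \<subseteq> W" by auto
  have "ennreal (m K) + content_outer m (A - U) \<le> inner_content W" if K: "compact K" "K \<subseteq> W \<inter> U" for K
  proof -
    have "open (W - K)" "A - U \<subseteq> W - K"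
      using K W compact_imp_closed by (auto simp: open_Diff)
    then have "ennreal (m K) + content_outer m (A - U) \<le> ennreal (m K) + inner_content (W - K)"
      by (intro add_left_mono content_outer_le)
    also have "\<dots> = (SUP L\<in>{L. compact L \<and> L \<subseteq> W - K}. ennreal (m K) + ennreal (m L))"
      by (rule ennreal_SUP_add_right) auto
    also have "\<dots> \<le> inner_content W"
    proof (rule SUP_least)
      fix L assume L: "L \<in> {L. compact L \<and> L \<subseteq> W - K}"
      then have "m (K \<union> L) = m K + m L"
        by (intro mean_Un) blast
      then have "ennreal (m K) + ennreal (m L) = ennreal (m (K \<union> L))"
        using ennreal_plus[OF mean_nonneg mean_nonneg] by (simp only:)
      also have "\<dots> \<le> inner_content W"
        using K L by (intro SUP_upper) (auto intro: compact_Un)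
      finally show "ennreal (m K) + ennreal (m L) \<le> inner_content W" .
    qed
    finally show ?thesis .
  qed
  then have le: "(SUP K\<in>{K. compact K \<and> K \<subseteq> W \<inter> U}. ennreal (m K) + content_outer m (A - U)) \<le> inner_content W"
    by (intro SUP_least) auto
  have "content_outer m (A \<inter> U) \<le> inner_content (W \<inter> U)"
    using W assms by (intro content_outer_le) auto
  then have "content_outer m (A \<inter> U) + content_outer m (A - U)
      \<le> inner_content (W \<inter> U) + content_outer m (A - U)"
    by (rule add_right_mono)
  also have "\<dots> = (SUP K\<in>{K. compact K \<and> K \<subseteq> W \<inter> U}. ennreal (m K) + content_outer m (A - U))"
    by (rule ennreal_SUP_add_left[symmetric]) auto
  also note le
  finally show "content_outer m (A \<inter> U) + content_outer m (A - U) \<le> inner_content W" .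
qed

definition mean_measure :: "'x measure"
  where "mean_measure = measure_of UNIV (sets borel) (content_outer m)"

lemma sets_mean_measure [simp]: "sets mean_measure = sets borel"
  unfolding mean_measure_def using sets.sigma_sets_eq[of borel] by simp

lemma space_mean_measure [simp]: "space mean_measure = UNIV"
  unfolding mean_measure_def by simp

text \<open>Open sets are Caratheodory measurable by \<open>content_outer_split\<close> and
  subadditivity, hence the Borel sets are, and the outer measure is countably additive on
  them.\<close>

lemma emeasure_mean_measure:
  assumes "A \<in> sets borel"
  shows "emeasure mean_measure A = content_outer m A"
proof -
  let ?L = "lambda_system UNIV UNIV (content_outer m)"
  interpret P: sigma_algebra "UNIV :: 'x set" UNIV
    using sigma_algebra_Pow[of UNIV] by simp
  have ms: "measure_space UNIV ?L (content_outer m)"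
    by (rule P.caratheodory_lemma[OF outer_measure_content_outer])
  interpret L: sigma_algebra UNIV ?L
    using ms by (simp add: measure_space_def)
  have "{S. open S} \<subseteq> ?L"
  proof
    fix U :: "'x set" assume "U \<in> {S. open S}"
    then have "open U" by simp
    have "content_outer m A \<le> content_outer m (A \<inter> U) + content_outer m (A - U)" for A
    proof -
      let ?B = "\<lambda>n::nat. if n = 0 then A \<inter> U else if n = 1 then A - U else {}"
      have "A = (\<Union>n. ?B n)" by (auto split: if_splits)
      then have "content_outer m A \<le> (\<Sum>n. content_outer m (?B n))"
        using content_outer_subadditive[of ?B] by simp
      also have "\<dots> = (\<Sum>n\<in>{0,1}. content_outer m (?B n))"
        by (rule suminf_finite) (auto simp: content_outer_open mean_empty)
      finally show ?thesis by simp
    qed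
    then have "content_outer m (A \<inter> U) + content_outer m (A - U) = content_outer m A" for A
      using content_outer_split[OF \<open>open U\<close>, of A] by (intro antisym)
    then show "U \<in> ?L"
      by (simp add: lambda_system_def Diff_eq Int_commute)
  qed
  then have sub: "sets borel \<subseteq> ?L"
    unfolding borel_def using L.sigma_sets_subset by simp
  have ms': "measure_space UNIV (sets borel) (content_outer m)"
    using measure_down[OF ms _ sub] sets.sigma_algebra_axioms[of borel] by simp
  show ?thesis
    unfolding mean_measure_def
    using ms' assms unfolding measure_space_def by (intro emeasure_measure_of_sigma) blast+
qed

lemma prob_space_mean_measure: "prob_space mean_measure"
  by (rule prob_spaceI) (simp add: emeasure_mean_measure content_outer_UNIV)

lemma mean_le_measure:
  assumes "open U" "K \<subseteq> U" "compact K"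
  shows "m K \<le> measure mean_measure U"
proof -
  interpret prob_space mean_measure by (rule prob_space_mean_measure)
  have "ennreal (m K) \<le> emeasure mean_measure U"
    using assms by (auto simp: emeasure_mean_measure content_outer_open intro!: SUP_upper)
  then show ?thesis
    by (simp add: emeasure_eq_measure)
qed

lemma mean_measure_open_approx:
  assumes "open U" "0 < e"
  shows "\<exists>K. compact K \<and> K \<subseteq> U \<and> measure mean_measure U \<le> m K + e"
proof (rule ccontr)
  interpret prob_space mean_measure by (rule prob_space_mean_measure)
  assume neg: "\<not> ?thesis"
  then have *: "m K \<le> measure mean_measure U - e" if "compact K" "K \<subseteq> U" for K
    using that by (meson le_diff_eq linear)
  have "0 \<le> measure mean_measure U - e"
    using *[of "{}"] by (simp add: mean_empty)
  moreover have "emeasure mean_measure U \<le> ennreal (measure mean_measure U - e)"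
    using assms * by (auto simp: emeasure_mean_measure content_outer_open intro!: SUP_least ennreal_leI)
  ultimately show False
    using assms by (simp add: emeasure_eq_measure)
qed

lemma mean_measure_outer:
  assumes "A \<in> sets borel" "0 < e"
  shows "\<exists>U. open U \<and> A \<subseteq> U \<and> measure mean_measure U \<le> measure mean_measure A + e"
proof -
  interpret prob_space mean_measure by (rule prob_space_mean_measure)
  have "content_outer m A < emeasure mean_measure A + ennreal e"
    using assms by (simp add: emeasure_mean_measure[symmetric] emeasure_eq_measure
        flip: ennreal_plus) (simp add: ennreal_lessI measure_nonneg)
  then obtain U where "open U" "A \<subseteq> U" "inner_content U < emeasure mean_measure A + ennreal e"
    unfolding content_outer_def INF_less_iff by auto
  moreover from this have "emeasure mean_measure U = inner_content U"
    by (simp add: emeasure_mean_measure content_outer_open)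
  ultimately have "ennreal (measure mean_measure U) < ennreal (measure mean_measure A + e)"
    using assms by (simp add: emeasure_eq_measure)
  then show ?thesis
    using \<open>open U\<close> \<open>A \<subseteq> U\<close> assms
    by (metis ennreal_less_iff less_imp_le measure_nonneg)
qed

lemma regular_mean_measure: "regular_measure mean_measure"
  unfolding regular_measure_def
proof safe
  interpret prob_space mean_measure by (rule prob_space_mean_measure)
  fix A assume "A \<in> sets mean_measure"
  then have A: "A \<in> sets borel" by simp
  have "emeasure mean_measure A \<le> (SUP K\<in>{K. K \<subseteq> A \<and> compact K}. emeasure mean_measure K)"
  proof (rule ennreal_le_epsilon)
    fix e :: real assume "e > 0"
    \<comment> \<open>Inner regularity at A is outer regularity at its complement, since complements
      of open sets are compact here.\<close>
    then obtain U where U: "open U" "- A \<subseteq> U" "measure mean_measure U \<le> measure mean_measure (- A) + e"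
      using mean_measure_outer[of "- A" e] A by auto
    have K: "compact (- U)" "- U \<subseteq> A"
      using compact_space U by (auto simp: Compl_eq_Diff_UNIV compact_diff)
    have "measure mean_measure A \<le> measure mean_measure (- U) + e"
      using U(3) prob_compl[of U] prob_compl[of A] A U(1) by (simp add: Compl_eq_Diff_UNIV)
    then have "emeasure mean_measure A \<le> emeasure mean_measure (- U) + ennreal e"
      using \<open>e > 0\<close> by (simp add: emeasure_eq_measure flip: ennreal_plus)
    also have "\<dots> \<le> (SUP K\<in>{K. K \<subseteq> A \<and> compact K}. emeasure mean_measure K) + ennreal e"
      using K by (intro add_right_mono SUP_upper) auto
    finally show "emeasure mean_measure A \<le> \<dots>" .
  qed
  then show "emeasure mean_measure A = (SUP K\<in>{K. K \<subseteq> A \<and> compact K}. emeasure mean_measure K)"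
    using A by (intro antisym) (auto intro!: SUP_least emeasure_mono)
  show "emeasure mean_measure A = (INF U\<in>{U. A \<subseteq> U \<and> open U}. emeasure mean_measure U)"
    using A by (subst emeasure_mean_measure, simp, subst content_outer_def)
      (auto simp: emeasure_mean_measure content_outer_open conj_commute intro!: INF_cong)
qed

lemma content_outer_image:
  fixes f :: "'x \<Rightarrow> 'x"
  assumes hom: "homeomorphism UNIV UNIV f h" and inv: "\<And>A. m (f ` A) = m A"
  shows "content_outer m (f ` A) = content_outer m A"
proof -
  have fh: "f (h x) = x" "h (f x) = x" for x
    using hom by (auto simp: homeomorphism_def)
  have cf: "continuous_on UNIV f" "continuous_on UNIV h"
    using hom by (auto simp: homeomorphism_def)
  have opf: "open (f ` U) \<longleftrightarrow> open U" for U
    using homeomorphism_imp_open_map[OF hom, of U]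
      homeomorphism_imp_open_map[OF homeomorphism_symD[OF hom], of "f ` U"] fh
    by (auto simp: image_image)
  have cpf: "compact (f ` U) \<longleftrightarrow> compact U" for U
    using compact_continuous_image[OF continuous_on_subset[OF cf(1)], of U]
      compact_continuous_image[OF continuous_on_subset[OF cf(2)], of "f ` U"] fh
    by (auto simp: image_image)
  have im: "f ` (h ` U) = U" for U
    by (simp add: image_image fh)
  have injf: "inj f" by (metis fh(2) injI)
  have *: "inner_content (f ` U) = inner_content U" for U
  proof -
    have "{K. compact K \<and> K \<subseteq> f ` U} = (`) f ` {K. compact K \<and> K \<subseteq> U}"
    proof (safe)
      fix K assume K: "compact K" "K \<subseteq> f ` U"
      then have "h ` K \<subseteq> U" using fh by auto
      then show "K \<in> (`) f ` {K. compact K \<and> K \<subseteq> U}"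
        using K im[of K] cpf[of "h ` K"] by (intro image_eqI[of _ _ "h ` K"]) auto
    qed (auto simp: cpf)
    then show ?thesis by (simp add: image_image inv)
  qed
  have "{U. open U \<and> f ` A \<subseteq> U} = (`) f ` {U. open U \<and> A \<subseteq> U}"
  proof (safe)
    fix K assume K: "open K" "f ` A \<subseteq> K"
    have "A \<subseteq> h ` K"
    proof
      fix x assume "x \<in> A"
      then show "x \<in> h ` K" using K(2) fh by (intro image_eqI[of _ _ "f x"]) auto
    qed
    then show "K \<in> (`) f ` {K. open K \<and> A \<subseteq> K}"
      using K im[of K] opf[of "h ` K"] by (intro image_eqI[of _ _ "h ` K"]) auto
  qed (auto simp: opf)
  then show ?thesis
    by (simp add: content_outer_def image_image *)
qed

end

section \<open>Invariant means as limits of orbit frequencies\<close>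

lemma closed_thicken:
  fixes C :: "'x::metric_space set"
  assumes "closed C" "open U" "C \<subseteq> U"
  shows "\<exists>C'. closed C' \<and> C \<subseteq> interior C' \<and> C' \<subseteq> U"
proof -
  obtain O1 O2 where O: "open O1" "open O2" "C \<subseteq> O1" "- U \<subseteq> O2" "O1 \<inter> O2 = {}"
    using t4_space[of C "- U"] assms by (metis closed_Compl disjoint_eq_subset_Compl double_complement)
  have "closed (- O2)" "C \<subseteq> interior (- O2)" "- O2 \<subseteq> U"
    using O interior_maximal[of O1 "- O2"] by auto
  then show ?thesis by blast
qed

text \<open>In a directed family every finite subfamily has a member below all of it, so the finite
  intersection property only has to be checked for single members.\<close>

lemma compact_directed_Inter:
  assumes "compact P" "I \<noteq> {}" "\<And>i. i \<in> I \<Longrightarrow> closed (f i)" "\<And>i. i \<in> I \<Longrightarrow> P \<inter> f i \<noteq> {}"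
    and dir: "\<And>i j. i \<in> I \<Longrightarrow> j \<in> I \<Longrightarrow> \<exists>k\<in>I. f k \<subseteq> f i \<inter> f j"
  shows "P \<inter> (\<Inter>i\<in>I. f i) \<noteq> {}"
proof (rule compact_imp_fip_image[OF assms(1,3)])
  fix J assume J: "finite J" "J \<subseteq> I"
  have "\<exists>k\<in>I. f k \<subseteq> (\<Inter>i\<in>J. f i)"
    using J
  proof (induction J rule: finite_induct)
    case empty
    then show ?case using assms(2) by auto
  next
    case (insert i J)
    then obtain k where k: "k \<in> I" "f k \<subseteq> (\<Inter>i\<in>J. f i)" by blast
    obtain l where l: "l \<in> I" "f l \<subseteq> f i \<inter> f k" using dir[of i k] insert.prems k by blast
    then have "f l \<subseteq> (\<Inter>i\<in>insert i J. f i)" using k(2) by blast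
    then show ?case using l(1) by blast
  qed
  then obtain k where k: "k \<in> I" "f k \<subseteq> (\<Inter>i\<in>J. f i)" by blast
  have "P \<inter> f k \<subseteq> P \<inter> (\<Inter>i\<in>J. f i)"
    using k(2) by (rule Int_mono[OF subset_refl])
  then show "P \<inter> (\<Inter>i\<in>J. f i) \<noteq> {}"
    using assms(4)[OF k(1)] by fast
qed

locale compact_action =
  fixes G :: "('g, 'm) monoid_scheme" (structure)
    and \<alpha> :: "'g \<Rightarrow> 'x::metric_space \<Rightarrow> 'x"
  assumes homeo_action: "homeo_action G \<alpha>"
    and compact_space: "compact (UNIV :: 'x set)"
begin

sublocale group_action G UNIV \<alpha>
  using homeo_action by (simp add: homeo_action_def)

sublocale group G
  using group_hom by (simp add: group_hom_def)

abbreviation \<M> :: "'x measure set"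
  where "\<M> \<equiv> invariant_measures G \<alpha>"

lemma act_mult: "g \<in> carrier G \<Longrightarrow> h \<in> carrier G \<Longrightarrow> \<alpha> (g \<otimes> h) x = \<alpha> g (\<alpha> h x)"
  by (simp add: composition_rule)

lemma act_one: "\<alpha> \<one> x = x"
  using fun_cong[OF id_eq_one, of x] by simp

lemma act_inv:
  assumes "g \<in> carrier G"
  shows "\<alpha> (inv g) (\<alpha> g x) = x" "\<alpha> g (\<alpha> (inv g) x) = x"
  using assms by (simp_all add: act_one flip: act_mult)

lemma act_image_mult: "g \<in> carrier G \<Longrightarrow> h \<in> carrier G \<Longrightarrow> \<alpha> g ` \<alpha> h ` A = \<alpha> (g \<otimes> h) ` A"
  by (simp add: image_image act_mult)

lemma act_image_one: "\<alpha> \<one> ` A = A"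
  by (simp add: act_one)

lemma mem_act: "g \<in> carrier G \<Longrightarrow> x \<in> \<alpha> g ` A \<longleftrightarrow> \<alpha> (inv g) x \<in> A"
  by (metis act_inv image_iff)

lemma mem_act_inv: "g \<in> carrier G \<Longrightarrow> x \<in> \<alpha> (inv g) ` A \<longleftrightarrow> \<alpha> g x \<in> A"
  by (simp add: mem_act)

lemma inj_act: "g \<in> carrier G \<Longrightarrow> inj (\<alpha> g)"
  using inj_prop by auto

lemma act_homeomorphism: "g \<in> carrier G \<Longrightarrow> \<exists>h. homeomorphism UNIV UNIV (\<alpha> g) h"
  using homeo_action by (simp add: homeo_action_def)

lemma continuous_act: "g \<in> carrier G \<Longrightarrow> continuous_on A (\<alpha> g)"
  using act_homeomorphism by (metis homeomorphism_cont1 continuous_on_subset top_greatest)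

lemma act_vimage: "g \<in> carrier G \<Longrightarrow> \<alpha> g ` A = \<alpha> (inv g) -` A"
  unfolding vimage_def using mem_act[of g] by blast

lemma open_act: "g \<in> carrier G \<Longrightarrow> open U \<Longrightarrow> open (\<alpha> g ` U)"
  by (simp add: act_vimage open_vimage continuous_act)

lemma closed_act: "g \<in> carrier G \<Longrightarrow> closed U \<Longrightarrow> closed (\<alpha> g ` U)"
  by (simp add: act_vimage closed_vimage continuous_act)

lemma compact_closed: "closed (K :: 'x set) \<Longrightarrow> compact K"
  using compact_space by (metis closed_Int_compact inf_top_right)

lemma measurable_act: "g \<in> carrier G \<Longrightarrow> \<alpha> g \<in> borel_measurable borel"
  by (rule borel_measurable_continuous_onI) (rule continuous_act)

lemma borel_act: "g \<in> carrier G \<Longrightarrow> A \<in> sets borel \<Longrightarrow> \<alpha> g ` A \<in> sets borel"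
  using measurable_sets_borel[OF measurable_act, of "inv g" A] by (simp add: act_vimage)

lemma finite_set_mult: "finite F \<Longrightarrow> finite S \<Longrightarrow> finite (F <#> S)"
  by (simp add: set_mult_def)

lemma approx_invariant_translate:
  fixes e :: real
  assumes "finite F" "finite S" "F \<subseteq> carrier G" "S \<subseteq> carrier G" "g \<in> F" "approx_invariant G F e S"
  shows "card ((\<otimes>) g ` S - S) \<le> e * card S"
proof -
  have "(\<otimes>) g ` S - S \<subseteq> sym_diff S (F <#> S)"
    using assms by (auto simp: set_mult_def)
  then have "card ((\<otimes>) g ` S - S) \<le> card (sym_diff S (F <#> S))"
    using assms by (intro card_mono) (auto simp: finite_set_mult)
  then show ?thesis
    using assms(6) unfolding approx_invariant_def by linarith
qed

text \<open>The empirical measure of the orbit segment of x along S; for finite nonempty S it is a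
  finitely additive probability on all subsets.\<close>

definition orbit_freq :: "'g set \<Rightarrow> 'x \<Rightarrow> 'x set \<Rightarrow> real"
  where "orbit_freq S x A = card {s\<in>S. \<alpha> s x \<in> A} / card S"

lemma orbit_freq_Un:
  assumes "finite S" "A \<inter> B = {}"
  shows "orbit_freq S x (A \<union> B) = orbit_freq S x A + orbit_freq S x B"
proof -
  have "{s\<in>S. \<alpha> s x \<in> A \<union> B} = {s\<in>S. \<alpha> s x \<in> A} \<union> {s\<in>S. \<alpha> s x \<in> B}"
    by auto
  moreover have "card ({s\<in>S. \<alpha> s x \<in> A} \<union> {s\<in>S. \<alpha> s x \<in> B}) = card {s\<in>S. \<alpha> s x \<in> A} + card {s\<in>S. \<alpha> s x \<in> B}"
    using assms by (intro card_Un_disjoint) auto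
  ultimately show ?thesis
    by (simp add: orbit_freq_def add_divide_distrib)
qed

lemma orbit_freq_bounds:
  assumes "finite S"
  shows "0 \<le> orbit_freq S x A" "orbit_freq S x A \<le> 1"
proof -
  have "card {s\<in>S. \<alpha> s x \<in> A} \<le> card S"
    using assms by (intro card_mono) auto
  then show "0 \<le> orbit_freq S x A" "orbit_freq S x A \<le> 1"
    by (auto simp: orbit_freq_def divide_le_eq_1)
qed

text \<open>Pulling A back by g amounts to counting along gS instead of S. Both sets have the same
  size, so the bound on gS - S also bounds S - gS, and it controls the error in either
  direction.\<close>

lemma orbit_freq_almost_invariant:
  fixes e :: real
  assumes S: "finite S" "S \<subseteq> carrier G" "S \<noteq> {}" and g: "g \<in> carrier G"
    and e: "card ((\<otimes>) g ` S - S) \<le> e * card S"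
  shows "\<bar>orbit_freq S x (\<alpha> (inv g) ` A) - orbit_freq S x A\<bar> \<le> e"
proof -
  let ?gS = "(\<otimes>) g ` S"
  have inj: "inj_on ((\<otimes>) g) S"
    using inj_on_subset[OF inj_on_cmult[OF g] S(2)] .
  have "bij_betw ((\<otimes>) g) {s\<in>S. \<alpha> s x \<in> \<alpha> (inv g) ` A} {t\<in>?gS. \<alpha> t x \<in> A}"
    unfolding bij_betw_def using S g inj by (auto simp: mem_act_inv act_mult inj_on_def subset_eq)
  then have c1: "card {s\<in>S. \<alpha> s x \<in> \<alpha> (inv g) ` A} = card {t\<in>?gS. \<alpha> t x \<in> A}"
    by (rule bij_betw_same_card)
  have cgS: "card ?gS = card S"
    by (rule card_image[OF inj])
  have c2: "card (S - ?gS) = card (?gS - S)"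
    using cgS S by (simp add: card_Diff_subset_Int Int_commute)
  have "card {t\<in>?gS. \<alpha> t x \<in> A} \<le> card ({t\<in>S. \<alpha> t x \<in> A} \<union> (?gS - S))"
    using S by (intro card_mono) auto
  then have u: "card {t\<in>?gS. \<alpha> t x \<in> A} \<le> card {t\<in>S. \<alpha> t x \<in> A} + card (?gS - S)"
    using card_Un_le order_trans by blast
  have "card {t\<in>S. \<alpha> t x \<in> A} \<le> card ({t\<in>?gS. \<alpha> t x \<in> A} \<union> (S - ?gS))"
    using S by (intro card_mono) auto
  then have l: "card {t\<in>S. \<alpha> t x \<in> A} \<le> card {t\<in>?gS. \<alpha> t x \<in> A} + card (S - ?gS)"
    using card_Un_le order_trans by blast
  have "\<bar>real (card {s\<in>S. \<alpha> s x \<in> \<alpha> (inv g) ` A}) - real (card {t\<in>S. \<alpha> t x \<in> A})\<bar> \<le> e * card S"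
    using u l c1 c2 e by linarith
  moreover have "0 < real (card S)"
    using S by (simp add: card_gt_0_iff)
  ultimately show ?thesis
    unfolding orbit_freq_def by (simp add: diff_divide_distrib[symmetric] pos_divide_le_eq)
qed

lemma compact_unit_cube: "compact {m :: 'x set \<Rightarrow> real. \<forall>A. 0 \<le> m A \<and> m A \<le> 1}"
proof -
  have "compactin (product_topology (\<lambda>_. euclidean) UNIV) (PiE (UNIV :: 'x set set) (\<lambda>_. {0..1::real}))"
    by (simp add: compactin_PiE)
  then have "compact (PiE (UNIV :: 'x set set) (\<lambda>_. {0..1::real}))"
    by (simp add: euclidean_product_topology)
  moreover have "PiE (UNIV :: 'x set set) (\<lambda>_. {0..1::real}) = {m. \<forall>A. 0 \<le> m A \<and> m A \<le> 1}"
    by (auto simp: PiE_UNIV_domain)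
  ultimately show ?thesis by simp
qed

lemma closed_means:
  "closed {m :: 'x set \<Rightarrow> real. (\<forall>A. 0 \<le> m A \<and> m A \<le> 1) \<and>
    (\<forall>A B. A \<inter> B = {} \<longrightarrow> m (A \<union> B) = m A + m B) \<and> m UNIV = 1}"
  by (intro closed_Collect_conj closed_Collect_all closed_Collect_imp closed_Collect_eq closed_Collect_le
      open_Collect_const continuous_intros continuous_on_product_coordinates)

lemma compact_means:
  "compact {m :: 'x set \<Rightarrow> real. (\<forall>A. 0 \<le> m A \<and> m A \<le> 1) \<and>
    (\<forall>A B. A \<inter> B = {} \<longrightarrow> m (A \<union> B) = m A + m B) \<and> m UNIV = 1}"
  using compact_Int_closed[OF compact_unit_cube closed_means] by (simp add: Collect_conj_eq)

text \<open>Each quadruple (F, e, C', K) imposes a closed condition on means, and an orbit frequency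
  satisfies it. The conditions are directed: enlarge F and K, shrink e and C'. By compactness some
  mean satisfies all of them, so the errors e disappear.\<close>

lemma invariant_mean_exists:
  fixes V :: "'x set"
  assumes C: "closed C"
    and ex: "\<And>F (e::real) C' K. finite F \<Longrightarrow> F \<noteq> {} \<Longrightarrow> F \<subseteq> carrier G \<Longrightarrow> 0 < e \<Longrightarrow> closed C' \<Longrightarrow> C \<subseteq> interior C' \<Longrightarrow>
      closed K \<Longrightarrow> K \<subseteq> V \<Longrightarrow>
      \<exists>S x. finite S \<and> S \<subseteq> carrier G \<and> approx_invariant G F e S \<and>
        card {s\<in>S. \<alpha> s x \<in> K} \<le> card {s\<in>S. \<alpha> s x \<in> C'} + e * card S"
  shows "\<exists>m. finite_mean m \<and> (\<forall>g\<in>carrier G. \<forall>A. m (\<alpha> g ` A) = m A) \<and>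
    (\<forall>C' K. closed C' \<and> C \<subseteq> interior C' \<and> closed K \<and> K \<subseteq> V \<longrightarrow> m K \<le> m C')"
proof -
  define P where "P = {m :: 'x set \<Rightarrow> real. (\<forall>A. 0 \<le> m A \<and> m A \<le> 1) \<and>
    (\<forall>A B. A \<inter> B = {} \<longrightarrow> m (A \<union> B) = m A + m B) \<and> m UNIV = 1}"
  define I where "I = {(F, e :: real, C', K). finite F \<and> F \<noteq> {} \<and> F \<subseteq> carrier G \<and> 0 < e \<and>
    closed C' \<and> C \<subseteq> interior C' \<and> closed K \<and> K \<subseteq> V}"
  define f where "f = (\<lambda>(F, e, C', K). {m \<in> P.
    (\<forall>g\<in>F. \<forall>A. \<bar>m (\<alpha> (inv g) ` A) - m A\<bar> \<le> e) \<and> m K \<le> m C' + e})"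
  have "P \<inter> (\<Inter>i\<in>I. f i) \<noteq> {}"
  proof (rule compact_directed_Inter)
    show "compact P" using compact_means by (simp add: P_def)
    have "({\<one>}, 1, UNIV, {}) \<in> I" by (auto simp: I_def)
    then show "I \<noteq> {}" by blast
  next
    fix i assume "i \<in> I"
    then obtain F e C' K where i: "i = (F, e, C', K)" "finite F" "F \<noteq> {}" "F \<subseteq> carrier G" "0 < e" "closed C'"
      "C \<subseteq> interior C'" "closed K" "K \<subseteq> V" by (auto simp: I_def)
    have "closed {m :: 'x set \<Rightarrow> real.
        (\<forall>g\<in>F. \<forall>A. \<bar>m (\<alpha> (inv g) ` A) - m A\<bar> \<le> e) \<and> m K \<le> m C' + e}"
      unfolding Ball_def
      by (intro closed_Collect_conj closed_Collect_all closed_Collect_imp closed_Collect_le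
        open_Collect_const continuous_intros continuous_on_product_coordinates)
    moreover have "closed P"
      unfolding P_def by (rule closed_means)
    ultimately have "closed (P \<inter> {m.
        (\<forall>g\<in>F. \<forall>A. \<bar>m (\<alpha> (inv g) ` A) - m A\<bar> \<le> e) \<and> m K \<le> m C' + e})"
      by (rule closed_Int[rotated])
    moreover have "P \<inter> {m. (\<forall>g\<in>F. \<forall>A. \<bar>m (\<alpha> (inv g) ` A) - m A\<bar> \<le> e) \<and> m K \<le> m C' + e} = f i"
      by (simp add: f_def i(1) Collect_conj_eq)
    ultimately show "closed (f i)" by (simp only:)
    obtain S x where S: "finite S" "S \<subseteq> carrier G" "approx_invariant G F e S"
      "card {s\<in>S. \<alpha> s x \<in> K} \<le> card {s\<in>S. \<alpha> s x \<in> C'} + e * card S"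
      using ex[OF i(2-9)] by blast
    have ne: "S \<noteq> {}"
      using S(3) by (auto simp: approx_invariant_def)
    have "orbit_freq S x K \<le> orbit_freq S x C' + e"
    proof -
      have "0 < real (card S)" using ne S by (simp add: card_gt_0_iff)
      then show ?thesis
        using S(4) by (simp add: orbit_freq_def field_simps)
    qed
    moreover have "\<bar>orbit_freq S x (\<alpha> (inv g) ` A) - orbit_freq S x A\<bar> \<le> e" if "g \<in> F" for g A
      using orbit_freq_almost_invariant[OF S(1,2) ne] approx_invariant_translate[OF i(2) S(1) i(4) S(2) that S(3)] that i
      by blast
    moreover have "orbit_freq S x UNIV = 1"
      using ne S by (simp add: orbit_freq_def)
    then have "orbit_freq S x \<in> P"
      using orbit_freq_bounds[OF S(1)] orbit_freq_Un[OF S(1)] by (simp add: P_def)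
    ultimately have "orbit_freq S x \<in> P \<inter> f i"
      by (simp add: i(1) f_def)
    then show "P \<inter> f i \<noteq> {}" by blast
  next
    fix i j assume ij: "i \<in> I" "j \<in> I"
    obtain F e C' K where
      i: "i = (F, e, C', K)" "finite F" "F \<noteq> {}" "F \<subseteq> carrier G" "0 < e" "closed C'"
      "C \<subseteq> interior C'" "closed K" "K \<subseteq> V" using ij(1) by (auto simp: I_def)
    obtain F1 e1 C1 K1 where
      j: "j = (F1, e1, C1, K1)" "finite F1" "F1 \<noteq> {}" "F1 \<subseteq> carrier G" "0 < e1" "closed C1"
      "C \<subseteq> interior C1" "closed K1" "K1 \<subseteq> V" using ij(2) by (auto simp: I_def)
    let ?k = "(F \<union> F1, min e e1, C' \<inter> C1, K \<union> K1)"
    have k: "?k \<in> I" using i j by (auto simp: I_def)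
    have "m \<in> f i \<inter> f j" if m: "m \<in> f ?k" for m
    proof -
      have mP: "m \<in> P" and inv: "\<And>g A. g \<in> F \<union> F1 \<Longrightarrow> \<bar>m (\<alpha> (inv g) ` A) - m A\<bar> \<le> min e e1"
        and le: "m (K \<union> K1) \<le> m (C' \<inter> C1) + min e e1"
        using m unfolding f_def by auto
      have mono: "m A \<le> m B" if "A \<subseteq> B" for A B
      proof -
        have "m (A \<union> (B - A)) = m A + m (B - A)" "0 \<le> m (B - A)"
          using mP unfolding P_def by blast+
        then show ?thesis using that by (simp add: Un_absorb1)
      qed
      have "m K \<le> m C' + e" "m K1 \<le> m C1 + e1"
        using le mono[of K "K \<union> K1"] mono[of K1 "K \<union> K1"] mono[of "C' \<inter> C1" C'] mono[of "C' \<inter> C1" C1]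
        by auto
      moreover have "\<forall>g\<in>F. \<forall>A. \<bar>m (\<alpha> (inv g) ` A) - m A\<bar> \<le> e" "\<forall>g\<in>F1. \<forall>A. \<bar>m (\<alpha> (inv g) ` A) - m A\<bar> \<le> e1"
        using inv by force+
      ultimately show ?thesis using mP unfolding i(1) j(1) f_def by simp
    qed
    then show "\<exists>k\<in>I. f k \<subseteq> f i \<inter> f j" using k by (intro bexI[of _ ?k]) auto
  qed
  then obtain m where m: "m \<in> P" "\<And>i. i \<in> I \<Longrightarrow> m \<in> f i" by auto
  have inv: "m (\<alpha> g ` A) = m A" if g: "g \<in> carrier G" for g A
  proof -
    have "\<bar>m (\<alpha> g ` A) - m A\<bar> \<le> 0"
    proof (rule field_le_epsilon)
      fix e :: real assume "0 < e"
      \<comment> \<open>The conditions \<open>f\<close> speak of inverses of test elements, so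
        invariance under g is read off at \<open>inv g\<close>.\<close>
      then show "\<bar>m (\<alpha> g ` A) - m A\<bar> \<le> 0 + e"
        using m(2)[of "({inv g}, e, UNIV, {})"] g by (auto simp: I_def f_def)
    qed
    then show ?thesis by simp
  qed
  have le: "m K \<le> m C'" if K: "closed C'" "C \<subseteq> interior C'" "closed K" "K \<subseteq> V" for C' K
  proof (rule field_le_epsilon)
    fix e :: real assume "0 < e"
    then show "m K \<le> m C' + e"
      using m(2)[of "({\<one>}, e, C', K)"] K by (auto simp: I_def f_def)
  qed
  have "finite_mean m"
    using m(1) compact_space unfolding P_def finite_mean_def by blast
  moreover have "\<forall>g\<in>carrier G. \<forall>A. m (\<alpha> g ` A) = m A"
    using inv by (intro ballI allI)
  moreover have "\<forall>C' K. closed C' \<and> C \<subseteq> interior C' \<and> closed K \<and> K \<subseteq> V \<longrightarrow> m K \<le> m C'"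
    using le by (intro allI impI) (elim conjE)
  ultimately show ?thesis
    by (intro exI[of _ m] conjI)
qed

lemma mean_measure_invariant:
  assumes "finite_mean m" "\<And>g A. g \<in> carrier G \<Longrightarrow> m (\<alpha> g ` A) = m A"
  shows "finite_mean.mean_measure m \<in> \<M>"
proof -
  interpret finite_mean m by (rule assms(1))
  have "measure mean_measure (\<alpha> g ` A) = measure mean_measure A"
    if g: "g \<in> carrier G" and A: "A \<in> sets borel" for g A
  proof -
    obtain h where "homeomorphism UNIV UNIV (\<alpha> g) h"
      using act_homeomorphism[OF g] by blast
    then have "content_outer m (\<alpha> g ` A) = content_outer m A"
      using assms(2)[OF g] by (rule content_outer_image)
    then show ?thesis
      using g A borel_act by (simp add: measure_def emeasure_mean_measure)
  qed
  then show ?thesis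
    by (simp add: invariant_measures_def prob_space_mean_measure regular_mean_measure)
qed

text \<open>
  If the claim failed, a limit of the empirical means along ever more invariant sets would be an
  invariant mean giving \<open>V\<close> at most the mass of \<open>C\<close>, and so would the invariant measure it induces.
\<close>

lemma uniform_gap:
  assumes C: "closed C" and V: "open V"
    and lt: "\<forall>\<mu>\<in>\<M>. measure \<mu> C < measure \<mu> V"
  shows "\<exists>F (e::real) C' K. finite F \<and> F \<noteq> {} \<and> F \<subseteq> carrier G \<and> 0 < e \<and> closed C' \<and> C \<subseteq> interior C' \<and> closed K \<and> K \<subseteq> V \<and>
    (\<forall>S x. finite S \<and> S \<subseteq> carrier G \<and> approx_invariant G F e S \<longrightarrow>
      card {s\<in>S. \<alpha> s x \<in> C'} + e * card S < card {s\<in>S. \<alpha> s x \<in> K})"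
proof (rule ccontr)
  assume neg: "\<not> ?thesis"
  have "\<exists>S x. finite S \<and> S \<subseteq> carrier G \<and> approx_invariant G F e S \<and>
        card {s\<in>S. \<alpha> s x \<in> K} \<le> card {s\<in>S. \<alpha> s x \<in> C'} + e * card S"
    if "finite F" "F \<noteq> {}" "F \<subseteq> carrier G" "0 < e" "closed C'" "C \<subseteq> interior C'"
      "closed K" "K \<subseteq> V" for F C' K and e :: real
  proof (rule ccontr)
    assume "\<not> ?thesis"
    then have "\<forall>S x. finite S \<and> S \<subseteq> carrier G \<and> approx_invariant G F e S \<longrightarrow>
      card {s\<in>S. \<alpha> s x \<in> C'} + e * card S < card {s\<in>S. \<alpha> s x \<in> K}"
      by (simp add: not_le)
    then show False using neg that by blast
  qed
  then have "\<exists>m. finite_mean m \<and> (\<forall>g\<in>carrier G. \<forall>A. m (\<alpha> g ` A) = m A) \<and>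
    (\<forall>C' K. closed C' \<and> C \<subseteq> interior C' \<and> closed K \<and> K \<subseteq> V \<longrightarrow> m K \<le> m C')"
    by (rule invariant_mean_exists[OF C])
  then obtain m where m: "finite_mean m" "\<forall>g\<in>carrier G. \<forall>A. m (\<alpha> g ` A) = m A"
    and le: "\<forall>C' K. closed C' \<and> C \<subseteq> interior C' \<and> closed K \<and> K \<subseteq> V \<longrightarrow> m K \<le> m C'"
    by (elim exE conjE)
  interpret finite_mean m by (rule m(1))
  \<comment> \<open>The mean and its measure are comparable only across a compact set inside an open
    one. Hence V is replaced by a compact K inside it and C by an open U with C' in between, at a
    cost of e each.\<close>
  have "measure mean_measure V \<le> measure mean_measure C + 2 * e" if e: "0 < e" for e
  proof -
    obtain K where K: "compact K" "K \<subseteq> V" "measure mean_measure V \<le> m K + e"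
      using mean_measure_open_approx[OF V e] by blast
    obtain U where U: "open U" "C \<subseteq> U" "measure mean_measure U \<le> measure mean_measure C + e"
      using mean_measure_outer[OF _ e, of C] C by auto
    obtain C' where C': "closed C'" "C \<subseteq> interior C'" "C' \<subseteq> U"
      using closed_thicken[OF C U(1,2)] by blast
    have "m K \<le> m C'"
      using le C' K compact_imp_closed[OF K(1)] by blast
    also have "\<dots> \<le> measure mean_measure U"
      using mean_le_measure[OF U(1) C'(3)] compact_closed C' by blast
    finally show ?thesis using K U by linarith
  qed
  then have "measure mean_measure V \<le> measure mean_measure C + e" if "0 < e" for e
    using that by (metis field_sum_of_halves half_gt_zero mult_2)
  then have "measure mean_measure V \<le> measure mean_measure C"
    by (rule field_le_epsilon)
  then show False
    using bspec[OF lt mean_measure_invariant[OF m(1)]] m(2) by auto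
qed

section \<open>Castles and subequivalence\<close>

text \<open>Regularity is left out and invariance is asked under a bare set of elements, so that
  push-forwards qualify without further proof. Every regular invariant measure is an instance, so
  bounds proved for \<open>inv_under\<close> apply to the measures in the definitions of
  comparison.\<close>

definition inv_under :: "'g set \<Rightarrow> 'x measure \<Rightarrow> bool"
  where "inv_under H \<nu> \<longleftrightarrow> sets \<nu> = sets borel \<and> prob_space \<nu> \<and>
    (\<forall>g\<in>H. \<forall>A\<in>sets borel. measure \<nu> (\<alpha> g ` A) = measure \<nu> A)"

lemma inv_underD:
  assumes "inv_under H \<nu>"
  shows "sets \<nu> = sets borel" "prob_space \<nu>"
    "\<And>g A. g \<in> H \<Longrightarrow> A \<in> sets borel \<Longrightarrow> measure \<nu> (\<alpha> g ` A) = measure \<nu> A"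
  using assms by (auto simp: inv_under_def)

lemma inv_under_subset: "inv_under H \<nu> \<Longrightarrow> H' \<subseteq> H \<Longrightarrow> inv_under H' \<nu>"
  by (auto simp: inv_under_def)

lemma inv_under_invariant_measures:
  "\<nu> \<in> invariant_measures (G\<lparr>carrier := H\<rparr>) \<alpha> \<Longrightarrow> inv_under H \<nu>"
  by (auto simp: inv_under_def invariant_measures_def)

lemma inv_under_carrier: "\<nu> \<in> \<M> \<Longrightarrow> inv_under (carrier G) \<nu>"
  by (auto simp: inv_under_def invariant_measures_def)

lemma measure_distr_act:
  assumes "sets \<nu> = sets borel" "g \<in> carrier G" "A \<in> sets borel"
  shows "measure (distr \<nu> borel (\<alpha> g)) A = measure \<nu> (\<alpha> (inv g) ` A)"
proof -
  have sp: "space \<nu> = UNIV"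
    using sets_eq_imp_space_eq[OF assms(1)] by simp
  have "\<alpha> g \<in> measurable \<nu> borel"
    using measurable_act[OF assms(2)] assms(1) by (simp cong: measurable_cong_sets)
  then show ?thesis
    using assms by (simp add: measure_distr sp act_vimage)
qed

text \<open>Translating by h before pulling back along g is translating by
  \<open>inv g \<otimes> h \<otimes> g\<close> after it. This is the point at which conjugates of
  one subgroup inside another are exploited.\<close>

lemma inv_under_distr:
  assumes "inv_under H2 \<nu>" "g \<in> carrier G" "H1 \<subseteq> carrier G" "H2 \<subseteq> carrier G"
    and conj: "\<And>h. h \<in> H1 \<Longrightarrow> inv g \<otimes> h \<otimes> g \<in> H2"
  shows "inv_under H1 (distr \<nu> borel (\<alpha> g))"
proof -
  note d = inv_underD[OF assms(1)]
  have "\<alpha> g \<in> measurable \<nu> borel"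
    using measurable_act[OF assms(2)] d(1) by (simp cong: measurable_cong_sets)
  then have "prob_space (distr \<nu> borel (\<alpha> g))"
    using d(2) by (rule prob_space.prob_space_distr[rotated])
  moreover have "measure (distr \<nu> borel (\<alpha> g)) (\<alpha> h ` A) = measure (distr \<nu> borel (\<alpha> g)) A"
    if h: "h \<in> H1" and A: "A \<in> sets borel" for h A
  proof -
    have hG: "h \<in> carrier G" using h assms(3) by blast
    have eq: "(inv g \<otimes> h \<otimes> g) \<otimes> inv g = inv g \<otimes> h"
      using hG assms(2) by (simp add: m_assoc)
    have "\<alpha> (inv g) ` \<alpha> h ` A = \<alpha> (inv g \<otimes> h \<otimes> g) ` \<alpha> (inv g) ` A"
      using hG assms(2) by (simp add: act_image_mult eq)
    then show ?thesis
      using d(1) d(3)[OF conj[OF h], of "\<alpha> (inv g) ` A"] A hG assms(2)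
      by (simp add: measure_distr_act borel_act)
  qed
  ultimately show ?thesis
    by (simp add: inv_under_def)
qed

lemma measure_levels:
  assumes \<nu>: "inv_under H \<nu>" "H \<subseteq> carrier G" and I: "finite I"
    and T: "\<And>i. i \<in> I \<Longrightarrow> finite (T i)" "\<And>i. i \<in> I \<Longrightarrow> T i \<subseteq> H"
    and V: "\<And>i. i \<in> I \<Longrightarrow> V i \<in> sets borel"
    and disj: "disjoint_family_on (\<lambda>(i, s). \<alpha> s ` V i) (Sigma I T)"
  shows "measure \<nu> (\<Union>i\<in>I. \<Union>s\<in>T i. \<alpha> s ` V i) = (\<Sum>i\<in>I. card (T i) * measure \<nu> (V i))"
proof -
  note d = inv_underD[OF \<nu>(1)]
  interpret prob_space \<nu> by (rule d(2))
  have "(\<Union>i\<in>I. \<Union>s\<in>T i. \<alpha> s ` V i) = (\<Union>p\<in>Sigma I T. case p of (i, s) \<Rightarrow> \<alpha> s ` V i)"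
    by auto
  also have "measure \<nu> \<dots> = (\<Sum>p\<in>Sigma I T. measure \<nu> (case p of (i, s) \<Rightarrow> \<alpha> s ` V i))"
  proof (rule finite_measure_finite_Union)
    show "finite (Sigma I T)" using I T by auto
    show "(\<lambda>p. case p of (i, s) \<Rightarrow> \<alpha> s ` V i) ` Sigma I T \<subseteq> events"
      using borel_act[OF subsetD[OF \<nu>(2) subsetD[OF T(2)]] V] by (auto simp: d(1))
  qed (fact disj)
  also have "\<dots> = (\<Sum>i\<in>I. \<Sum>s\<in>T i. measure \<nu> (\<alpha> s ` V i))"
    using I T by (subst sum.Sigma) (auto intro!: sum.cong)
  also have "\<dots> = (\<Sum>i\<in>I. card (T i) * measure \<nu> (V i))"
    using d(3) V T(2) by (intro sum.cong refl) (simp add: subset_eq)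
  finally show ?thesis .
qed

section \<open>Subequivalence through indexed covers, and what a castle gives to invariant
  measures\<close>

definition packable :: "('g, 'k) monoid_scheme \<Rightarrow> 'x set \<Rightarrow> 'x set \<Rightarrow> bool"
  where "packable G' C B \<longleftrightarrow>
    (\<exists>\<U> s. finite \<U> \<and> (\<forall>U\<in>\<U>. open U) \<and> C \<subseteq> \<Union>\<U> \<and> s \<in> \<U> \<rightarrow> carrier G' \<and>
      disjoint_family_on (\<lambda>U. \<alpha> (s U) ` U) \<U> \<and> (\<forall>U\<in>\<U>. \<alpha> (s U) ` U \<subseteq> B))"

lemma subeq_iff_packable: "subeq G' \<alpha> A B \<longleftrightarrow> (\<forall>C. closed C \<and> C \<subseteq> A \<longrightarrow> packable G' C B)"
  by (simp add: subeq_def packable_def)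

lemma packable_mono:
  assumes "packable G' C B" "B \<subseteq> B'"
  shows "packable G' C B'"
proof -
  obtain \<U> s where U: "finite \<U>" "\<forall>U\<in>\<U>. open U" "C \<subseteq> \<Union>\<U>" "s \<in> \<U> \<rightarrow> carrier G'"
      "disjoint_family_on (\<lambda>U. \<alpha> (s U) ` U) \<U>" "\<forall>U\<in>\<U>. \<alpha> (s U) ` U \<subseteq> B"
    using assms(1) unfolding packable_def by (elim exE conjE)
  have "\<forall>U\<in>\<U>. \<alpha> (s U) ` U \<subseteq> B'"
    using U(6) assms(2) by (meson subset_trans)
  then show ?thesis
    unfolding packable_def using U(1-5) by (intro exI[of _ \<U>] exI[of _ s] conjI)
qed

text \<open>In \<open>packable\<close> the moving element is a function of the open set, so a family
  that repeats a set is first thinned to one index per set; the union does not change.\<close>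

lemma packableI:
  assumes I: "finite I" "\<forall>i\<in>I. open (W i)" "C \<subseteq> (\<Union>i\<in>I. W i)" "\<forall>i\<in>I. s i \<in> carrier G'"
    "disjoint_family_on (\<lambda>i. \<alpha> (s i) ` W i) I" "\<forall>i\<in>I. \<alpha> (s i) ` W i \<subseteq> B"
  shows "packable G' C B"
proof -
  obtain J where J: "J \<subseteq> I" "inj_on W J" "W ` I = W ` J"
    using iffD1[OF subset_image_inj[of "W ` I" W I] subset_refl] by (elim exE conjE)
  let ?s = "\<lambda>U. s (inv_into J W U)"
  have s: "?s (W j) = s j" if "j \<in> J" for j
    using that J(2) by (simp add: inv_into_f_f)
  have fin: "finite (W ` J)"
    using finite_subset[OF J(1) I(1)] by (rule finite_imageI)
  have cov: "C \<subseteq> \<Union>(W ` J)"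
    using I(3) J(3) by metis
  have dis: "disjoint_family_on (\<lambda>U. \<alpha> (?s U) ` U) (W ` J)"
    unfolding disjoint_family_on_def
  proof (intro ballI impI)
    fix U U' assume "U \<in> W ` J" "U' \<in> W ` J" and ne: "U \<noteq> U'"
    then obtain j j' where j: "j \<in> J" "U = W j" "j' \<in> J" "U' = W j'" by (elim imageE)
    with ne have "j \<noteq> j'" by metis
    then show "\<alpha> (?s U) ` U \<inter> \<alpha> (?s U') ` U' = {}"
      using I(5) j J(1) by (simp add: s disjoint_family_on_def subset_iff)
  qed
  have s1: "?s \<in> W ` J \<rightarrow> carrier G'" using s I(4) J(1) by (auto simp: subset_iff)
  have s2: "\<forall>U\<in>W ` J. \<alpha> (?s U) ` U \<subseteq> B"
  proof
    fix U assume "U \<in> W ` J"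
    then obtain j where j: "j \<in> J" "U = W j" by (elim imageE)
    then show "\<alpha> (?s U) ` U \<subseteq> B"
      using bspec[OF I(6) subsetD[OF J(1) j(1)]] by (simp add: s)
  qed
  have op: "\<forall>U\<in>W ` J. open U" using I(2) J(1) by (simp add: subset_iff)
  show ?thesis
    unfolding packable_def
    by (intro exI[of _ "W ` J"] exI[of _ ?s] conjI fin cov dis s1 s2 op)
qed

text \<open>The same thinning of repeated sets as in \<open>packableI\<close>, now also carrying the
  index of the target summand. Disjointness is asked only among sets sent to the same
  summand.\<close>

lemma subeq_sum_singleI_indexed:
  fixes G' :: "('g, 'k) monoid_scheme"
  assumes "\<And>C. closed C \<Longrightarrow> C \<subseteq> A \<Longrightarrow> \<exists>(I :: 'i set) W s k. finite I \<and> (\<forall>i\<in>I. open (W i)) \<and> C \<subseteq> (\<Union>i\<in>I. W i) \<and>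
    (\<forall>i\<in>I. s i \<in> carrier G' \<and> k i < length Bs \<and> \<alpha> (s i) ` W i \<subseteq> Bs ! k i) \<and>
    (\<forall>i\<in>I. \<forall>j\<in>I. i \<noteq> j \<longrightarrow> k i = k j \<longrightarrow> \<alpha> (s i) ` W i \<inter> \<alpha> (s j) ` W j = {})"
  shows "subeq_sum G' \<alpha> [A] Bs"
  unfolding subeq_sum_def
proof (intro allI impI)
  fix C assume "\<forall>i<length [A]. closed (C i) \<and> C i \<subseteq> [A] ! i"
  then have C: "closed (C 0)" "C 0 \<subseteq> A" by auto
  obtain I :: "'i set" and W s k where I: "finite I" "\<forall>i\<in>I. open (W i)" "C 0 \<subseteq> (\<Union>i\<in>I. W i)"
    "\<forall>i\<in>I. s i \<in> carrier G' \<and> k i < length Bs \<and> \<alpha> (s i) ` W i \<subseteq> Bs ! k i"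
    and dj: "\<forall>i\<in>I. \<forall>j\<in>I. i \<noteq> j \<longrightarrow> k i = k j \<longrightarrow> \<alpha> (s i) ` W i \<inter> \<alpha> (s j) ` W j = {}"
    using assms[OF C] by (elim exE conjE)
  obtain J where J: "J \<subseteq> I" "inj_on W J" "W ` I = W ` J"
    using iffD1[OF subset_image_inj[of "W ` I" W I] subset_refl] by (elim exE conjE)
  let ?s = "\<lambda>U. s (inv_into J W U)" and ?k = "\<lambda>U. k (inv_into J W U)"
  have s: "?s (W j) = s j" "?k (W j) = k j" if "j \<in> J" for j
    using that J(2) by (simp_all add: inv_into_f_f)
  have fin: "finite (W ` J)"
    using finite_subset[OF J(1) I(1)] by (rule finite_imageI)
  have cov: "C 0 \<subseteq> \<Union>(W ` J)"
    using I(3) J(3) by metis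
  have dis: "disjoint_family_on (\<lambda>(i, U). (\<alpha> (?s U) ` U) \<times> {?k U}) (SIGMA i:{..<length [A]}. W ` J)"
    unfolding disjoint_family_on_def
  proof (intro ballI impI)
    fix p q assume p: "p \<in> (SIGMA i:{..<length [A]}. W ` J)" and q: "q \<in> (SIGMA i:{..<length [A]}. W ` J)" and ne: "p \<noteq> q"
    from p obtain j where j: "j \<in> J" "p = (0, W j)" by auto
    from q obtain j' where j': "j' \<in> J" "q = (0, W j')" by auto
    from ne j j' have "j \<noteq> j'" by metis
    with dj j(1) j'(1) J(1) have "k j = k j' \<longrightarrow> \<alpha> (s j) ` W j \<inter> \<alpha> (s j') ` W j' = {}"
      by (simp add: subset_iff)
    then show "(case p of (i, U) \<Rightarrow> (\<alpha> (?s U) ` U) \<times> {?k U}) \<inter> (case q of (i, U) \<Rightarrow> (\<alpha> (?s U) ` U) \<times> {?k U}) = {}"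
      using j j' by (simp add: s) blast
  qed
  have 1: "\<forall>i<length [A]. finite (W ` J) \<and> (\<forall>U\<in>W ` J. open U) \<and> C i \<subseteq> \<Union>(W ` J) \<and>
          (\<forall>U\<in>W ` J. ?s U \<in> carrier G' \<and> ?k U < length Bs)"
    using fin cov I(2,4) J(1) by (simp add: s subset_iff)
  have 2: "\<forall>i<length [A]. \<forall>U\<in>W ` J. (\<alpha> (?s U) ` U) \<times> {?k U} \<subseteq> (\<Union>j<length Bs. (Bs ! j) \<times> {j})"
    using I(4) J(1) by (simp add: s subset_iff)
  show "\<exists>\<U> s k.
        (\<forall>i<length [A]. finite (\<U> i) \<and> (\<forall>U\<in>\<U> i. open U) \<and> C i \<subseteq> \<Union>(\<U> i) \<and>
          (\<forall>U\<in>\<U> i. s i U \<in> carrier G' \<and> k i U < length Bs)) \<and>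
        disjoint_family_on (\<lambda>(i, U). (\<alpha> (s i U) ` U) \<times> {k i U}) (SIGMA i:{..<length [A]}. \<U> i) \<and>
        (\<forall>i<length [A]. \<forall>U\<in>\<U> i.
          (\<alpha> (s i U) ` U) \<times> {k i U} \<subseteq> (\<Union>j<length Bs. (Bs ! j) \<times> {j}))"
    by (intro exI[of _ "\<lambda>_. W ` J"] exI[of _ "\<lambda>_. ?s"] exI[of _ "\<lambda>_. ?k"] conjI 1 2 dis)
qed

text \<open>A is closed, so the subequivalence may be tested on A itself, and R is the union of the
  resulting cover. The sets of the cover keep their measure when moved, and those sent to one
  summand are disjoint inside it. The bound thus reaches an open neighbourhood of A and is uniform
  in the measure.\<close>

lemma subeq_sum_single_cover:
  assumes H: "H \<subseteq> carrier G" and A: "closed A" and Bs: "\<And>B. B \<in> set Bs \<Longrightarrow> B \<in> sets borel"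
    and sub: "subeq_sum (G\<lparr>carrier := H\<rparr>) \<alpha> [A] Bs"
  shows "\<exists>R. open R \<and> A \<subseteq> R \<and>
    (\<forall>\<nu>. inv_under H \<nu> \<longrightarrow> measure \<nu> R \<le> (\<Sum>j<length Bs. measure \<nu> (Bs ! j)))"
proof -
  have "\<exists>\<U> s k.
        (\<forall>i<length [A]. finite (\<U> i) \<and> (\<forall>U\<in>\<U> i. open U) \<and> A \<subseteq> \<Union>(\<U> i) \<and>
          (\<forall>U\<in>\<U> i. s i U \<in> carrier (G\<lparr>carrier := H\<rparr>) \<and> k i U < length Bs)) \<and>
        disjoint_family_on (\<lambda>(i, U). (\<alpha> (s i U) ` U) \<times> {k i U}) (SIGMA i:{..<length [A]}. \<U> i) \<and>
        (\<forall>i<length [A]. \<forall>U\<in>\<U> i.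
          (\<alpha> (s i U) ` U) \<times> {k i U} \<subseteq> (\<Union>j<length Bs. (Bs ! j) \<times> {j}))"
    using sub[unfolded subeq_sum_def, rule_format, of "\<lambda>_. A"] A by simp
  then obtain \<U> s k where
    a: "\<forall>i<length [A]. finite (\<U> i) \<and> (\<forall>U\<in>\<U> i. open U) \<and> A \<subseteq> \<Union>(\<U> i) \<and>
          (\<forall>U\<in>\<U> i. s i U \<in> carrier (G\<lparr>carrier := H\<rparr>) \<and> k i U < length Bs)" and
    b: "disjoint_family_on (\<lambda>(i, U). (\<alpha> (s i U) ` U) \<times> {k i U}) (SIGMA i:{..<length [A]}. \<U> i)" and
    c: "\<forall>i<length [A]. \<forall>U\<in>\<U> i.
          (\<alpha> (s i U) ` U) \<times> {k i U} \<subseteq> (\<Union>j<length Bs. (Bs ! j) \<times> {j})"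
    by (elim exE conjE)
  define O' where "O' = \<U> 0"
  define t where "t = s 0"
  define l where "l = k (0::nat)"
  have fin: "finite O'" and op: "\<And>U. U \<in> O' \<Longrightarrow> open U" and cov: "A \<subseteq> \<Union>O'"
    and t: "\<And>U. U \<in> O' \<Longrightarrow> t U \<in> H" and l: "\<And>U. U \<in> O' \<Longrightarrow> l U < length Bs"
    using a by (auto simp: O'_def t_def l_def)
  have dis: "\<alpha> (t U) ` U \<inter> \<alpha> (t U') ` U' = {}" if "U \<in> O'" "U' \<in> O'" "U \<noteq> U'" "l U = l U'" for U U'
    using disjoint_family_onD[OF b, of "(0, U)" "(0, U')"] that by (auto simp: O'_def t_def l_def)
  have sub': "\<alpha> (t U) ` U \<subseteq> Bs ! l U" if "U \<in> O'" for U
    using c that by (auto simp: O'_def t_def l_def)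
  have "measure \<nu> (\<Union>O') \<le> (\<Sum>j<length Bs. measure \<nu> (Bs ! j))" if \<nu>: "inv_under H \<nu>" for \<nu>
  proof -
    note d = inv_underD[OF \<nu>]
    interpret prob_space \<nu> by (rule d(2))
    have tb: "\<alpha> (t U) ` U \<in> events" if "U \<in> O'" for U
      using borel_act t[OF that] H op[OF that] by (auto simp: d(1))
    have "measure \<nu> (\<Union>O') \<le> (\<Sum>U\<in>O'. measure \<nu> U)"
      using finite_measure_subadditive_finite[OF fin, of "\<lambda>U. U"] op by (auto simp: d(1) subset_eq)
    also have "\<dots> = (\<Sum>U\<in>O'. measure \<nu> (\<alpha> (t U) ` U))"
      using d(3) t op by (intro sum.cong) auto
    also have "\<dots> = (\<Sum>j<length Bs. \<Sum>U\<in>{U\<in>O'. l U = j}. measure \<nu> (\<alpha> (t U) ` U))"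
      using fin l by (intro sum.group[symmetric]) auto
    also have "\<dots> = (\<Sum>j<length Bs. measure \<nu> (\<Union>U\<in>{U\<in>O'. l U = j}. \<alpha> (t U) ` U))"
      using fin tb dis by (intro sum.cong refl finite_measure_finite_Union[symmetric])
        (auto simp: disjoint_family_on_def)
    also have "\<dots> \<le> (\<Sum>j<length Bs. measure \<nu> (Bs ! j))"
      using sub' Bs by (intro sum_mono finite_measure_mono) (auto simp: d(1))
    finally show ?thesis .
  qed
  moreover have "open (\<Union>O')" using op by blast
  ultimately show ?thesis using cov by blast
qed

lemma concat_replicate_sum:
  fixes f :: "'b \<Rightarrow> real"
  shows "(\<Sum>j<length (concat (map (\<lambda>(S, V). replicate (n S) V) c)). f (concat (map (\<lambda>(S, V). replicate (n S) V) c) ! j))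
    = (\<Sum>i<length c. n (fst (c ! i)) * f (snd (c ! i)))"
proof -
  have "(\<Sum>j<length (concat (map (\<lambda>(S, V). replicate (n S) V) c)). f (concat (map (\<lambda>(S, V). replicate (n S) V) c) ! j))
    = sum_list (map f (concat (map (\<lambda>(S, V). replicate (n S) V) c)))"
    by (simp add: sum_list_sum_nth atLeast0LessThan)
  also have "\<dots> = sum_list (map (\<lambda>(S, V). n S * f V) c)"
    by (induction c) (auto simp: sum_list_replicate)
  also have "\<dots> = (\<Sum>i<length c. n (fst (c ! i)) * f (snd (c ! i)))"
    by (simp add: sum_list_sum_nth atLeast0LessThan case_prod_beta)
  finally show ?thesis .
qed

lemma card_le_card_set_mult:
  assumes "finite F" "finite S" "F \<subseteq> carrier G" "S \<subseteq> carrier G" "S \<noteq> {}"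
  shows "card F \<le> card (F <#> S)"
proof -
  obtain s where s: "s \<in> S" using assms by blast
  then have "s \<in> carrier G" using assms by blast
  then have "inj_on (\<lambda>f. f \<otimes> s) F"
    using assms by (intro inj_onI) (meson right_cancel subsetD)
  then have "card F = card ((\<lambda>f. f \<otimes> s) ` F)" by (simp add: card_image)
  also have "\<dots> \<le> card (F <#> S)"
    using s assms by (intro card_mono finite_set_mult) (auto simp: set_mult_def)
  finally show ?thesis .
qed

text \<open>The product of F and S contains a right translate of F, yet exceeds S by at most card S
  elements. A large test set therefore forces large shapes.\<close>

lemma card_le_of_approx_invariant:
  assumes "finite F" "finite S" "F \<subseteq> carrier G" "S \<subseteq> carrier G" "e \<le> 1" "approx_invariant G F e S"
  shows "card F \<le> 2 * card S"
proof -
  have "S \<noteq> {}" using assms(6) by (auto simp: approx_invariant_def)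
  then have "card F \<le> card (F <#> S)"
    by (rule card_le_card_set_mult[OF assms(1-4)])
  also have "\<dots> \<le> card (sym_diff S (F <#> S) \<union> S)"
    using assms by (intro card_mono) (auto simp: finite_set_mult)
  also have "\<dots> \<le> card (sym_diff S (F <#> S)) + card S"
    by (rule card_Un_le)
  finally have "real (card F) \<le> card (sym_diff S (F <#> S)) + card S" by linarith
  also have "\<dots> \<le> card S + real (card S)"
    using assms(5,6) mult_right_mono[OF assms(5), of "real (card S)"] by (simp add: approx_invariant_def)
  finally show ?thesis by linarith
qed

lemma castle_tower: "castle G' \<alpha> c \<Longrightarrow> (S, V) \<in> set c \<Longrightarrow> tower G' \<alpha> S V"
  by (auto simp: castle_def)

text \<open>All that is used of almost finiteness: long towers with small levels, and an open
  remainder that is uniformly small in measure. The lengths come from testing with about N elements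
  of H, which explains the demand on the size of H.\<close>

lemma almost_finite_levels:
  assumes H: "subgroup H G" and af: "almost_finite (G\<lparr>carrier := H\<rparr>) \<alpha>" and N: "infinite H \<or> N \<le> card H"
    and "0 < \<delta>" "0 < \<epsilon>"
  shows "\<exists>(n::nat) S V R. (\<forall>i<n. finite (S i) \<and> S i \<subseteq> H \<and> N \<le> 2 * card (S i) \<and> open (V i) \<and>
      (\<forall>s\<in>S i. \<forall>x\<in>\<alpha> s ` V i. \<forall>y\<in>\<alpha> s ` V i. dist x y < \<delta>)) \<and>
    disjoint_family_on (\<lambda>(i, s). \<alpha> s ` V i) (Sigma {..<n} S) \<and>
    open R \<and> UNIV - (\<Union>i<n. \<Union>s\<in>S i. \<alpha> s ` V i) \<subseteq> R \<and>
    (\<forall>\<nu>. inv_under H \<nu> \<longrightarrow> measure \<nu> R \<le> \<epsilon>)"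
proof -
  have HG: "H \<subseteq> carrier G" using H by (rule subgroup.subset)
  let ?G = "G\<lparr>carrier := H\<rparr>"
  have "\<exists>F. finite F \<and> F \<subseteq> H \<and> F \<noteq> {} \<and> N \<le> card F"
  proof (cases "finite H")
    case True
    then show ?thesis using N subgroup.one_closed[OF H] by (intro exI[of _ H]) auto
  next
    case False
    \<comment> \<open>One element more than N keeps the test set nonempty when N = 0.\<close>
    obtain F where "finite F" "card F = Suc N" "F \<subseteq> H"
      using infinite_arbitrarily_large[OF False] by blast
    then show ?thesis by (intro exI[of _ F]) auto
  qed
  then obtain F where F: "finite F" "F \<subseteq> H" "F \<noteq> {}" "N \<le> card F" by blast
  \<comment> \<open>The three bounds serve the diameters, the measure of the remainder, and
    \<open>card_le_of_approx_invariant\<close>.\<close>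
  define e where "e = min (min \<delta> \<epsilon>) 1"
  have e: "0 < e" "e \<le> \<delta>" "e \<le> \<epsilon>" "e \<le> 1" using assms by (auto simp: e_def)
  have "\<exists>c. castle ?G \<alpha> c \<and>
      (\<forall>(S, V)\<in>set c. approx_invariant ?G F e S \<and> (\<forall>s\<in>S. diameter (\<alpha> s ` V) < e)) \<and>
      subeq_sum ?G \<alpha>
          [UNIV - (\<Union>(S, V)\<in>set c. \<Union>s\<in>S. \<alpha> s ` V)]
          (concat (map (\<lambda>(S, V). replicate (nat \<lfloor>e * real (card S)\<rfloor>) V) c))"
    using af F(1-3) e(1) unfolding almost_finite_def by simp
  then obtain c where c: "castle ?G \<alpha> c"
      "\<forall>(S, V)\<in>set c. approx_invariant ?G F e S \<and> (\<forall>s\<in>S. diameter (\<alpha> s ` V) < e)"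
      "subeq_sum ?G \<alpha>
          [UNIV - (\<Union>(S, V)\<in>set c. \<Union>s\<in>S. \<alpha> s ` V)]
          (concat (map (\<lambda>(S, V). replicate (nat \<lfloor>e * real (card S)\<rfloor>) V) c))"
    by (elim exE conjE)
  let ?n = "length c" and ?S = "\<lambda>i. fst (c ! i)" and ?V = "\<lambda>i. snd (c ! i)"
  let ?A = "\<Union>i<?n. \<Union>s\<in>?S i. \<alpha> s ` ?V i"
  have in_c: "(?S i, ?V i) \<in> set c" if "i < ?n" for i using that by simp
  have tow: "finite (?S i)" "?S i \<subseteq> H" "open (?V i)" if "i < ?n" for i
    using castle_tower[OF c(1) in_c[OF that]] by (simp_all add: tower_def)
  have disj: "disjoint_family_on (\<lambda>(i, s). \<alpha> s ` ?V i) (Sigma {..<?n} ?S)"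
    using c(1) by (simp add: castle_def)
  have inv: "approx_invariant G F e (?S i)" if "i < ?n" for i
    using bspec[OF c(2) in_c[OF that]] by (simp add: case_prod_beta approx_invariant_def set_mult_def)
  have card: "N \<le> 2 * card (?S i)" if "i < ?n" for i
    using card_le_of_approx_invariant[OF F(1) tow(1)[OF that] subset_trans[OF F(2) HG]
        subset_trans[OF tow(2)[OF that] HG] e(4) inv[OF that]] F(4)
    by linarith
  have diam: "dist x y < \<delta>" if "i < ?n" "s \<in> ?S i" "x \<in> \<alpha> s ` ?V i" "y \<in> \<alpha> s ` ?V i" for i s x y
  proof -
    have "bounded (\<alpha> s ` ?V i)"
      using bounded_subset[OF compact_imp_bounded[OF compact_space]] by auto
    then have "dist x y \<le> diameter (\<alpha> s ` ?V i)"
      using that(3,4) by (rule diameter_bounded_bound)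
    also have "\<dots> < e" using bspec[OF c(2) in_c[OF that(1)]] that(2) by (simp add: case_prod_beta)
    finally show ?thesis using e(2) by linarith
  qed
  have opl: "open (\<alpha> s ` ?V i)" if "i < ?n" "s \<in> ?S i" for i s
    using open_act tow[OF that(1)] that(2) HG by blast
  have Aeq: "(\<Union>(S, V)\<in>set c. \<Union>s\<in>S. \<alpha> s ` V) = ?A"
  proof -
    have "set c = (!) c ` {..<?n}" by (auto simp: set_conv_nth)
    then show ?thesis by (simp add: case_prod_beta)
  qed
  have opA: "open ?A" using opl by auto
  let ?B = "concat (map (\<lambda>(S, V). replicate (nat \<lfloor>e * real (card S)\<rfloor>) V) c)"
  have "\<exists>R. open R \<and> UNIV - ?A \<subseteq> R \<and>
    (\<forall>\<nu>. inv_under H \<nu> \<longrightarrow> measure \<nu> R \<le> (\<Sum>j<length ?B. measure \<nu> (?B ! j)))"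
  proof (rule subeq_sum_single_cover[OF HG])
    show "closed (UNIV - ?A)" using opA by (rule closed_Diff[OF closed_UNIV])
    show "subeq_sum ?G \<alpha> [UNIV - ?A] ?B" using c(3) Aeq by simp
    show "B \<in> sets borel" if B: "B \<in> set ?B" for B
    proof -
      obtain S where "(S, B) \<in> set c"
        using B by (auto simp: set_replicate_conv_if split: if_splits)
      then show ?thesis using castle_tower[OF c(1)] by (auto simp: tower_def)
    qed
  qed
  then obtain R where R: "open R" "UNIV - ?A \<subseteq> R"
    "\<And>\<nu>. inv_under H \<nu> \<Longrightarrow> measure \<nu> R \<le> (\<Sum>j<length ?B. measure \<nu> (?B ! j))" by blast
  have "measure \<nu> R \<le> \<epsilon>" if \<nu>: "inv_under H \<nu>" for \<nu>
  proof -
    interpret prob_space \<nu> by (rule inv_underD(2)[OF \<nu>])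
    \<comment> \<open>A base occurs at most \<open>e * card S\<close> times in the formal sum, while
      its tower has \<open>card S\<close> levels of the same measure; the formal sum thus weighs at
      most e times the castle.\<close>
    have "measure \<nu> R \<le> (\<Sum>i<?n. nat \<lfloor>e * real (card (?S i))\<rfloor> * measure \<nu> (?V i))"
      using R(3)[OF \<nu>] concat_replicate_sum[where n = "\<lambda>S. nat \<lfloor>e * real (card S)\<rfloor>" and c = c and f = "measure \<nu>"] by simp
    also have "\<dots> \<le> (\<Sum>i<?n. e * (card (?S i) * measure \<nu> (?V i)))"
    proof (rule sum_mono)
      fix i
      have "real (nat \<lfloor>e * real (card (?S i))\<rfloor>) \<le> e * card (?S i)"
        using e(1) by (simp add: of_nat_floor)
      then show "nat \<lfloor>e * real (card (?S i))\<rfloor> * measure \<nu> (?V i) \<le> e * (card (?S i) * measure \<nu> (?V i))"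
        using mult_right_mono[OF _ measure_nonneg, of _ _ \<nu> "?V i"] by (simp add: mult.assoc[symmetric])
    qed
    also have "\<dots> = e * measure \<nu> ?A"
      using measure_levels[OF \<nu> HG _ _ _ _ disj] tow by (simp add: sum_distrib_left)
    also have "\<dots> \<le> e * 1"
      using e(1) prob_le_1 by (intro mult_left_mono) auto
    finally show ?thesis using e(3) by linarith
  qed
  then show ?thesis
    using tow card diam disj R(1,2)
    by (intro exI[of _ ?n] exI[of _ ?S] exI[of _ ?V] exI[of _ R] conjI allI impI ballI)
qed

end

section \<open>Even colourings and integrated counting\<close>

lemma card_mod_eq_bounds:
  fixes n q j :: nat
  assumes "j < q"
  shows "n div q \<le> card {k. k < n \<and> k mod q = j}" "card {k. k < n \<and> k mod q = j} \<le> n div q + 1"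
proof -
  let ?A = "{k. k < n \<and> k mod q = j}"
  have inj: "inj_on (\<lambda>d. j + q * d) {..<n div q}"
    using assms by (auto simp: inj_on_def)
  have "(\<lambda>d. j + q * d) ` {..<n div q} \<subseteq> ?A"
  proof clarify
    fix d assume "d < n div q"
    then have "q * (d + 1) \<le> q * (n div q)" by (intro mult_le_mono2) simp
    also have "\<dots> \<le> n" by simp
    finally show "j + q * d < n \<and> (j + q * d) mod q = j" using assms by simp
  qed
  then have "card ((\<lambda>d. j + q * d) ` {..<n div q}) \<le> card ?A"
    by (intro card_mono) auto
  then show "n div q \<le> card ?A"
    using card_image[OF inj] by simp
  have "inj_on (\<lambda>k. k div q) ?A"
  proof (rule inj_onI)
    fix x y assume "x \<in> ?A" "y \<in> ?A" "x div q = y div q"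
    then show "x = y"
      using div_mult_mod_eq[of x q] div_mult_mod_eq[of y q] by simp
  qed
  then have "card ?A \<le> card {..n div q}"
    by (intro card_inj_on_le[of "\<lambda>k. k div q"]) (auto intro!: div_le_mono)
  then show "card ?A \<le> n div q + 1" by simp
qed

text \<open>Enumerate P and colour each element by the residue of its number modulo q.\<close>

lemma balanced_colouring:
  assumes "finite P" "0 < q"
  shows "\<exists>\<phi> :: 'a \<Rightarrow> nat. (\<forall>p. \<phi> p < q) \<and>
    (\<forall>j<q. card P / q - 1 \<le> card {p\<in>P. \<phi> p = j} \<and> card {p\<in>P. \<phi> p = j} \<le> card P / q + 1)"
proof -
  obtain h where h: "bij_betw h P {0..<card P}"
    using ex_bij_betw_finite_nat[OF assms(1)] by blast
  have "card P / q - 1 \<le> card {p\<in>P. h p mod q = j} \<and> card {p\<in>P. h p mod q = j} \<le> card P / q + 1"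
    if "j < q" for j
  proof -
    have "h ` {p\<in>P. h p mod q = j} = {k. k < card P \<and> k mod q = j}"
      using h by (force simp: bij_betw_def)
    moreover have "inj_on h {p\<in>P. h p mod q = j}"
      using h by (auto simp: bij_betw_def inj_on_def)
    then have "card (h ` {p\<in>P. h p mod q = j}) = card {p\<in>P. h p mod q = j}"
      by (rule card_image)
    ultimately have "card {p\<in>P. h p mod q = j} = card {k. k < card P \<and> k mod q = j}"
      by (simp only:)
    moreover have "real (card P div q) \<le> card P / q" "card P / q - 1 \<le> real (card P div q)"
      using floor_divide_of_nat_eq[of "card P" q, where ?'a = real] floor_correct[of "card P / q"] by simp_all
    ultimately show ?thesis
      using card_mod_eq_bounds[OF that, of "card P"] by linarith
  qed
  then show ?thesis
    using assms(2) by (intro exI[of _ "\<lambda>p. h p mod q"]) simp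
qed

text \<open>A sum of probabilities is the expected number of events that occur, so a pointwise
  inequality between two counts can be integrated. It transfers statements about single orbit
  segments to invariant measures.\<close>

lemma (in prob_space) sum_prob_mono:
  fixes a c :: real
  assumes J: "finite J" and E: "\<And>j. j \<in> J \<Longrightarrow> E j \<in> events" and F: "\<And>j. j \<in> J' \<Longrightarrow> F j \<in> events"
    and J': "finite J'"
    and le: "\<And>x. x \<in> space M \<Longrightarrow> card {j\<in>J. x \<in> E j} + c \<le> a * real (card {j\<in>J'. x \<in> F j})"
  shows "(\<Sum>j\<in>J. prob (E j)) + c \<le> a * (\<Sum>j\<in>J'. prob (F j))"
proof -
  have count: "real (card {j\<in>I. x \<in> D j}) = (\<Sum>j\<in>I. indicat_real (D j) x)" if "finite I" for I D and x :: 'a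
  proof -
    have "(\<Sum>j\<in>I. indicat_real (D j) x) = (\<Sum>j\<in>I. if x \<in> D j then 1 else 0 :: real)"
      by (intro sum.cong) (auto simp: indicator_def)
    also have "\<dots> = (\<Sum>j\<in>{j\<in>I. x \<in> D j}. 1)"
      using that by (rule sum.inter_filter[symmetric])
    finally show ?thesis by simp
  qed
  have iE: "integrable M (indicator (E j) :: 'a \<Rightarrow> real)" if "j \<in> J" for j
    using E[OF that] by (intro integrable_real_indicator) (auto simp: emeasure_eq_measure)
  have iF: "integrable M (indicator (F j) :: 'a \<Rightarrow> real)" if "j \<in> J'" for j
    using F[OF that] by (intro integrable_real_indicator) (auto simp: emeasure_eq_measure)
  have "(\<Sum>j\<in>J. prob (E j)) + c = (\<integral>x. (\<Sum>j\<in>J. indicat_real (E j) x) + c \<partial>M)"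
    using iE E J by (simp add: integral_add integral_sum prob_space)
  also have "\<dots> \<le> (\<integral>x. a * (\<Sum>j\<in>J'. indicat_real (F j) x) \<partial>M)"
    using iE iF le J J' by (intro integral_mono) (auto simp: count)
  also have "\<dots> = a * (\<Sum>j\<in>J'. prob (F j))"
    using iF F by (simp add: integral_sum)
  finally show ?thesis .
qed

lemma compact_uniform_ball:
  fixes C :: "'x::metric_space set"
  assumes "compact C" "open U" "C \<subseteq> U"
  shows "\<exists>\<delta>>0. \<forall>x\<in>C. \<forall>y. dist x y < \<delta> \<longrightarrow> y \<in> U"
proof -
  obtain \<delta> where "0 < \<delta>" "(\<Union>x\<in>C. ball x \<delta>) \<subseteq> U"
    using compact_subset_open_imp_ball_epsilon_subset[OF assms] by blast
  then show ?thesis by (intro exI[of _ \<delta>]) (auto simp: subset_eq)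
qed

context compact_action
begin

text \<open>Each base is repeated at least N/2 times among disjoint levels of the same measure. The
  sum on the left is the price of an error of one level per tower.\<close>

lemma sum_levels_base_le:
  assumes \<nu>: "inv_under H \<nu>" "H \<subseteq> carrier G" and I: "finite I"
    and T: "\<And>i. i \<in> I \<Longrightarrow> finite (T i)" "\<And>i. i \<in> I \<Longrightarrow> T i \<subseteq> H"
    and V: "\<And>i. i \<in> I \<Longrightarrow> V i \<in> sets borel"
    and disj: "disjoint_family_on (\<lambda>(i, s). \<alpha> s ` V i) (Sigma I T)"
    and N: "\<And>i. i \<in> I \<Longrightarrow> N \<le> 2 * card (T i)" "0 < N"
  shows "(\<Sum>i\<in>I. measure \<nu> (V i)) \<le> 2 / N"
proof -
  interpret prob_space \<nu> by (rule inv_underD(2)[OF \<nu>(1)])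
  have "N * (\<Sum>i\<in>I. measure \<nu> (V i)) \<le> (\<Sum>i\<in>I. 2 * (card (T i) * measure \<nu> (V i)))"
    unfolding sum_distrib_left
  proof (rule sum_mono)
    fix i assume "i \<in> I"
    then have "real N \<le> 2 * real (card (T i))" using N(1)[of i] by linarith
    then show "N * measure \<nu> (V i) \<le> 2 * (card (T i) * measure \<nu> (V i))"
      using mult_right_mono[OF _ measure_nonneg, of _ _ \<nu> "V i"] by (simp add: mult.assoc[symmetric])
  qed
  also have "\<dots> = 2 * measure \<nu> (\<Union>i\<in>I. \<Union>s\<in>T i. \<alpha> s ` V i)"
    using measure_levels[OF \<nu> I T V disj] by (simp add: sum_distrib_left)
  also have "\<dots> \<le> 2" using prob_le_1 by simp
  finally show ?thesis using N(2) by (simp add: field_simps)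
qed

lemma measure_sublevels:
  assumes \<nu>: "inv_under H \<nu>" "H \<subseteq> carrier G" and I: "finite I"
    and T: "\<And>i. i \<in> I \<Longrightarrow> finite (T i)" "\<And>i. i \<in> I \<Longrightarrow> T i \<subseteq> H"
    and V: "\<And>i. i \<in> I \<Longrightarrow> V i \<in> sets borel"
    and disj: "disjoint_family_on (\<lambda>(i, s). \<alpha> s ` V i) (Sigma I T)"
    and P: "\<And>i. i \<in> I \<Longrightarrow> P i \<subseteq> T i"
  shows "measure \<nu> (\<Union>i\<in>I. \<Union>s\<in>P i. \<alpha> s ` V i) = (\<Sum>i\<in>I. card (P i) * measure \<nu> (V i))"
proof (rule measure_levels[OF \<nu> I _ _ V])
  show "finite (P i)" "P i \<subseteq> H" if "i \<in> I" for i
    using finite_subset[OF P[OF that] T(1)[OF that]] subset_trans[OF P[OF that] T(2)[OF that]] .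
  show "disjoint_family_on (\<lambda>(i, s). \<alpha> s ` V i) (Sigma I P)"
    using P by (intro disjoint_family_on_mono[OF _ disj]) auto
qed

text \<open>The comparison is made between sets moved by \<open>inv (x i)\<close>, which may
  overlap; the summand index keeps them apart. Moving back by the matching \<open>x\<close> lands in
  the disjoint sets \<open>B j\<close>. The source has one set more than the target, namely the
  remainder of a castle.\<close>

lemma subeq_sum_pullback:
  assumes H: "H \<subseteq> carrier G" and C: "closed C" and x: "\<And>i. i \<le> (q::nat) \<Longrightarrow> x i \<in> carrier G"
    and W: "\<And>i. i \<le> q \<Longrightarrow> open (W i)" "C \<subseteq> (\<Union>i\<le>q. W i)"
    and disj: "disjoint_family_on B {..<q}"
    and sub: "subeq_sum (G\<lparr>carrier := H\<rparr>) \<alpha> (map (\<lambda>i. \<alpha> (inv (x i)) ` W i) [0..<Suc q])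
      (map (\<lambda>i. \<alpha> (inv (x i)) ` B i) [0..<q])"
  shows "packable G C (\<Union>j<q. B j)"
proof -
  have "\<exists>D. (\<forall>i\<in>{..q}. compact (D i) \<and> D i \<subseteq> W i) \<and> C = (\<Union>i\<in>{..q}. D i)"
    using W by (intro compact_shrink compact_closed[OF C]) auto
  then obtain D where D: "\<forall>i\<in>{..q}. compact (D i) \<and> D i \<subseteq> W i" "C = (\<Union>i\<in>{..q}. D i)"
    by (elim exE conjE)
  let ?As = "map (\<lambda>i. \<alpha> (inv (x i)) ` W i) [0..<Suc q]"
  let ?Bs = "map (\<lambda>i. \<alpha> (inv (x i)) ` B i) [0..<q]"
  let ?C = "\<lambda>i. \<alpha> (inv (x i)) ` D i"
  have Asi: "?As ! i = \<alpha> (inv (x i)) ` W i" if "i < Suc q" for i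
    using that by (simp del: upt_Suc)
  have "\<forall>i<length ?As. closed (?C i) \<and> ?C i \<subseteq> ?As ! i"
  proof (intro allI impI)
    fix i assume i: "i < length ?As"
    then have i': "i \<le> q" by simp
    then have "closed (?C i)"
      using x[OF i'] D(1) compact_imp_closed by (intro closed_act) auto
    moreover have "?C i \<subseteq> \<alpha> (inv (x i)) ` W i"
      using D(1) i' by (intro image_mono) auto
    ultimately show "closed (?C i) \<and> ?C i \<subseteq> ?As ! i"
      using i' by (simp add: Asi del: upt_Suc)
  qed
  then have "\<exists>\<U> s k.
        (\<forall>i<length ?As. finite (\<U> i) \<and> (\<forall>U\<in>\<U> i. open U) \<and> ?C i \<subseteq> \<Union>(\<U> i) \<and>
          (\<forall>U\<in>\<U> i. s i U \<in> carrier (G\<lparr>carrier := H\<rparr>) \<and> k i U < length ?Bs)) \<and>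
        disjoint_family_on (\<lambda>(i, U). (\<alpha> (s i U) ` U) \<times> {k i U}) (SIGMA i:{..<length ?As}. \<U> i) \<and>
        (\<forall>i<length ?As. \<forall>U\<in>\<U> i.
          (\<alpha> (s i U) ` U) \<times> {k i U} \<subseteq> (\<Union>j<length ?Bs. (?Bs ! j) \<times> {j}))"
    by (rule mp[OF spec[OF sub[unfolded subeq_sum_def], of ?C]])
  then obtain \<U> s k where
    a: "\<forall>i<length ?As. finite (\<U> i) \<and> (\<forall>U\<in>\<U> i. open U) \<and> ?C i \<subseteq> \<Union>(\<U> i) \<and>
          (\<forall>U\<in>\<U> i. s i U \<in> carrier (G\<lparr>carrier := H\<rparr>) \<and> k i U < length ?Bs)" and
    b: "disjoint_family_on (\<lambda>(i, U). (\<alpha> (s i U) ` U) \<times> {k i U}) (SIGMA i:{..<length ?As}. \<U> i)" and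
    c: "\<forall>i<length ?As. \<forall>U\<in>\<U> i.
          (\<alpha> (s i U) ` U) \<times> {k i U} \<subseteq> (\<Union>j<length ?Bs. (?Bs ! j) \<times> {j})"
    by (elim exE conjE)
  have fin: "finite (\<U> i)" and op: "\<And>U. U \<in> \<U> i \<Longrightarrow> open U" and cov: "?C i \<subseteq> \<Union>(\<U> i)"
    and s: "\<And>U. U \<in> \<U> i \<Longrightarrow> s i U \<in> H" and k: "\<And>U. U \<in> \<U> i \<Longrightarrow> k i U < q" if "i \<le> q" for i
    using a[rule_format, of i] that by auto
  have dis: "\<alpha> (s i U) ` U \<inter> \<alpha> (s i' U') ` U' = {}"
    if "i \<le> q" "i' \<le> q" "U \<in> \<U> i" "U' \<in> \<U> i'" "(i, U) \<noteq> (i', U')" "k i U = k i' U'" for i i' U U'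
    using disjoint_family_onD[OF b, of "(i, U)" "(i', U')"] that by auto
  have im: "\<alpha> (s i U) ` U \<subseteq> \<alpha> (inv (x (k i U))) ` B (k i U)" if "i \<le> q" "U \<in> \<U> i" for i U
  proof -
    have "(\<alpha> (s i U) ` U) \<times> {k i U} \<subseteq> (\<Union>j<length ?Bs. (?Bs ! j) \<times> {j})"
      using c[rule_format, of i U] that by simp
    then show ?thesis by auto
  qed
  let ?I = "SIGMA i:{..q}. \<U> i"
  let ?W = "\<lambda>(i, U). \<alpha> (x i) ` U"
  \<comment> \<open>Return from piece i by \<open>inv (x i)\<close>, compare inside H, then undo the
    motion of the target piece.\<close>
  let ?t = "\<lambda>(i, U). x (k i U) \<otimes> s i U \<otimes> inv (x i)"
  have sG: "s i U \<in> carrier G" if "i \<le> q" "U \<in> \<U> i" for i U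
    using s[OF that] H by blast
  have xk: "x (k i U) \<in> carrier G" if "i \<le> q" "U \<in> \<U> i" for i U
    using k[OF that] x by simp
  have t_im: "\<alpha> (?t (i, U)) ` ?W (i, U) = \<alpha> (x (k i U)) ` \<alpha> (s i U) ` U" if "i \<le> q" "U \<in> \<U> i" for i U
    using sG[OF that] xk[OF that] x[OF that(1)] by (simp add: act_image_mult m_assoc)
  have t_sub: "\<alpha> (?t (i, U)) ` ?W (i, U) \<subseteq> B (k i U)" if "i \<le> q" "U \<in> \<U> i" for i U
  proof -
    have "\<alpha> (x (k i U)) ` \<alpha> (s i U) ` U \<subseteq> \<alpha> (x (k i U)) ` \<alpha> (inv (x (k i U))) ` B (k i U)"
      by (rule image_mono[OF im[OF that]])
    also have "\<dots> = B (k i U)"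
      using xk[OF that] by (simp add: image_image act_inv)
    finally show ?thesis unfolding t_im[OF that] .
  qed
  have "finite ?I" using fin by auto
  moreover have "\<forall>p\<in>?I. open (?W p)" using op x open_act by auto
  moreover have "C \<subseteq> (\<Union>p\<in>?I. ?W p)"
  proof
    fix z assume "z \<in> C"
    then obtain i where i: "i \<le> q" "z \<in> D i" using D(2) by auto
    then have "\<alpha> (inv (x i)) z \<in> \<Union>(\<U> i)" using cov[OF i(1)] by blast
    then obtain U where U: "U \<in> \<U> i" "\<alpha> (inv (x i)) z \<in> U" by blast
    then have "z \<in> ?W (i, U)" using x[OF i(1)] by (simp add: mem_act)
    moreover have "(i, U) \<in> ?I" using i U by simp
    ultimately show "z \<in> (\<Union>p\<in>?I. ?W p)" by (rule UN_I[rotated])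
  qed
  moreover have "\<forall>p\<in>?I. ?t p \<in> carrier G" using sG xk x by auto
  moreover have "disjoint_family_on (\<lambda>p. \<alpha> (?t p) ` ?W p) ?I"
    unfolding disjoint_family_on_def
  proof (intro ballI impI)
    fix p p' assume p: "p \<in> ?I" "p' \<in> ?I" "p \<noteq> p'"
    obtain i U i' U' where e: "p = (i, U)" "p' = (i', U')" by (metis surj_pair)
    have m: "i \<le> q" "U \<in> \<U> i" "i' \<le> q" "U' \<in> \<U> i'" using p e by auto
    show "\<alpha> (?t p) ` ?W p \<inter> \<alpha> (?t p') ` ?W p' = {}"
    proof (cases "k i U = k i' U'")
      case True
      have "\<alpha> (s i U) ` U \<inter> \<alpha> (s i' U') ` U' = {}"
        using dis[OF m(1,3,2,4) _ True] p(3) e by simp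
      then have "\<alpha> (x (k i U)) ` \<alpha> (s i U) ` U \<inter> \<alpha> (x (k i U)) ` \<alpha> (s i' U') ` U' = {}"
        using inj_act[OF xk[OF m(1,2)]] by (simp add: image_Int[symmetric])
      then show ?thesis
        unfolding e t_im[OF m(1,2)] t_im[OF m(3,4)] True .
    next
      case False
      then have "B (k i U) \<inter> B (k i' U') = {}"
        using k[OF m(1,2)] k[OF m(3,4)] by (intro disjoint_family_onD[OF disj]) auto
      then show ?thesis
        unfolding e using t_sub[OF m(1,2)] t_sub[OF m(3,4)] by blast
    qed
  qed
  moreover have "\<forall>p\<in>?I. \<alpha> (?t p) ` ?W p \<subseteq> (\<Union>j<q. B j)"
  proof
    fix p assume "p \<in> ?I"
    then obtain i U where e: "p = (i, U)" "i \<le> q" "U \<in> \<U> i" by auto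
    show "\<alpha> (?t p) ` ?W p \<subseteq> (\<Union>j<q. B j)"
      unfolding e(1) using t_sub[OF e(2,3)] k[OF e(2,3)] by blast
  qed
  ultimately show ?thesis
    by (rule packableI)
qed

section \<open>Comparison\<close>

text \<open>Within each tower a colour class misses its exact share by at most one level, and
  \<open>sum_levels_base_le\<close> adds up these errors.\<close>

lemma measure_colour_class:
  fixes q N :: nat
  assumes \<nu>: "inv_under H \<nu>" "H \<subseteq> carrier G" and I: "finite I"
    and T: "\<And>i. i \<in> I \<Longrightarrow> finite (T i)" "\<And>i. i \<in> I \<Longrightarrow> T i \<subseteq> H"
    and V: "\<And>i. i \<in> I \<Longrightarrow> V i \<in> sets borel"
    and disj: "disjoint_family_on (\<lambda>(i, s). \<alpha> s ` V i) (Sigma I T)"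
    and N: "\<And>i. i \<in> I \<Longrightarrow> N \<le> 2 * card (T i)" "0 < N"
    and P: "\<And>i. i \<in> I \<Longrightarrow> P i \<subseteq> T i"
    and bal: "\<And>i. i \<in> I \<Longrightarrow> card (P i) / q - 1 \<le> card {s\<in>P i. \<phi> i s = j} \<and>
      card {s\<in>P i. \<phi> i s = j} \<le> card (P i) / q + 1"
  shows "\<bar>measure \<nu> (\<Union>i\<in>I. \<Union>s\<in>{s\<in>P i. \<phi> i s = j}. \<alpha> s ` V i) -
    measure \<nu> (\<Union>i\<in>I. \<Union>s\<in>P i. \<alpha> s ` V i) / q\<bar> \<le> 2 / N"
proof -
  have 1: "measure \<nu> (\<Union>i\<in>I. \<Union>s\<in>{s\<in>P i. \<phi> i s = j}. \<alpha> s ` V i) =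
      (\<Sum>i\<in>I. card {s\<in>P i. \<phi> i s = j} * measure \<nu> (V i))"
    using P by (intro measure_sublevels[OF \<nu> I T V disj]) auto
  have 2: "measure \<nu> (\<Union>i\<in>I. \<Union>s\<in>P i. \<alpha> s ` V i) = (\<Sum>i\<in>I. card (P i) * measure \<nu> (V i))"
    by (intro measure_sublevels[OF \<nu> I T V disj] P)
  have "measure \<nu> (\<Union>i\<in>I. \<Union>s\<in>{s\<in>P i. \<phi> i s = j}. \<alpha> s ` V i) -
    measure \<nu> (\<Union>i\<in>I. \<Union>s\<in>P i. \<alpha> s ` V i) / q =
    (\<Sum>i\<in>I. (card {s\<in>P i. \<phi> i s = j} - card (P i) / q) * measure \<nu> (V i))"
    unfolding 1 2 by (simp add: sum_divide_distrib sum_subtractf left_diff_distrib)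
  also have "\<bar>\<dots>\<bar> \<le> (\<Sum>i\<in>I. measure \<nu> (V i))"
  proof (rule order_trans[OF sum_abs sum_mono])
    fix i assume "i \<in> I"
    then have "\<bar>card {s\<in>P i. \<phi> i s = j} - card (P i) / q\<bar> \<le> 1"
      using bal[of i] by linarith
    then have "\<bar>card {s\<in>P i. \<phi> i s = j} - card (P i) / q\<bar> * measure \<nu> (V i) \<le> 1 * measure \<nu> (V i)"
      by (rule mult_right_mono) simp
    then show "\<bar>(card {s\<in>P i. \<phi> i s = j} - card (P i) / q) * measure \<nu> (V i)\<bar> \<le> measure \<nu> (V i)"
      by (simp add: abs_mult)
  qed
  also have "\<dots> \<le> 2 / N"
    by (rule sum_levels_base_le[OF \<nu> I T V disj N])
  finally show ?thesis .
qed

text \<open>Amenability fixes one Folner set, so that only finitely many conjugates have to be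
  handled by a pair of good subgroups.\<close>

lemma folner_gap:
  assumes amen: "amenable G" and C: "closed C" and V: "open V"
    and lt: "\<forall>\<mu>\<in>\<M>. measure \<mu> C < measure \<mu> V"
  shows "\<exists>S (e::real) C' K. finite S \<and> S \<noteq> {} \<and> S \<subseteq> carrier G \<and> 0 < e \<and> closed C' \<and> C \<subseteq> interior C' \<and>
    closed K \<and> K \<subseteq> V \<and> (\<forall>x. card {s\<in>S. \<alpha> s x \<in> C'} + e * card S \<le> card {s\<in>S. \<alpha> s x \<in> K})"
proof -
  obtain F C' K and e :: real where F: "finite F" "F \<noteq> {}" "F \<subseteq> carrier G" "0 < e"
    and CK: "closed C'" "C \<subseteq> interior C'" "closed K" "K \<subseteq> V"
    and gap: "\<forall>S x. finite S \<and> S \<subseteq> carrier G \<and> approx_invariant G F e S \<longrightarrow>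
      card {s\<in>S. \<alpha> s x \<in> C'} + e * card S < card {s\<in>S. \<alpha> s x \<in> K}"
    using uniform_gap[OF C V lt] by (elim exE conjE)
  have "\<exists>S. finite S \<and> S \<subseteq> carrier G \<and> approx_invariant G F e S"
    using amen F unfolding amenable_def by simp
  then obtain S where S: "finite S" "S \<subseteq> carrier G" "approx_invariant G F e S"
    by (elim exE conjE)
  have "S \<noteq> {}" using S(3) by (auto simp: approx_invariant_def)
  moreover have "\<forall>x. card {s\<in>S. \<alpha> s x \<in> C'} + e * card S \<le> card {s\<in>S. \<alpha> s x \<in> K}"
    using gap S by (intro allI less_imp_le) simp
  ultimately show ?thesis
    using S F(4) CK by (intro exI[of _ S] exI[of _ e] exI[of _ C'] exI[of _ K] conjI)
qed

text \<open>
  Levels of a \<open>\<Lambda>\<^sub>1\<close>-castle are dealt out evenly to the elements of a Folner set \<open>S\<close> of \<open>\<Gamma>\<close>. This cuts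
  \<open>C\<close> and \<open>V\<close> into pieces of nearly equal measure for every \<open>\<Lambda>\<^sub>1\<close>-invariant measure; moving each piece by
  the inverse of its element turns the \<open>\<Lambda>\<^sub>2\<close>-measures of the pieces into averages over \<open>S\<close>.
\<close>

lemma comparison_cover:
  assumes amen: "amenable G" and good: "good_subgroups G \<alpha>" and C: "closed C" and V: "open V"
    and lt: "\<forall>\<mu>\<in>\<M>. measure \<mu> C < measure \<mu> V"
  shows "packable G C V"
proof -
  obtain S C' K and e :: real where S: "finite S" "S \<noteq> {}" "S \<subseteq> carrier G" and e: "0 < e"
    and CK: "closed C'" "C \<subseteq> interior C'" "closed K" "K \<subseteq> V"
    and gap: "\<forall>x. card {s\<in>S. \<alpha> s x \<in> C'} + e * card S \<le> card {s\<in>S. \<alpha> s x \<in> K}"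
    using folner_gap[OF amen C V lt] by (elim exE conjE)
  define q where "q = card S"
  have q: "0 < q" using S by (simp add: q_def card_gt_0_iff)
  obtain g where g: "bij_betw g {0..<q} S"
    using ex_bij_betw_nat_finite[OF S(1)] unfolding q_def by blast
  \<comment> \<open>Labels below q enumerate S. Label q is reserved for the uncovered remainder,
    which stays in place.\<close>
  define x where "x i = (if i < q then g i else \<one>)" for i
  have xG: "x i \<in> carrier G" for i
    using bij_betwE[OF g] S(3) by (auto simp: x_def)
  have xS: "x i \<in> S" if "i < q" for i
    using bij_betwE[OF g] that by (simp add: x_def)
  obtain \<delta>1 where \<delta>1: "0 < \<delta>1" "\<forall>y\<in>C. \<forall>z. dist y z < \<delta>1 \<longrightarrow> z \<in> interior C'"
    using compact_uniform_ball[OF compact_closed[OF C] open_interior CK(2)] by blast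
  obtain \<delta>2 where \<delta>2: "0 < \<delta>2" "\<forall>y\<in>K. \<forall>z. dist y z < \<delta>2 \<longrightarrow> z \<in> V"
    using compact_uniform_ball[OF compact_closed[OF CK(3)] V CK(4)] by blast
  define \<delta> where "\<delta> = min \<delta>1 \<delta>2"
  have \<delta>: "0 < \<delta>" using \<delta>1 \<delta>2 by (simp add: \<delta>_def)
  \<comment> \<open>Rounding costs at most 2/N per label for the pieces of C and again for those of
    V. With this N each of the two totals is at most e/8.\<close>
  define N where "N = nat \<lceil>16 * q / e\<rceil>"
  have N0: "0 < 16 * q / e" using q e by simp
  then have N: "0 < N" "16 * q / e \<le> N"
    unfolding N_def by (simp, linarith)
  \<comment> \<open>Inverses are used because pieces are moved by \<open>inv (x i)\<close>, so the
    conjugates needed are of the form x^-1 \<Lambda>1 x.\<close>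
  have "finite (m_inv G ` S)" "m_inv G ` S \<subseteq> carrier G"
    using S by auto
  note mp[OF spec[OF spec[OF good[unfolded good_subgroups_def], of "m_inv G ` S"], of N], OF conjI[OF this]]
  then obtain \<Lambda>1 \<Lambda>2 where L: "subgroup \<Lambda>1 G" "subgroup \<Lambda>2 G" "\<Lambda>1 \<subseteq> \<Lambda>2"
    "infinite \<Lambda>1 \<or> N \<le> card \<Lambda>1" "almost_finite (G\<lparr>carrier := \<Lambda>1\<rparr>) \<alpha>"
    "comparison_on_multisets (G\<lparr>carrier := \<Lambda>2\<rparr>) \<alpha>"
    "\<forall>f\<in>m_inv G ` S. (f <# \<Lambda>1) #> inv f \<subseteq> \<Lambda>2"
    by (elim exE conjE)
  have LG: "\<Lambda>1 \<subseteq> carrier G" "\<Lambda>2 \<subseteq> carrier G"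
    using L subgroup.subset by blast+
  have conj: "inv (x i) \<otimes> h \<otimes> x i \<in> \<Lambda>2" if "h \<in> \<Lambda>1" for i h
  proof (cases "i < q")
    case True
    have "(inv (x i) <# \<Lambda>1) #> inv (inv (x i)) \<subseteq> \<Lambda>2"
      using L(7) xS[OF True] by blast
    moreover have "inv (x i) \<otimes> h \<otimes> x i \<in> (inv (x i) <# \<Lambda>1) #> inv (inv (x i))"
      using that xG[of i] by (auto simp: l_coset_def r_coset_def)
    ultimately show ?thesis by blast
  next
    case False
    have "h \<in> carrier G" using that LG by blast
    then show ?thesis using False that L(3) by (auto simp: x_def)
  qed
  have e4: "0 < e / 4" using e by simp
  obtain n :: nat and T U R where
    TU: "\<forall>i<n. finite (T i) \<and> T i \<subseteq> \<Lambda>1 \<and> N \<le> 2 * card (T i) \<and> open (U i) \<and>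
      (\<forall>s\<in>T i. \<forall>x\<in>\<alpha> s ` U i. \<forall>y\<in>\<alpha> s ` U i. dist x y < \<delta>)"
    and disj: "disjoint_family_on (\<lambda>(i, s). \<alpha> s ` U i) (Sigma {..<n} T)"
    and R: "open R" "UNIV - (\<Union>i<n. \<Union>s\<in>T i. \<alpha> s ` U i) \<subseteq> R"
    and R_le: "\<forall>\<nu>. inv_under \<Lambda>1 \<nu> \<longrightarrow> measure \<nu> R \<le> e / 4"
    using almost_finite_levels[OF L(1,5,4) \<delta> e4] by (elim exE conjE)
  have T: "finite (T i)" "T i \<subseteq> \<Lambda>1" "N \<le> 2 * card (T i)" "open (U i)" if "i \<in> {..<n}" for i
    using TU that by auto
  have diam: "dist y z < \<delta>" if "i < n" "s \<in> T i" "y \<in> \<alpha> s ` U i" "z \<in> \<alpha> s ` U i" for i s y z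
    using TU that by blast
  have oplev: "open (\<alpha> s ` U i)" if "i < n" "s \<in> T i" for i s
    using open_act T[of i] that LG by blast
  \<comment> \<open>Levels have diameter below \<delta>, so those meeting C stay inside C' and those
    meeting K stay inside V. The former cover C and the latter cover K, up to R.\<close>
  define P where "P i = {s\<in>T i. \<alpha> s ` U i \<inter> C \<noteq> {}}" for i
  define Q where "Q i = {s\<in>T i. \<alpha> s ` U i \<inter> K \<noteq> {}}" for i
  have PT: "P i \<subseteq> T i" and QT: "Q i \<subseteq> T i" for i by (auto simp: P_def Q_def)
  have "\<forall>i. \<exists>f :: 'g \<Rightarrow> nat. i < n \<longrightarrow> (\<forall>p. f p < q) \<and> (\<forall>j<q. card (P i) / q - 1 \<le> card {p\<in>P i. f p = j} \<and>
      card {p\<in>P i. f p = j} \<le> card (P i) / q + 1)"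
    using balanced_colouring[OF finite_subset[OF PT T(1)] q] by simp
  then obtain \<phi> where "\<forall>i. i < n \<longrightarrow> (\<forall>p. \<phi> i p < q) \<and> (\<forall>j<q. card (P i) / q - 1 \<le> card {p\<in>P i. \<phi> i p = j} \<and>
      card {p\<in>P i. \<phi> i p = j} \<le> card (P i) / q + 1)"
    by (elim exE[OF choice])
  then have \<phi>: "\<And>i p. i < n \<Longrightarrow> \<phi> i p < q"
    "\<And>i j. i < n \<Longrightarrow> j < q \<Longrightarrow> card (P i) / q - 1 \<le> card {p\<in>P i. \<phi> i p = j} \<and>
      card {p\<in>P i. \<phi> i p = j} \<le> card (P i) / q + 1"
    by simp_all
  have "\<forall>i. \<exists>f :: 'g \<Rightarrow> nat. i < n \<longrightarrow> (\<forall>p. f p < q) \<and> (\<forall>j<q. card (Q i) / q - 1 \<le> card {p\<in>Q i. f p = j} \<and>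
      card {p\<in>Q i. f p = j} \<le> card (Q i) / q + 1)"
    using balanced_colouring[OF finite_subset[OF QT T(1)] q] by simp
  then obtain \<psi> where "\<forall>i. i < n \<longrightarrow> (\<forall>p. \<psi> i p < q) \<and> (\<forall>j<q. card (Q i) / q - 1 \<le> card {p\<in>Q i. \<psi> i p = j} \<and>
      card {p\<in>Q i. \<psi> i p = j} \<le> card (Q i) / q + 1)"
    by (elim exE[OF choice])
  then have \<psi>: "\<And>i p. i < n \<Longrightarrow> \<psi> i p < q"
    "\<And>i j. i < n \<Longrightarrow> j < q \<Longrightarrow> card (Q i) / q - 1 \<le> card {p\<in>Q i. \<psi> i p = j} \<and>
      card {p\<in>Q i. \<psi> i p = j} \<le> card (Q i) / q + 1"
    by simp_all
  define A where "A j = (\<Union>i<n. \<Union>s\<in>{s\<in>P i. \<phi> i s = j}. \<alpha> s ` U i)" for j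
  define B where "B j = (\<Union>i<n. \<Union>s\<in>{s\<in>Q i. \<psi> i s = j}. \<alpha> s ` U i)" for j
  define W where "W j = (if j < q then A j else R)" for j
  have opP: "open (\<alpha> s ` U i)" if "i < n" "s \<in> P i" for i s
    using oplev[OF that(1) subsetD[OF PT that(2)]] .
  have opQ: "open (\<alpha> s ` U i)" if "i < n" "s \<in> Q i" for i s
    using oplev[OF that(1) subsetD[OF QT that(2)]] .
  have opA: "open (A j)" and opB: "open (B j)" for j
    using opP opQ by (auto simp: A_def B_def intro!: open_UN)
  then have opW: "open (W j)" for j using R(1) by (simp add: W_def)
  have BV: "(\<Union>j<q. B j) \<subseteq> V"
  proof -
    have "\<alpha> s ` U i \<subseteq> V" if ish: "i < n" "s \<in> Q i" for i s
    proof
      fix z assume z: "z \<in> \<alpha> s ` U i"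
      obtain y where y: "y \<in> \<alpha> s ` U i" "y \<in> K" using ish(2) by (auto simp: Q_def)
      have "dist y z < \<delta>" using diam[OF ish(1) _ y(1) z] ish(2) QT by blast
      then show "z \<in> V" using \<delta>2(2) y(2) by (simp add: \<delta>_def)
    qed
    then show ?thesis unfolding B_def by blast
  qed
  have PC: "(\<Union>i<n. \<Union>s\<in>P i. \<alpha> s ` U i) \<subseteq> C'"
  proof -
    have "\<alpha> s ` U i \<subseteq> C'" if ish: "i < n" "s \<in> P i" for i s
    proof
      fix z assume z: "z \<in> \<alpha> s ` U i"
      obtain y where y: "y \<in> \<alpha> s ` U i" "y \<in> C" using ish(2) by (auto simp: P_def)
      have "dist y z < \<delta>" using diam[OF ish(1) _ y(1) z] ish(2) PT by blast
      then show "z \<in> C'" using \<delta>1(2) y(2) interior_subset by (auto simp: \<delta>_def)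
    qed
    then show ?thesis by blast
  qed
  have CW: "C \<subseteq> (\<Union>j\<le>q. W j)"
  proof
    fix z assume z: "z \<in> C"
    show "z \<in> (\<Union>j\<le>q. W j)"
    proof (cases "z \<in> R")
      case True
      then have "z \<in> W q" by (simp add: W_def)
      then show ?thesis by blast
    next
      case False
      then obtain i s where ish: "i < n" "s \<in> T i" "z \<in> \<alpha> s ` U i" using R(2) by blast
      then have "s \<in> P i" using z by (auto simp: P_def)
      then have "z \<in> A (\<phi> i s)" using ish by (auto simp: A_def)
      then have "z \<in> W (\<phi> i s)" "\<phi> i s \<le> q" using \<phi>(1)[OF ish(1), of s] by (auto simp: W_def)
      then show ?thesis by blast
    qed
  qed
  have KQ: "K \<subseteq> (\<Union>i<n. \<Union>s\<in>Q i. \<alpha> s ` U i) \<union> R"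
  proof
    fix z assume z: "z \<in> K"
    show "z \<in> (\<Union>i<n. \<Union>s\<in>Q i. \<alpha> s ` U i) \<union> R"
    proof (cases "z \<in> R")
      case False
      then obtain i s where ish: "i < n" "s \<in> T i" "z \<in> \<alpha> s ` U i" using R(2) by blast
      then have "s \<in> Q i" using z by (auto simp: Q_def)
      then show ?thesis using ish by blast
    qed simp
  qed
  have Bdisj: "B j \<inter> B k = {}" if "j \<noteq> k" for j k
  proof (rule ccontr)
    assume "B j \<inter> B k \<noteq> {}"
    then obtain z where z: "z \<in> B j" "z \<in> B k" by blast
    obtain i s where 1: "i < n" "s \<in> Q i" "\<psi> i s = j" "z \<in> \<alpha> s ` U i"
      using z(1) by (auto simp: B_def)
    obtain i' s' where 2: "i' < n" "s' \<in> Q i'" "\<psi> i' s' = k" "z \<in> \<alpha> s' ` U i'"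
      using z(2) by (auto simp: B_def)
    have "(i, s) \<noteq> (i', s')" using 1 2 that by auto
    moreover have "(i, s) \<in> Sigma {..<n} T" "(i', s') \<in> Sigma {..<n} T" using 1 2 QT by auto
    ultimately have "\<alpha> s ` U i \<inter> \<alpha> s' ` U i' = {}"
      using disjoint_family_onD[OF disj] by fastforce
    then show False using 1 2 by blast
  qed
  have Bo: "A j \<in> sets borel" "B j \<in> sets borel" "C' \<in> sets borel" "K \<in> sets borel" "R \<in> sets borel" for j
    using opA opB CK R(1) by auto
  have estimates: "measure \<kappa> (A j) \<le> measure \<kappa> C' / q + 2 / N"
      "(measure \<kappa> K - e / 4) / q - 2 / N \<le> measure \<kappa> (B j)"
    if \<kappa>: "inv_under \<Lambda>1 \<kappa>" and j: "j < q" for \<kappa> j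
  proof -
    interpret prob_space \<kappa> by (rule inv_underD(2)[OF \<kappa>])
    note sb = inv_underD(1)[OF \<kappa>]
    have Ub: "U i \<in> sets borel" if "i \<in> {..<n}" for i using T(4)[OF that] by simp
    have lev: "(\<Union>i<n. \<Union>s\<in>P i. \<alpha> s ` U i) \<in> events" "(\<Union>i<n. \<Union>s\<in>Q i. \<alpha> s ` U i) \<in> events"
      using opP opQ by (auto simp: sb intro!: borel_open open_UN)
    have "\<bar>measure \<kappa> (A j) - measure \<kappa> (\<Union>i<n. \<Union>s\<in>P i. \<alpha> s ` U i) / q\<bar> \<le> 2 / N"
      unfolding A_def
      by (rule measure_colour_class[OF \<kappa> LG(1) _ T(1,2) Ub disj T(3) N(1) PT]) (use \<phi>(2) j in auto)
    moreover have "measure \<kappa> (\<Union>i<n. \<Union>s\<in>P i. \<alpha> s ` U i) / q \<le> measure \<kappa> C' / q"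
      using PC Bo by (intro divide_right_mono finite_measure_mono) (auto simp: sb)
    ultimately show "measure \<kappa> (A j) \<le> measure \<kappa> C' / q + 2 / N" by linarith
    have "\<bar>measure \<kappa> (B j) - measure \<kappa> (\<Union>i<n. \<Union>s\<in>Q i. \<alpha> s ` U i) / q\<bar> \<le> 2 / N"
      unfolding B_def
      by (rule measure_colour_class[OF \<kappa> LG(1) _ T(1,2) Ub disj T(3) N(1) QT]) (use \<psi>(2) j in auto)
    moreover have "measure \<kappa> K \<le> measure \<kappa> (\<Union>i<n. \<Union>s\<in>Q i. \<alpha> s ` U i) + e / 4"
    proof -
      have "measure \<kappa> K \<le> measure \<kappa> ((\<Union>i<n. \<Union>s\<in>Q i. \<alpha> s ` U i) \<union> R)"
        using KQ lev Bo by (intro finite_measure_mono) (auto simp: sb)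
      also have "\<dots> \<le> measure \<kappa> (\<Union>i<n. \<Union>s\<in>Q i. \<alpha> s ` U i) + measure \<kappa> R"
        using lev Bo by (intro measure_Un_le) (auto simp: sb)
      finally show ?thesis using R_le \<kappa> by force
    qed
    then have "(measure \<kappa> K - e / 4) / q \<le> measure \<kappa> (\<Union>i<n. \<Union>s\<in>Q i. \<alpha> s ` U i) / q"
      by (intro divide_right_mono) auto
    ultimately show "(measure \<kappa> K - e / 4) / q - 2 / N \<le> measure \<kappa> (B j)" by linarith
  qed
  have "subeq_sum (G\<lparr>carrier := \<Lambda>2\<rparr>) \<alpha> (map (\<lambda>i. \<alpha> (inv (x i)) ` W i) [0..<Suc q])
      (map (\<lambda>i. \<alpha> (inv (x i)) ` B i) [0..<q])"
  proof (rule L(6)[unfolded comparison_on_multisets_def, rule_format])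
    let ?Us = "map (\<lambda>i. \<alpha> (inv (x i)) ` W i) [0..<Suc q]"
    let ?Vs = "map (\<lambda>i. \<alpha> (inv (x i)) ` B i) [0..<q]"
    have "measure \<nu> R + (\<Sum>j<q. measure \<nu> (\<alpha> (inv (x j)) ` A j)) < (\<Sum>j<q. measure \<nu> (\<alpha> (inv (x j)) ` B j))"
      if \<nu>2: "inv_under \<Lambda>2 \<nu>" for \<nu>
    proof -
      interpret prob_space \<nu> by (rule inv_underD(2)[OF \<nu>2])
      note sb = inv_underD(1)[OF \<nu>2]
      have sp: "space \<nu> = UNIV" using sets_eq_imp_space_eq[OF sb] by simp
      \<comment> \<open>Measuring the moved piece with \<nu> is measuring the piece itself with
        \<open>\<kappa> j\<close>. This measure is \<Lambda>1-invariant, so \<open>estimates\<close>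
        applies to every j although the measures differ.\<close>
      define \<kappa> where "\<kappa> j = distr \<nu> borel (\<alpha> (x j))" for j
      have \<kappa>: "inv_under \<Lambda>1 (\<kappa> j)" for j
        unfolding \<kappa>_def by (rule inv_under_distr[OF \<nu>2 xG LG conj])
      have m\<kappa>: "measure (\<kappa> j) D = measure \<nu> (\<alpha> (inv (x j)) ` D)" if "D \<in> sets borel" for j D
        unfolding \<kappa>_def by (rule measure_distr_act[OF sb xG that])
      have cnt: "card {j\<in>{..<q}. y \<in> \<alpha> (inv (x j)) ` D} = card {s\<in>S. \<alpha> s y \<in> D}" for y D
      proof (rule bij_betw_same_card)
        have b: "bij_betw x {..<q} S"
          using g by (subst bij_betw_cong[of _ _ g]) (auto simp: x_def atLeast0LessThan)
        have "x ` {j\<in>{..<q}. y \<in> \<alpha> (inv (x j)) ` D} = {s\<in>S. \<alpha> s y \<in> D}"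
          using b xG by (auto simp: bij_betw_def mem_act_inv)
        then show "bij_betw x {j\<in>{..<q}. y \<in> \<alpha> (inv (x j)) ` D} {s\<in>S. \<alpha> s y \<in> D}"
          by (intro bij_betw_subset[OF b]) auto
      qed
      \<comment> \<open>At a point y, the number of moved copies of D that contain y is the number
        of visits of the S-orbit segment of y to D; the gap of \<open>folner_gap\<close> is
        integrated.\<close>
      have "(\<Sum>j<q. measure \<nu> (\<alpha> (inv (x j)) ` C')) + e * q \<le> 1 * (\<Sum>j<q. measure \<nu> (\<alpha> (inv (x j)) ` K))"
      proof (rule sum_prob_mono)
        show "real (card {j\<in>{..<q}. y \<in> \<alpha> (inv (x j)) ` C'}) + e * q \<le> 1 * real (card {j\<in>{..<q}. y \<in> \<alpha> (inv (x j)) ` K})" for y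
          unfolding cnt using gap by (simp add: q_def)
      qed (use borel_act xG Bo in \<open>auto simp: sb\<close>)
      then have gap': "(\<Sum>j<q. measure (\<kappa> j) C') + e * q \<le> (\<Sum>j<q. measure (\<kappa> j) K)"
        using Bo by (simp add: m\<kappa>)
      have "(\<Sum>j<q. measure (\<kappa> j) (A j)) \<le> (\<Sum>j<q. measure (\<kappa> j) C' / q + 2 / N)"
        using estimates(1)[OF \<kappa>] by (intro sum_mono) simp
      also have "\<dots> = (\<Sum>j<q. measure (\<kappa> j) C') / q + q * (2 / N)"
        by (simp add: sum.distrib sum_divide_distrib)
      finally have 1: "(\<Sum>j<q. measure (\<kappa> j) (A j)) \<le> (\<Sum>j<q. measure (\<kappa> j) C') / q + q * (2 / N)" .
      have "(\<Sum>j<q. measure (\<kappa> j) K) / q - e / 4 - q * (2 / N) = (\<Sum>j<q. (measure (\<kappa> j) K - e / 4) / q - 2 / N)"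
        using q by (simp add: sum_subtractf sum_divide_distrib diff_divide_distrib)
      also have "\<dots> \<le> (\<Sum>j<q. measure (\<kappa> j) (B j))"
        using estimates(2)[OF \<kappa>] by (intro sum_mono) simp
      finally have 2: "(\<Sum>j<q. measure (\<kappa> j) K) / q - e / 4 - q * (2 / N) \<le> (\<Sum>j<q. measure (\<kappa> j) (B j))" .
      have "((\<Sum>j<q. measure (\<kappa> j) C') + e * q) / q \<le> (\<Sum>j<q. measure (\<kappa> j) K) / q"
        using gap' by (intro divide_right_mono) auto
      then have 3: "(\<Sum>j<q. measure (\<kappa> j) C') / q + e \<le> (\<Sum>j<q. measure (\<kappa> j) K) / q"
        using q by (simp add: add_divide_distrib)
      have 4: "q * (2 / N) \<le> e / 8"
        using N e by (simp add: field_simps)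
      have 5: "measure \<nu> R \<le> e / 4"
        using R_le inv_under_subset[OF \<nu>2 L(3)] by blast
      \<comment> \<open>The error is at most e/4 for R on the left, e/4 for the part of K lost to R,
        and twice e/8 for rounding: 3e/4 in total, against a gap of e.\<close>
      have "measure \<nu> R + (\<Sum>j<q. measure (\<kappa> j) (A j)) < (\<Sum>j<q. measure (\<kappa> j) (B j))"
        using 1 2 3 4 5 e by linarith
      then show ?thesis using Bo by (simp add: m\<kappa>)
    qed
    note main = this
    have sumU: "(\<Sum>i<length ?Us. measure \<nu> (?Us ! i)) = measure \<nu> R + (\<Sum>j<q. measure \<nu> (\<alpha> (inv (x j)) ` A j))" for \<nu>
    proof -
      have "(\<Sum>i<length ?Us. measure \<nu> (?Us ! i)) = (\<Sum>i<Suc q. measure \<nu> (\<alpha> (inv (x i)) ` W i))"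
        by (intro sum.cong) (auto simp del: upt_Suc)
      also have "\<dots> = measure \<nu> (\<alpha> (inv (x q)) ` W q) + (\<Sum>j<q. measure \<nu> (\<alpha> (inv (x j)) ` W j))"
        by simp
      also have "\<alpha> (inv (x q)) ` W q = R"
        by (simp add: x_def W_def act_image_one)
      also have "(\<Sum>j<q. measure \<nu> (\<alpha> (inv (x j)) ` W j)) = (\<Sum>j<q. measure \<nu> (\<alpha> (inv (x j)) ` A j))"
        by (intro sum.cong) (auto simp: W_def)
      finally show ?thesis .
    qed
    have opUs: "\<forall>U\<in>set ?Us. open U" and opVs: "\<forall>V\<in>set ?Vs. open V"
      using opW opB open_act xG by auto
    have "\<forall>\<mu>\<in>invariant_measures (G\<lparr>carrier := \<Lambda>2\<rparr>) \<alpha>.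
          (\<Sum>i<length ?Us. measure \<mu> (?Us ! i)) < (\<Sum>j<length ?Vs. measure \<mu> (?Vs ! j))"
      unfolding sumU using main[OF inv_under_invariant_measures] by simp
    then show "(\<forall>U\<in>set ?Us. open U) \<and> (\<forall>V\<in>set ?Vs. open V) \<and>
        (\<forall>\<mu>\<in>invariant_measures (G\<lparr>carrier := \<Lambda>2\<rparr>) \<alpha>.
          (\<Sum>i<length ?Us. measure \<mu> (?Us ! i)) < (\<Sum>j<length ?Vs. measure \<mu> (?Vs ! j)))"
      using opUs opVs by (intro conjI)
  qed
  moreover have "disjoint_family_on B {..<q}"
    using Bdisj by (simp add: disjoint_family_on_def)
  ultimately have "packable G C (\<Union>j<q. B j)"
    by (intro subeq_sum_pullback[OF LG(2) C xG opW CW])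
  then show ?thesis using BV by (rule packable_mono)
qed

text \<open>Borel sets A are allowed on the left because the remainder of a castle, to be absorbed
  later, is closed and not open.\<close>

lemma subeq_of_measure_less:
  assumes amen: "amenable G" and good: "good_subgroups G \<alpha>" and A: "A \<in> sets borel" and V: "open V"
    and lt: "\<forall>\<mu>\<in>\<M>. measure \<mu> A < measure \<mu> V"
  shows "subeq G \<alpha> A V"
  unfolding subeq_iff_packable
proof (intro allI impI, elim conjE)
  fix C assume C: "closed C" "C \<subseteq> A"
  have "\<forall>\<mu>\<in>\<M>. measure \<mu> C < measure \<mu> V"
  proof
    fix \<mu> assume \<mu>: "\<mu> \<in> \<M>"
    note d = inv_underD[OF inv_under_carrier[OF \<mu>]]
    interpret prob_space \<mu> by (rule d(2))
    have "measure \<mu> C \<le> measure \<mu> A"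
      using C A by (intro finite_measure_mono) (auto simp: d(1))
    then show "measure \<mu> C < measure \<mu> V" using bspec[OF lt \<mu>] by linarith
  qed
  then show "packable G C V"
    by (rule comparison_cover[OF amen good C(1) V])
qed

lemma comparison_of_good_subgroups:
  assumes amen: "amenable G" and good: "good_subgroups G \<alpha>"
  shows "comparison G \<alpha>"
  unfolding comparison_def
  using subeq_of_measure_less[OF amen good borel_open] by simp

section \<open>Small boundaries\<close>

lemma inv_measureD:
  assumes "\<mu> \<in> \<M>"
  shows "sets \<mu> = sets borel" "prob_space \<mu>"
    "\<And>g A. g \<in> carrier G \<Longrightarrow> A \<in> sets borel \<Longrightarrow> measure \<mu> (\<alpha> g ` A) = measure \<mu> A"
  using inv_underD[OF inv_under_carrier[OF assms]] by auto

lemma inv_measure_mono: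
  assumes "\<mu> \<in> \<M>" "A \<subseteq> B" "B \<in> sets borel"
  shows "measure \<mu> A \<le> measure \<mu> B"
proof -
  interpret prob_space \<mu> by (rule inv_measureD(2)[OF assms(1)])
  show ?thesis using assms inv_measureD(1)[OF assms(1)] by (intro finite_measure_mono) auto
qed

lemma inv_measure_Un_le:
  assumes "\<mu> \<in> \<M>" "A \<in> sets borel" "B \<in> sets borel"
  shows "measure \<mu> (A \<union> B) \<le> measure \<mu> A + measure \<mu> B"
  using assms inv_measureD(1)[OF assms(1)] by (intro measure_Un_le) auto

text \<open>The pieces are the levels of one \<Lambda>1-castle. The bound on R passes to the
  measures in \<open>\<M>\<close>, since these are in particular \<Lambda>1-invariant.\<close>

lemma small_pieces:
  assumes good: "good_subgroups G \<alpha>" and "0 < \<delta>" "0 < \<epsilon>"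
  shows "\<exists>\<P> R. finite \<P> \<and> (\<forall>P\<in>\<P>. open P \<and> (\<forall>x\<in>P. \<forall>y\<in>P. dist x y < \<delta>)) \<and> disjoint \<P> \<and>
    open R \<and> UNIV - \<Union>\<P> \<subseteq> R \<and> (\<forall>\<mu>\<in>\<M>. measure \<mu> R \<le> \<epsilon>)"
proof -
  note mp[OF spec[OF spec[OF good[unfolded good_subgroups_def], of "{}"], of 0], simplified]
  then obtain \<Lambda>1 \<Lambda>2 where L: "subgroup \<Lambda>1 G" "almost_finite (G\<lparr>carrier := \<Lambda>1\<rparr>) \<alpha>"
    by (elim exE conjE)
  have LG: "\<Lambda>1 \<subseteq> carrier G" using L(1) by (rule subgroup.subset)
  obtain n :: nat and T U R where
    TU: "\<forall>i<n. finite (T i) \<and> T i \<subseteq> \<Lambda>1 \<and> 0 \<le> 2 * card (T i) \<and> open (U i) \<and>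
      (\<forall>s\<in>T i. \<forall>x\<in>\<alpha> s ` U i. \<forall>y\<in>\<alpha> s ` U i. dist x y < \<delta>)"
    and disj: "disjoint_family_on (\<lambda>(i, s). \<alpha> s ` U i) (Sigma {..<n} T)"
    and R: "open R" "UNIV - (\<Union>i<n. \<Union>s\<in>T i. \<alpha> s ` U i) \<subseteq> R"
    and R_le: "\<forall>\<nu>. inv_under \<Lambda>1 \<nu> \<longrightarrow> measure \<nu> R \<le> \<epsilon>"
    using almost_finite_levels[OF L disjI2[OF le0] assms(2,3)] by (elim exE conjE)
  let ?f = "\<lambda>(i, s). \<alpha> s ` U i"
  let ?P = "?f ` Sigma {..<n} T"
  have "finite ?P" using TU by auto
  moreover have "\<forall>P\<in>?P. open P \<and> (\<forall>x\<in>P. \<forall>y\<in>P. dist x y < \<delta>)"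
  proof
    fix P assume "P \<in> ?P"
    then obtain i s where p: "i < n" "s \<in> T i" "P = \<alpha> s ` U i" by auto
    have "s \<in> carrier G" "open (U i)" using TU p LG by blast+
    then have "open P" using p(3) by (simp add: open_act)
    moreover have "\<forall>x\<in>P. \<forall>y\<in>P. dist x y < \<delta>" unfolding p(3) using TU p by blast
    ultimately show "open P \<and> (\<forall>x\<in>P. \<forall>y\<in>P. dist x y < \<delta>)" by (rule conjI)
  qed
  moreover have "disjoint ?P"
    unfolding disjoint_def
  proof (intro ballI impI)
    fix A B assume "A \<in> ?P" "B \<in> ?P" and ne: "A \<noteq> B"
    then obtain p p' where p: "p \<in> Sigma {..<n} T" "p' \<in> Sigma {..<n} T" "A = ?f p" "B = ?f p'"
      by (elim imageE)
    then have "p \<noteq> p'" using ne by auto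
    then show "A \<inter> B = {}"
      unfolding p(3,4) using disjoint_family_onD[OF disj p(1,2)] by simp
  qed
  moreover have "UNIV - \<Union>?P \<subseteq> R" using R(2) by fastforce
  moreover have "\<forall>\<mu>\<in>\<M>. measure \<mu> R \<le> \<epsilon>"
    using R_le inv_under_subset[OF inv_under_carrier LG] by simp
  ultimately show ?thesis
    using R(1) by (intro exI[of _ ?P] exI[of _ R] conjI)
qed

text \<open>After thickening C and D, every piece off R is joined to one side: to C if it meets the
  thickened C, to D otherwise. Pieces are too small to meet both, and a piece minus R is closed,
  being the complement of R and the other pieces. What remains lies in R.\<close>

lemma separation_step:
  assumes good: "good_subgroups G \<alpha>" and C: "closed C" and D: "closed D" and CD: "C \<inter> D = {}" and e: "0 < \<epsilon>"
  shows "\<exists>C' D'. closed C' \<and> closed D' \<and> C' \<inter> D' = {} \<and> C \<subseteq> interior C' \<and> D \<subseteq> interior D' \<and>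
    (\<forall>\<mu>\<in>\<M>. measure \<mu> (- (C' \<union> D')) \<le> \<epsilon>)"
proof -
  obtain C1 where C1: "closed C1" "C \<subseteq> interior C1" "C1 \<subseteq> - D"
    using closed_thicken[OF C, of "- D"] D CD by auto
  obtain D1 where D1: "closed D1" "D \<subseteq> interior D1" "D1 \<subseteq> - C1"
    using closed_thicken[OF D, of "- C1"] C1 by auto
  obtain \<delta> where \<delta>: "0 < \<delta>" "\<forall>x\<in>C1. \<forall>y. dist x y < \<delta> \<longrightarrow> y \<in> - D1"
    using compact_uniform_ball[OF compact_closed[OF C1(1)], of "- D1"] D1 by auto
  obtain \<P> R where P: "finite \<P>" "\<forall>P\<in>\<P>. open P \<and> (\<forall>x\<in>P. \<forall>y\<in>P. dist x y < \<delta>)" "disjoint \<P>"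
    and R: "open R" "UNIV - \<Union>\<P> \<subseteq> R" "\<forall>\<mu>\<in>\<M>. measure \<mu> R \<le> \<epsilon>"
    using small_pieces[OF good \<delta>(1) e] by (elim exE conjE)
  have clP: "closed (P - R)" if "P \<in> \<P>" for P
  proof -
    have "P - R = - (R \<union> \<Union>(\<P> - {P}))"
    proof
      show "P - R \<subseteq> - (R \<union> \<Union>(\<P> - {P}))"
        using disjointD[OF P(3) that] by auto
      show "- (R \<union> \<Union>(\<P> - {P})) \<subseteq> P - R" using R(2) by auto
    qed
    moreover have "open (R \<union> \<Union>(\<P> - {P}))" using P(2) R(1) by auto
    ultimately show ?thesis by (simp add: closed_def)
  qed
  let ?N = "{P\<in>\<P>. P \<inter> C1 \<noteq> {}}" and ?F = "{P\<in>\<P>. P \<inter> C1 = {}}"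
  let ?C = "C1 \<union> (\<Union>P\<in>?N. P - R)" and ?D = "D1 \<union> (\<Union>P\<in>?F. P - R)"
  have "closed (\<Union>P\<in>?N. P - R)" "closed (\<Union>P\<in>?F. P - R)"
    using P(1) clP by (intro closed_UN; simp)+
  then have "closed ?C" "closed ?D"
    using C1(1) D1(1) by (auto intro!: closed_Un)
  moreover have "?C \<inter> ?D = {}"
  proof -
    have PD: "P \<inter> D1 = {}" if PN: "P \<in> ?N" for P
    proof (rule ccontr)
      assume "P \<inter> D1 \<noteq> {}"
      then obtain y where y: "y \<in> P" "y \<in> D1" by blast
      obtain x where x: "x \<in> P" "x \<in> C1" using PN by blast
      have "dist x y < \<delta>" using P(2) PN x y by blast
      then show False using \<delta>(2) x y by blast
    qed
    have PP: "P \<inter> P' = {}" if "P \<in> ?N" "P' \<in> ?F" for P P'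
      using disjointD[OF P(3), of P P'] that by auto
    have "z \<notin> ?D" if z: "z \<in> ?C" for z
    proof (cases "z \<in> C1")
      case True
      then show ?thesis using D1 by blast
    next
      case False
      then obtain P where "P \<in> ?N" "z \<in> P" using z by blast
      then show ?thesis using PD[of P] PP[of P] by blast
    qed
    then show ?thesis by blast
  qed
  moreover have "C \<subseteq> interior ?C" "D \<subseteq> interior ?D"
    using C1(2) D1(2) interior_mono[of C1 ?C] interior_mono[of D1 ?D] by auto
  moreover have "measure \<mu> (- (?C \<union> ?D)) \<le> \<epsilon>" if \<mu>: "\<mu> \<in> \<M>" for \<mu>
  proof -
    have "- (?C \<union> ?D) \<subseteq> R"
    proof
      fix x assume x: "x \<in> - (?C \<union> ?D)"
      show "x \<in> R"
      proof (rule ccontr)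
        assume "x \<notin> R"
        then obtain P where "P \<in> \<P>" "x \<in> P" using R(2) by blast
        then show False using x \<open>x \<notin> R\<close> by (cases "P \<inter> C1 = {}") auto
      qed
    qed
    then have "measure \<mu> (- (?C \<union> ?D)) \<le> measure \<mu> R"
      using R(1) by (intro inv_measure_mono[OF \<mu>]) auto
    then show ?thesis using bspec[OF R(3) \<mu>] by linarith
  qed
  ultimately show ?thesis
    by (intro exI[of _ ?C] exI[of _ ?D] conjI ballI)
qed

definition null_boundary :: "'x set \<Rightarrow> bool"
  where "null_boundary W \<longleftrightarrow> (\<forall>\<mu>\<in>\<M>. measure \<mu> (frontier W) = 0)"

text \<open>As in Urysohn's lemma, C and the complement of U grow through disjoint closed sets, each
  inside the interior of the next, now with a gap of measure at most 1/(n+1). Both unions are open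
  and disjoint, so the frontier of the first lies in every gap.\<close>

lemma small_boundary:
  assumes good: "good_subgroups G \<alpha>" and C: "closed C" and U: "open U" and CU: "C \<subseteq> U"
  shows "\<exists>W. open W \<and> C \<subseteq> W \<and> W \<subseteq> U \<and> null_boundary W"
proof -
  \<comment> \<open>The clause for n = 0 pins the start of the chain, which dependent choice would
    leave open.\<close>
  let ?P = "\<lambda>(n::nat) (p :: 'x set \<times> 'x set). closed (fst p) \<and> closed (snd p) \<and> fst p \<inter> snd p = {} \<and>
    (n = 0 \<longrightarrow> p = (C, - U))"
  let ?Q = "\<lambda>(n::nat) (p :: 'x set \<times> 'x set) p'. fst p \<subseteq> interior (fst p') \<and> snd p \<subseteq> interior (snd p') \<and>
    (\<forall>\<mu>\<in>\<M>. measure \<mu> (- (fst p' \<union> snd p')) \<le> inverse (real (Suc n)))"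
  have "\<exists>f. \<forall>n. ?P n (f n) \<and> ?Q n (f n) (f (Suc n))"
  proof (rule dependent_nat_choice)
    show "\<exists>p. ?P 0 p" using C U CU by (intro exI[of _ "(C, - U)"]) auto
  next
    fix p n assume p: "?P n p"
    have "\<exists>C' D'. closed C' \<and> closed D' \<and> C' \<inter> D' = {} \<and> fst p \<subseteq> interior C' \<and> snd p \<subseteq> interior D' \<and>
      (\<forall>\<mu>\<in>\<M>. measure \<mu> (- (C' \<union> D')) \<le> inverse (real (Suc n)))"
      using p by (intro separation_step[OF good]) simp_all
    then obtain C' D' where "closed C'" "closed D'" "C' \<inter> D' = {}" "fst p \<subseteq> interior C'" "snd p \<subseteq> interior D'"
      "\<forall>\<mu>\<in>\<M>. measure \<mu> (- (C' \<union> D')) \<le> inverse (real (Suc n))"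
      by (elim exE conjE)
    then show "\<exists>p'. ?P (Suc n) p' \<and> ?Q n p p'"
      by (intro exI[of _ "(C', D')"]) simp
  qed
  then obtain f where f': "\<forall>n. ?P n (f n) \<and> ?Q n (f n) (f (Suc n))"
    by (rule exE)
  have f: "?P n (f n)" "?Q n (f n) (f (Suc n))" for n
    using spec[OF f', of n] by (rule conjunct1, rule conjunct2)
  define A where "A n = fst (f n)" for n
  define B where "B n = snd (f n)" for n
  have A0: "A 0 = C" "B 0 = - U" using f(1)[of 0] by (auto simp: A_def B_def)
  have disj: "A n \<inter> B n = {}" for n using f(1)[of n] by (simp add: A_def B_def)
  have int: "A n \<subseteq> interior (A (Suc n))" "B n \<subseteq> interior (B (Suc n))" for n
    using f(2)[of n] by (auto simp: A_def B_def)
  have cl: "closed (A n)" "closed (B n)" for n using f(1)[of n] by (auto simp: A_def B_def)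
  have small: "measure \<mu> (- (A (Suc n) \<union> B (Suc n))) \<le> inverse (real (Suc n))"
    if "\<mu> \<in> \<M>" for \<mu> n
    using f(2)[of n] that by (simp add: A_def B_def)
  have mono: "A m \<subseteq> A n" "B m \<subseteq> B n" if "m \<le> n" for m n
    using lift_Suc_mono_le[of A, OF subset_trans[OF int(1) interior_subset] that]
      lift_Suc_mono_le[of B, OF subset_trans[OF int(2) interior_subset] that] by auto
  define W where "W = (\<Union>n. A n)"
  define W' where "W' = (\<Union>n. B n)"
  have "(\<Union>n. F n) = (\<Union>n. interior (F (Suc n)))" if "\<And>n. F n \<subseteq> interior (F (Suc n))" for F :: "nat \<Rightarrow> 'x set"
  proof
    show "(\<Union>n. F n) \<subseteq> (\<Union>n. interior (F (Suc n)))"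
      by (intro UN_mono that subset_refl)
    show "(\<Union>n. interior (F (Suc n))) \<subseteq> (\<Union>n. F n)"
      by (rule UN_least, rule order_trans[OF interior_subset], rule UN_upper, rule UNIV_I)
  qed
  from this[of A, OF int(1)] this[of B, OF int(2)]
  have "W = (\<Union>n. interior (A (Suc n)))" "W' = (\<Union>n. interior (B (Suc n)))"
    unfolding W_def W'_def .
  then have op: "open W" "open W'" by auto
  have "W \<inter> W' = {}"
  proof (rule ccontr)
    assume "W \<inter> W' \<noteq> {}"
    then obtain x m n where x: "x \<in> A m" "x \<in> B n" by (auto simp: W_def W'_def)
    then have "x \<in> A (max m n)" "x \<in> B (max m n)"
      using mono[of m "max m n"] mono[of n "max m n"] by auto
    then show False using disj[of "max m n"] by blast
  qed
  then have "closure W \<subseteq> - W'"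
    using op(2) by (intro closure_minimal) auto
  then have fr: "frontier W \<subseteq> - (W \<union> W')"
    using op(1) by (auto simp: frontier_def interior_open)
  have "measure \<mu> (frontier W) = 0" if \<mu>: "\<mu> \<in> \<M>" for \<mu>
  proof -
    have "measure \<mu> (frontier W) \<le> inverse (real (Suc n))" for n
    proof -
      have "frontier W \<subseteq> - (A (Suc n) \<union> B (Suc n))"
        using fr by (auto simp: W_def W'_def)
      then have "measure \<mu> (frontier W) \<le> measure \<mu> (- (A (Suc n) \<union> B (Suc n)))"
        using cl by (intro inv_measure_mono[OF \<mu>]) auto
      then show ?thesis using small[OF \<mu>, of n] by linarith
    qed
    then have "measure \<mu> (frontier W) \<le> 0"
      by (intro LIMSEQ_le_const[OF LIMSEQ_inverse_real_of_nat]) blast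
    then show ?thesis by (simp add: measure_le_0_iff)
  qed
  then have "null_boundary W" by (simp add: null_boundary_def)
  moreover have "C \<subseteq> W" using A0(1) by (auto simp: W_def)
  moreover have "W \<subseteq> U"
  proof -
    have "- U \<subseteq> W'" using A0(2) by (auto simp: W'_def)
    then show ?thesis using \<open>W \<inter> W' = {}\<close> by blast
  qed
  ultimately show ?thesis using op(1) by blast
qed

section \<open>Closure properties of null boundaries, and bases adapted to a free action\<close>

lemma null_boundary_mono:
  assumes "\<And>i. i \<in> I \<Longrightarrow> null_boundary (A i)" "finite I" "frontier B \<subseteq> (\<Union>i\<in>I. frontier (A i))"
  shows "null_boundary B"
  unfolding null_boundary_def
proof
  fix \<mu> assume \<mu>: "\<mu> \<in> \<M>"
  interpret prob_space \<mu> by (rule inv_measureD(2)[OF \<mu>])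
  have "measure \<mu> (frontier B) \<le> measure \<mu> (\<Union>i\<in>I. frontier (A i))"
    using assms by (intro inv_measure_mono[OF \<mu>]) (auto intro!: borel_closed closed_UN)
  also have "\<dots> \<le> (\<Sum>i\<in>I. measure \<mu> (frontier (A i)))"
    using assms(2) by (intro finite_measure_subadditive_finite) (auto simp: inv_measureD(1)[OF \<mu>])
  also have "\<dots> = 0"
    using assms(1) \<mu> by (simp add: null_boundary_def)
  finally show "measure \<mu> (frontier B) = 0" by (simp add: measure_le_0_iff)
qed

lemma null_boundary_Un: "null_boundary A \<Longrightarrow> null_boundary B \<Longrightarrow> null_boundary (A \<union> B)"
  using null_boundary_mono[of "{A, B}" "\<lambda>A. A" "A \<union> B"] frontier_Un_subset[of A B] by auto

lemma null_boundary_Int: "null_boundary A \<Longrightarrow> null_boundary B \<Longrightarrow> null_boundary (A \<inter> B)"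
  using null_boundary_mono[of "{A, B}" "\<lambda>A. A" "A \<inter> B"] frontier_Int_subset[of A B] by auto

lemma null_boundary_Compl: "null_boundary A \<Longrightarrow> null_boundary (- A)"
  by (simp add: null_boundary_def frontier_complement)

lemma null_boundary_closure: "null_boundary A \<Longrightarrow> null_boundary (closure A)"
  using null_boundary_mono[of "{A}" "\<lambda>A. A" "closure A"] interior_mono[OF closure_subset, of A]
  by (auto simp: frontier_def)

lemma null_boundary_UNIV: "null_boundary UNIV"
  by (simp add: null_boundary_def)

lemma null_boundary_empty: "null_boundary {}"
  by (simp add: null_boundary_def)

lemma frontier_act:
  assumes "g \<in> carrier G"
  shows "frontier (\<alpha> g ` A) = \<alpha> g ` frontier A"
proof -
  obtain h where h: "homeomorphism UNIV UNIV (\<alpha> g) h" using act_homeomorphism[OF assms] by blast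
  have "closure (\<alpha> g ` A) = \<alpha> g ` closure A" for A
  proof
    show "closure (\<alpha> g ` A) \<subseteq> \<alpha> g ` closure A"
      using assms by (intro closure_minimal image_mono closure_subset closed_act) auto
    have "closure A \<subseteq> \<alpha> (inv g) ` closure (\<alpha> g ` A)"
    proof (rule closure_minimal)
      have "A = \<alpha> (inv g) ` \<alpha> g ` A" using assms by (simp add: image_image act_inv)
      also have "\<dots> \<subseteq> \<alpha> (inv g) ` closure (\<alpha> g ` A)" by (intro image_mono closure_subset)
      finally show "A \<subseteq> \<alpha> (inv g) ` closure (\<alpha> g ` A)" .
    qed (use assms in \<open>auto intro: closed_act\<close>)
    then have "\<alpha> g ` closure A \<subseteq> \<alpha> g ` \<alpha> (inv g) ` closure (\<alpha> g ` A)" by (rule image_mono)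
    then show "\<alpha> g ` closure A \<subseteq> closure (\<alpha> g ` A)"
      using assms by (simp add: image_image act_inv)
  qed
  moreover have "bij (\<alpha> g)"
    using inj_act[OF assms] act_inv(2)[OF assms] by (intro bijI surjI)
  then have "- (\<alpha> g ` A) = \<alpha> g ` (- A)" for A
    by (simp add: bij_image_Compl_eq)
  ultimately show ?thesis
    using inj_act[OF assms] by (simp add: frontier_closures image_Int)
qed

lemma null_boundary_act:
  assumes "g \<in> carrier G" "null_boundary A"
  shows "null_boundary (\<alpha> g ` A)"
  using assms inv_measureD(3)[OF _ assms(1), of _ "frontier A"]
  by (simp add: null_boundary_def frontier_act)

lemma null_boundary_INT:
  assumes "finite I" "\<And>i. i \<in> I \<Longrightarrow> null_boundary (A i)"
  shows "null_boundary (\<Inter>i\<in>I. A i)"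
  using assms by (induction I rule: finite_induct) (auto simp: null_boundary_UNIV intro: null_boundary_Int)

lemma null_boundary_UN:
  assumes "finite I" "\<And>i. i \<in> I \<Longrightarrow> null_boundary (A i)"
  shows "null_boundary (\<Union>i\<in>I. A i)"
  using assms by (induction I rule: finite_induct) (auto simp: null_boundary_empty intro: null_boundary_Un)

lemma free_actD:
  assumes "free_action G \<alpha>" "s \<in> carrier G" "t \<in> carrier G" "\<alpha> s x = \<alpha> t x"
  shows "s = t"
proof -
  have "\<alpha> (inv t \<otimes> s) x = x" using assms by (simp add: act_mult act_inv)
  then have "inv t \<otimes> s \<in> stabilizer G \<alpha> x" using assms by (simp add: stabilizer_def)
  then have "inv t \<otimes> s = \<one>" using assms(1) by (simp add: free_action_def)
  then have "inv t = inv s" using assms by (intro inv_equality[symmetric]) auto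
  then show ?thesis using assms by (metis inv_inv)
qed

text \<open>By freeness the points \<open>\<alpha> s x\<close> are distinct, so a small
  neighbourhood of x has disjoint small images; \<open>small_boundary\<close> gives it a null
  boundary and compactness leaves finitely many. Over such a set, S can be the shape of an open
  tower.\<close>

lemma separating_cover:
  assumes good: "good_subgroups G \<alpha>" and free: "free_action G \<alpha>" and S: "finite S" "S \<subseteq> carrier G" and e: "0 < \<epsilon>"
  shows "\<exists>\<Q>. finite \<Q> \<and> \<Union>\<Q> = UNIV \<and> (\<forall>Q\<in>\<Q>. open Q \<and> null_boundary Q \<and>
    (\<forall>s\<in>S. \<forall>t\<in>S. s \<noteq> t \<longrightarrow> \<alpha> s ` Q \<inter> \<alpha> t ` Q = {}) \<and> (\<forall>s\<in>S. \<forall>x\<in>Q. \<forall>y\<in>Q. dist (\<alpha> s x) (\<alpha> s y) < \<epsilon>))"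
proof -
  let ?good = "\<lambda>Q. open Q \<and> null_boundary Q \<and>
    (\<forall>s\<in>S. \<forall>t\<in>S. s \<noteq> t \<longrightarrow> \<alpha> s ` Q \<inter> \<alpha> t ` Q = {}) \<and> (\<forall>s\<in>S. \<forall>x\<in>Q. \<forall>y\<in>Q. dist (\<alpha> s x) (\<alpha> s y) < \<epsilon>)"
  have "\<exists>Q. x \<in> Q \<and> ?good Q" for x
  proof -
    \<comment> \<open>The list of lengths to stay below: \<epsilon> for the diameters, the distances
      in the orbit for disjointness. Including \<epsilon> makes \<open>Min D\<close> meaningful when
      there are no such distances.\<close>
    define D where "D = insert \<epsilon> ((\<lambda>(s, t). dist (\<alpha> s x) (\<alpha> t x)) ` {p\<in>S \<times> S. fst p \<noteq> snd p})"
    have finD: "finite D" using S by (simp add: D_def)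
    have posD: "0 < d" if dD: "d \<in> D" for d
    proof (cases "d = \<epsilon>")
      case False
      then obtain s t where st: "s \<in> S" "t \<in> S" "s \<noteq> t" "d = dist (\<alpha> s x) (\<alpha> t x)"
        using dD by (auto simp: D_def)
      then have "\<alpha> s x \<noteq> \<alpha> t x"
        using free_actD[OF free, of s t x] S(2) by blast
      then show ?thesis using st(4) by simp
    qed (use e in simp)
    define r where "r = Min D / 2"
    have r: "0 < r" using Min_in[OF finD] posD by (auto simp: r_def D_def)
    have r_le: "2 * r \<le> d" if "d \<in> D" for d
      using Min_le[OF finD that] by (simp add: r_def)
    define U where "U = (\<Inter>s\<in>S. \<alpha> s -` ball (\<alpha> s x) r)"
    have "open U"
      unfolding U_def using S by (intro open_INT ballI open_vimage continuous_act) auto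
    moreover have "{x} \<subseteq> U" using r by (simp add: U_def)
    ultimately have "\<exists>W. open W \<and> {x} \<subseteq> W \<and> W \<subseteq> U \<and> null_boundary W"
      by (intro small_boundary[OF good closed_singleton])
    then obtain W where W: "open W" "{x} \<subseteq> W" "W \<subseteq> U" "null_boundary W"
      by (elim exE conjE)
    have near: "dist (\<alpha> s x) (\<alpha> s y) < r" if "s \<in> S" "y \<in> W" for s y
      using W(3) that by (auto simp: U_def)
    have "\<alpha> s ` W \<inter> \<alpha> t ` W = {}" if st: "s \<in> S" "t \<in> S" "s \<noteq> t" for s t
    proof (rule ccontr)
      assume "\<alpha> s ` W \<inter> \<alpha> t ` W \<noteq> {}"
      then obtain y z where yz: "y \<in> W" "z \<in> W" "\<alpha> s y = \<alpha> t z" by blast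
      have "dist (\<alpha> s x) (\<alpha> t x) \<le> dist (\<alpha> s x) (\<alpha> s y) + dist (\<alpha> t x) (\<alpha> s y)"
        by (rule dist_triangle2)
      also have "\<dots> < 2 * r" using near[OF st(1) yz(1)] near[OF st(2) yz(2)] yz(3) by simp
      also have "\<dots> \<le> dist (\<alpha> s x) (\<alpha> t x)"
      proof (rule r_le)
        have "(s, t) \<in> {p\<in>S \<times> S. fst p \<noteq> snd p}" using st by simp
        then show "dist (\<alpha> s x) (\<alpha> t x) \<in> D"
          unfolding D_def by (intro insertI2 image_eqI[where x = "(s, t)"]) simp_all
      qed
      finally show False by simp
    qed
    moreover have "dist (\<alpha> s y) (\<alpha> s z) < \<epsilon>" if "s \<in> S" "y \<in> W" "z \<in> W" for s y z
    proof -
      have "dist (\<alpha> s y) (\<alpha> s z) \<le> dist (\<alpha> s x) (\<alpha> s y) + dist (\<alpha> s x) (\<alpha> s z)"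
        by (rule dist_triangle3)
      also have "\<dots> < 2 * r" using near[OF that(1,2)] near[OF that(1,3)] by simp
      also have "\<dots> \<le> \<epsilon>" by (rule r_le) (simp add: D_def)
      finally show ?thesis .
    qed
    ultimately show ?thesis using W by (intro exI[of _ W]) simp
  qed
  then have "\<forall>x. \<exists>Q. x \<in> Q \<and> ?good Q" by (rule allI)
  from choice[OF this] obtain Q where Q: "\<forall>x. x \<in> Q x \<and> ?good (Q x)" by (elim exE)
  obtain X where X: "finite X" "UNIV \<subseteq> (\<Union>x\<in>X. Q x)"
  proof (rule compactE_image[OF compact_space, of UNIV Q])
    show "open (Q x)" for x using Q by simp
    show "UNIV \<subseteq> \<Union>(range Q)" using Q by blast
  qed
  have "finite (Q ` X)" "\<Union>(Q ` X) = UNIV" using X by auto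
  moreover have "\<forall>P\<in>Q ` X. ?good P"
    using Q by - (rule ballI, erule imageE, hypsubst, rule conjunct2, erule spec)
  ultimately show ?thesis
    by (intro exI[of _ "Q ` X"] conjI)
qed

section \<open>Quasi-tilings\<close>

definition covered :: "('g set \<times> 'g set \<times> 'x set) set \<Rightarrow> 'x set"
  where "covered \<L> = (\<Union>(S, T, V)\<in>\<L>. \<Union>t\<in>T. \<alpha> t ` V)"

text \<open>
  In an entry \<open>(S, T, V)\<close> the full shape \<open>S\<close> is almost invariant, and \<open>T\<close> is what is left of it after
  trimming the overlap with tiles placed earlier; only the trimmed tiles are disjoint, but the full tiles
  cover no more than the trimmed ones.
\<close>

definition tile :: "'g set \<Rightarrow> real \<Rightarrow> real \<Rightarrow> real \<Rightarrow> 'x set \<Rightarrow> 'g set \<Rightarrow> 'g set \<Rightarrow> 'x set \<Rightarrow> bool"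
  where "tile F \<eta> \<beta> \<delta> A S T V \<longleftrightarrow>
    finite S \<and> S \<noteq> {} \<and> S \<subseteq> carrier G \<and> real (card ((F <#> S) - S)) \<le> \<eta> * real (card S) \<and>
    T \<subseteq> S \<and> (1 - \<beta>) * real (card S) \<le> real (card T) \<and> open V \<and>
    (\<forall>t\<in>T. \<forall>x\<in>V. \<forall>y\<in>V. dist (\<alpha> t x) (\<alpha> t y) < \<delta>) \<and> (\<forall>s\<in>S. \<alpha> s ` V \<subseteq> A)"

text \<open>The null boundary is carried along because later tiles are placed according to which
  orbit positions are already covered, a distinction made by open sets only away from the
  frontier.\<close>

definition tiling ::
    "'g set \<Rightarrow> real \<Rightarrow> real \<Rightarrow> real \<Rightarrow> ('g set \<times> 'g set \<times> 'x set) set \<Rightarrow> bool"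
  where "tiling F \<eta> \<beta> \<delta> \<L> \<longleftrightarrow> finite \<L> \<and>
    (\<forall>(S, T, V)\<in>\<L>. tile F \<eta> \<beta> \<delta> (covered \<L>) S T V) \<and> null_boundary (covered \<L>) \<and>
    disjoint_family_on (\<lambda>(p, t). \<alpha> t ` snd (snd p)) (SIGMA p:\<L>. fst (snd p))"

lemma tilingD:
  assumes "tiling F \<eta> \<beta> \<delta> \<L>" "(S, T, V) \<in> \<L>"
  shows "finite S" "S \<noteq> {}" "S \<subseteq> carrier G" "real (card ((F <#> S) - S)) \<le> \<eta> * real (card S)" "T \<subseteq> S"
    "(1 - \<beta>) * real (card S) \<le> real (card T)" "open V"
    "\<And>t x y. t \<in> T \<Longrightarrow> x \<in> V \<Longrightarrow> y \<in> V \<Longrightarrow> dist (\<alpha> t x) (\<alpha> t y) < \<delta>"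
    "\<And>s. s \<in> S \<Longrightarrow> \<alpha> s ` V \<subseteq> covered \<L>" "finite T" "T \<subseteq> carrier G"
proof -
  have "tile F \<eta> \<beta> \<delta> (covered \<L>) S T V"
    using bspec[OF conjunct1[OF conjunct2[OF assms(1)[unfolded tiling_def]]] assms(2)] unfolding prod.case .
  note * = this[unfolded tile_def]
  then show "finite S" "S \<noteq> {}" "S \<subseteq> carrier G" "real (card ((F <#> S) - S)) \<le> \<eta> * real (card S)" "T \<subseteq> S"
    "(1 - \<beta>) * real (card S) \<le> real (card T)" "open V"
    by - (elim conjE, assumption)+
  show "\<And>t x y. t \<in> T \<Longrightarrow> x \<in> V \<Longrightarrow> y \<in> V \<Longrightarrow> dist (\<alpha> t x) (\<alpha> t y) < \<delta>"
    "\<And>s. s \<in> S \<Longrightarrow> \<alpha> s ` V \<subseteq> covered \<L>"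
    using * by simp_all
  show "finite T" "T \<subseteq> carrier G" using * finite_subset by auto
qed

lemma tiling_level: "(S, T, V) \<in> \<L> \<Longrightarrow> t \<in> T \<Longrightarrow> \<alpha> t ` V \<subseteq> covered \<L>"
  unfolding covered_def by (rule subset_trans[OF _ UN_upper]) auto

lemma open_covered:
  assumes "tiling F \<eta> \<beta> \<delta> \<L>"
  shows "open (covered \<L>)"
  unfolding covered_def
proof (intro open_UN ballI)
  fix p assume p: "p \<in> \<L>"
  obtain S T V where e: "p = (S, T, V)" by (cases p)
  note d = tilingD[OF assms p[unfolded e]]
  show "open (case p of (S, T, V) \<Rightarrow> \<Union>t\<in>T. \<alpha> t ` V)"
    unfolding e using open_act d(7,11) by auto
qed

lemma covered_Un: "covered (\<L> \<union> \<N>) = covered \<L> \<union> covered \<N>"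
  by (simp add: covered_def)

lemma empty_tiling: "tiling F \<eta> \<beta> \<delta> {}"
  by (simp add: tiling_def covered_def null_boundary_empty disjoint_family_on_def)

lemma set_mult_mono: "F \<subseteq> F' \<Longrightarrow> F <#> S \<subseteq> F' <#> S"
  by (auto simp: set_mult_def)

lemma tiling_mono:
  assumes t: "tiling F' \<eta>' \<beta> \<delta> \<L>" and F: "F \<subseteq> F'" "finite F'" and \<eta>: "\<eta>' \<le> \<eta>"
  shows "tiling F \<eta> \<beta> \<delta> \<L>"
proof -
  have "real (card ((F <#> S) - S)) \<le> \<eta> * real (card S)" if p: "(S, T, V) \<in> \<L>" for S T V
  proof -
    note d = tilingD[OF t p]
    have "card ((F <#> S) - S) \<le> card ((F' <#> S) - S)"
      using set_mult_mono[OF F(1)] finite_set_mult[OF F(2) d(1)] by (intro card_mono) auto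
    moreover have "\<eta>' * real (card S) \<le> \<eta> * real (card S)" using \<eta> by (intro mult_right_mono) auto
    ultimately show ?thesis using d(4) by linarith
  qed
  note card = this
  show ?thesis
    unfolding tiling_def
  proof (intro conjI ballI)
    fix p assume p: "p \<in> \<L>"
    obtain S T V where e: "p = (S, T, V)" by (cases p)
    note d = tilingD[OF t p[unfolded e]]
    show "case p of (S, T, V) \<Rightarrow> tile F \<eta> \<beta> \<delta> (covered \<L>) S T V"
      unfolding e prod.case tile_def using d(1-3,5-9) card[OF p[unfolded e]] by (intro conjI ballI)
  qed (use t in \<open>simp_all add: tiling_def\<close>)
qed

text \<open>
  The greedy step: over the base \<open>Q\<close>, place a tile of shape \<open>S\<close> wherever at most a \<open>\<beta>\<close>-fraction of it is
  already covered. Points over which no tile is placed then see a \<open>\<beta>\<close>-fraction of covered points.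
\<close>

lemma tiling_extend:
  assumes t: "tiling F \<eta> \<beta> \<delta> \<L>"
    and Q: "open Q" "null_boundary Q" "\<And>s t. s \<in> S \<Longrightarrow> t \<in> S \<Longrightarrow> s \<noteq> t \<Longrightarrow> \<alpha> s ` Q \<inter> \<alpha> t ` Q = {}"
      "\<And>s x y. s \<in> S \<Longrightarrow> x \<in> Q \<Longrightarrow> y \<in> Q \<Longrightarrow> dist (\<alpha> s x) (\<alpha> s y) < \<delta>"
    and S: "finite S" "S \<noteq> {}" "S \<subseteq> carrier G" "real (card ((F <#> S) - S)) \<le> \<eta> * real (card S)"
    and \<beta>: "\<beta> \<le> 1"
  shows "\<exists>\<L>'. tiling F \<eta> \<beta> \<delta> \<L>' \<and> covered \<L> \<subseteq> covered \<L>' \<and>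
    (\<forall>x\<in>Q. x \<notin> (\<Union>s\<in>S. \<alpha> (inv s) ` frontier (covered \<L>)) \<longrightarrow> \<beta> * real (card S) \<le> real (card {s\<in>S. \<alpha> s x \<in> covered \<L>'}))"
proof -
  define A where "A = covered \<L>"
  have opA: "open A" using open_covered[OF t] by (simp add: A_def)
  have nbA: "null_boundary A" using t by (simp add: tiling_def A_def)
  define \<T> where "\<T> = {T. T \<subseteq> S \<and> (1 - \<beta>) * real (card S) \<le> real (card T)}"
  have fin\<T>: "finite \<T>" using S(1) by (simp add: \<T>_def)
  \<comment> \<open>These are the points of Q whose free positions are exactly T. Freeness is tested
    against the closure of A to keep the set open. The sets for different T are disjoint and miss
    only points moved onto the frontier of A.\<close>
  define V where "V T = Q \<inter> (\<Inter>s\<in>T. \<alpha> (inv s) ` (- closure A)) \<inter> (\<Inter>s\<in>S - T. \<alpha> (inv s) ` A)" for T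
  define \<N> where "\<N> = (\<lambda>T. (S, T, V T)) ` \<T>"
  have sG: "s \<in> carrier G" if "s \<in> S" for s using that S(3) by blast
  have memV: "x \<in> V T \<longleftrightarrow> x \<in> Q \<and> (\<forall>s\<in>T. \<alpha> s x \<notin> closure A) \<and> (\<forall>s\<in>S - T. \<alpha> s x \<in> A)" if "T \<subseteq> S" for x T
    using that sG by (auto simp: V_def mem_act_inv subset_iff)
  have opV: "open (V T)" if "T \<in> \<T>" for T
  proof -
    have T: "T \<subseteq> S" "finite T" using that S(1) finite_subset by (auto simp: \<T>_def)
    have "open (\<alpha> (inv s) ` (- closure A))" "open (\<alpha> (inv s) ` A)" if "s \<in> S" for s
      using sG[OF that] opA by (auto intro!: open_act)
    then show ?thesis
      unfolding V_def using T S(1) Q(1) by (intro open_Int open_INT ballI) auto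
  qed
  have nbV: "null_boundary (V T)" if "T \<in> \<T>" for T
  proof -
    have T: "T \<subseteq> S" "finite T" using that S(1) finite_subset by (auto simp: \<T>_def)
    have "null_boundary (\<alpha> (inv s) ` (- closure A))" "null_boundary (\<alpha> (inv s) ` A)" if "s \<in> S" for s
      using sG[OF that] nbA by (auto intro!: null_boundary_act null_boundary_Compl null_boundary_closure)
    then show ?thesis
      unfolding V_def using T S(1) Q(2) by (intro null_boundary_Int null_boundary_INT) auto
  qed
  have covN: "covered \<N> = (\<Union>T\<in>\<T>. \<Union>s\<in>T. \<alpha> s ` V T)"
    by (simp add: covered_def \<N>_def)
  let ?L = "\<L> \<union> \<N>"
  have cov': "covered ?L = A \<union> covered \<N>" by (simp add: covered_Un A_def)
  have nb: "null_boundary (covered ?L)"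
    unfolding cov' covN
  proof (intro null_boundary_Un nbA null_boundary_UN fin\<T>)
    fix T assume T: "T \<in> \<T>"
    then show "finite T" using S(1) finite_subset by (auto simp: \<T>_def)
    show "null_boundary (\<alpha> s ` V T)" if "s \<in> T" for s
      using that T sG nbV by (intro null_boundary_act) (auto simp: \<T>_def)
  qed
  have entries: "tile F \<eta> \<beta> \<delta> (covered ?L) S' T U"
    if p: "(S', T, U) \<in> ?L" for S' T U
  proof (cases "(S', T, U) \<in> \<L>")
    case True
    note d = tilingD[OF t True]
    have "\<forall>s\<in>S'. \<alpha> s ` U \<subseteq> covered ?L"
      unfolding cov' A_def using d(9) by (intro ballI le_supI1)
    moreover have "\<forall>t\<in>T. \<forall>x\<in>U. \<forall>y\<in>U. dist (\<alpha> t x) (\<alpha> t y) < \<delta>" using d(8) by (intro ballI)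
    ultimately show ?thesis unfolding tile_def using d(1-7) by (intro conjI)
  next
    case False
    then have e: "S' = S" "T \<in> \<T>" "U = V T" using p by (auto simp: \<N>_def)
    have TS: "T \<subseteq> S" "(1 - \<beta>) * real (card S) \<le> real (card T)" using e(2) by (auto simp: \<T>_def)
    have "\<alpha> s ` V T \<subseteq> covered ?L" if s: "s \<in> S" for s
    proof (cases "s \<in> T")
      case True
      then show ?thesis unfolding cov' covN using e(2) by blast
    next
      case False
      have "\<alpha> s ` V T \<subseteq> A"
        using memV[OF TS(1)] False s by blast
      then show ?thesis unfolding cov' by blast
    qed
    moreover have "dist (\<alpha> s x) (\<alpha> s y) < \<delta>" if "s \<in> T" "x \<in> V T" "y \<in> V T" for s x y
      using that memV[OF TS(1)] TS(1) by (intro Q(4)) auto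
    ultimately show ?thesis
      unfolding e(1,3) tile_def using S TS opV[OF e(2)] by (intro conjI ballI)
  qed
  have newA: "\<alpha> s ` V T \<inter> A = {}" if "T \<in> \<T>" "s \<in> T" for T s
  proof -
    have "T \<subseteq> S" using that by (simp add: \<T>_def)
    then have "\<alpha> s x \<notin> closure A" if "x \<in> V T" for x
      using memV[of T x] that \<open>s \<in> T\<close> by blast
    then show ?thesis using closure_subset[of A] by blast
  qed
  have disj: "disjoint_family_on (\<lambda>(p, t). \<alpha> t ` snd (snd p)) (SIGMA p:?L. fst (snd p))"
    unfolding disjoint_family_on_def
  proof (intro ballI impI)
    fix x y assume x: "x \<in> (SIGMA p:?L. fst (snd p))" and y: "y \<in> (SIGMA p:?L. fst (snd p))" and ne: "x \<noteq> y"
    obtain S1 T1 V1 t1 where ex: "x = ((S1, T1, V1), t1)" by (metis surj_pair)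
    obtain S2 T2 V2 t2 where ey: "y = ((S2, T2, V2), t2)" by (metis surj_pair)
    have m1: "(S1, T1, V1) \<in> ?L" "t1 \<in> T1" using x ex by auto
    have m2: "(S2, T2, V2) \<in> ?L" "t2 \<in> T2" using y ey by auto
    have N: "\<exists>T\<in>\<T>. p = (S, T, V T)" if "p \<in> \<N>" for p using that by (auto simp: \<N>_def)
    have old: "\<alpha> t ` U \<subseteq> A" if "(S', T, U) \<in> \<L>" "t \<in> T" for S' T U t
      using tiling_level[OF that] by (simp add: A_def)
    have "\<alpha> t1 ` V1 \<inter> \<alpha> t2 ` V2 = {}"
    proof (cases "(S1, T1, V1) \<in> \<L>")
      case o1: True
      show ?thesis
      proof (cases "(S2, T2, V2) \<in> \<L>")
        case True
        have "disjoint_family_on (\<lambda>(p, t). \<alpha> t ` snd (snd p)) (SIGMA p:\<L>. fst (snd p))"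
          using t by (simp add: tiling_def)
        from disjoint_family_onD[OF this, of x y] show ?thesis
          using o1 True m1 m2 ne ex ey by auto
      next
        case False
        then have "T2 \<in> \<T>" "V2 = V T2" using m2 N by auto
        then show ?thesis using newA[of T2 t2] m2(2) old[OF o1 m1(2)] by blast
      qed
    next
      case False
      then have n1: "T1 \<in> \<T>" "V1 = V T1" "S1 = S" using m1 N by auto
      show ?thesis
      proof (cases "(S2, T2, V2) \<in> \<L>")
        case True
        then show ?thesis using newA[OF n1(1) m1(2)] n1(2) old[OF True m2(2)] by blast
      next
        case False
        then have n2: "T2 \<in> \<T>" "V2 = V T2" "S2 = S" using m2 N by auto
        have TS: "T1 \<subseteq> S" "T2 \<subseteq> S" using n1(1) n2(1) by (auto simp: \<T>_def)
        show ?thesis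
        proof (cases "t1 = t2")
          case True
          then have "T1 \<noteq> T2" using ne ex ey n1 n2 by auto
          have "V T1 \<inter> V T2 = {}"
          proof (rule ccontr)
            assume "V T1 \<inter> V T2 \<noteq> {}"
            then obtain z where z: "z \<in> V T1" "z \<in> V T2" by blast
            have "T1 = {s\<in>S. \<alpha> s z \<notin> A}"
              using z(1) memV[OF TS(1)] TS(1) closure_subset[of A] by blast
            moreover have "T2 = {s\<in>S. \<alpha> s z \<notin> A}"
              using z(2) memV[OF TS(2)] TS(2) closure_subset[of A] by blast
            ultimately show False using \<open>T1 \<noteq> T2\<close> by simp
          qed
          moreover have "inj (\<alpha> t1)" using inj_act sG TS(1) m1(2) by blast
          ultimately show ?thesis
            unfolding n1(2) n2(2) True[symmetric] by (simp add: image_Int[symmetric])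
        next
          case False
          have "V T1 \<subseteq> Q" "V T2 \<subseteq> Q" by (auto simp: V_def)
          moreover have "\<alpha> t1 ` Q \<inter> \<alpha> t2 ` Q = {}"
            using Q(3) False m1(2) m2(2) TS by blast
          ultimately show ?thesis unfolding n1(2) n2(2) by blast
        qed
      qed
    qed
    then show "(case x of (p, t) \<Rightarrow> \<alpha> t ` snd (snd p)) \<inter> (case y of (p, t) \<Rightarrow> \<alpha> t ` snd (snd p)) = {}"
      by (simp add: ex ey)
  qed
  have "finite ?L" using t fin\<T> by (simp add: tiling_def \<N>_def)
  then have til: "tiling F \<eta> \<beta> \<delta> ?L"
    unfolding tiling_def
  proof (intro conjI ballI nb disj)
    fix p assume p: "p \<in> ?L"
    obtain S' T U where e: "p = (S', T, U)" by (cases p)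
    show "case p of (S, T, V) \<Rightarrow> tile F \<eta> \<beta> \<delta> (covered ?L) S T V"
      unfolding e prod.case by (rule entries[OF p[unfolded e]])
  qed
  have count: "\<beta> * real (card S) \<le> real (card {s\<in>S. \<alpha> s x \<in> covered ?L})"
    if x: "x \<in> Q" "x \<notin> (\<Union>s\<in>S. \<alpha> (inv s) ` frontier A)" for x
  proof -
    define T where "T = {s\<in>S. \<alpha> s x \<notin> A}"
    have TS: "T \<subseteq> S" by (auto simp: T_def)
    have c: "card (S - T) = card S - card T" "card T \<le> card S"
      using TS S(1) by (auto intro: card_Diff_subset card_mono finite_subset)
    show ?thesis
    proof (cases "T \<in> \<T>")
      case True
      have "\<alpha> s x \<notin> closure A" if "s \<in> T" for s
        using that x(2) sG opA by (auto simp: T_def mem_act_inv frontier_def interior_open)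
      then have xV: "x \<in> V T" using x(1) memV[OF TS] by (auto simp: T_def)
      have "\<alpha> s x \<in> covered ?L" if "s \<in> S" for s
      proof (cases "s \<in> T")
        case inT: True
        then show ?thesis unfolding cov' covN using True xV by blast
      next
        case False
        then have "\<alpha> s x \<in> A" using that by (simp add: T_def)
        then show ?thesis unfolding cov' by simp
      qed
      then have "{s\<in>S. \<alpha> s x \<in> covered ?L} = S" by auto
      then show ?thesis using mult_right_mono[OF \<beta>, of "real (card S)"] by simp
    next
      case False
      \<comment> \<open>No tile is placed at x only if fewer than a (1 - \<beta>)-fraction of the
        positions are free, so the old tiles already give the required density.\<close>
      then have "real (card T) < (1 - \<beta>) * real (card S)" using TS by (auto simp: \<T>_def)
      then have "\<beta> * real (card S) \<le> real (card (S - T))" using c by (simp add: of_nat_diff algebra_simps)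
      also have "\<dots> \<le> real (card {s\<in>S. \<alpha> s x \<in> covered ?L})"
        using S(1) by (intro of_nat_mono card_mono) (auto simp: T_def cov')
      finally show ?thesis .
    qed
  qed
  show ?thesis
    using til count unfolding A_def[symmetric]
    by (intro exI[of _ ?L] conjI ballI impI) (simp_all add: cov')
qed

text \<open>The base sets of a cover are treated one after another. Density gained earlier persists
  because the covered set only grows, and Z collects the translated frontiers, null by
  invariance.\<close>

lemma tiling_extend_cover:
  assumes "finite \<Q>"
    and Q: "\<forall>Q\<in>\<Q>. open Q \<and> null_boundary Q \<and>
      (\<forall>s\<in>S. \<forall>t\<in>S. s \<noteq> t \<longrightarrow> \<alpha> s ` Q \<inter> \<alpha> t ` Q = {}) \<and> (\<forall>s\<in>S. \<forall>x\<in>Q. \<forall>y\<in>Q. dist (\<alpha> s x) (\<alpha> s y) < \<delta>)"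
    and t: "tiling F \<eta> \<beta> \<delta> \<L>"
    and S: "finite S" "S \<noteq> {}" "S \<subseteq> carrier G" "real (card ((F <#> S) - S)) \<le> \<eta> * real (card S)"
    and \<beta>: "\<beta> \<le> 1"
  shows "\<exists>\<L>' Z. tiling F \<eta> \<beta> \<delta> \<L>' \<and> covered \<L> \<subseteq> covered \<L>' \<and> closed Z \<and>
    (\<forall>\<mu>\<in>\<M>. measure \<mu> Z = 0) \<and>
    (\<forall>x\<in>\<Union>\<Q>. x \<notin> Z \<longrightarrow> \<beta> * real (card S) \<le> real (card {s\<in>S. \<alpha> s x \<in> covered \<L>'}))"
  using assms(1) Q
proof (induction \<Q> rule: finite_induct)
  case empty
  show ?case using t by (intro exI[of _ \<L>] exI[of _ "{}"]) simp
next
  case (insert Q \<Q>)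
  then have "\<exists>\<L>' Z. tiling F \<eta> \<beta> \<delta> \<L>' \<and> covered \<L> \<subseteq> covered \<L>' \<and> closed Z \<and>
    (\<forall>\<mu>\<in>\<M>. measure \<mu> Z = 0) \<and>
    (\<forall>x\<in>\<Union>\<Q>. x \<notin> Z \<longrightarrow> \<beta> * real (card S) \<le> real (card {s\<in>S. \<alpha> s x \<in> covered \<L>'}))"
    by simp
  then obtain \<L>1 Z where 1: "tiling F \<eta> \<beta> \<delta> \<L>1" "covered \<L> \<subseteq> covered \<L>1" "closed Z"
    "\<forall>\<mu>\<in>\<M>. measure \<mu> Z = 0"
    "\<forall>x\<in>\<Union>\<Q>. x \<notin> Z \<longrightarrow> \<beta> * real (card S) \<le> real (card {s\<in>S. \<alpha> s x \<in> covered \<L>1})"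
    by (elim exE conjE)
  have "\<exists>\<L>'. tiling F \<eta> \<beta> \<delta> \<L>' \<and> covered \<L>1 \<subseteq> covered \<L>' \<and>
    (\<forall>x\<in>Q. x \<notin> (\<Union>s\<in>S. \<alpha> (inv s) ` frontier (covered \<L>1)) \<longrightarrow> \<beta> * real (card S) \<le> real (card {s\<in>S. \<alpha> s x \<in> covered \<L>'}))"
    using insert.prems by (intro tiling_extend[OF 1(1) _ _ _ _ S \<beta>]) simp_all
  then obtain \<L>2 where 2: "tiling F \<eta> \<beta> \<delta> \<L>2" "covered \<L>1 \<subseteq> covered \<L>2"
    "\<forall>x\<in>Q. x \<notin> (\<Union>s\<in>S. \<alpha> (inv s) ` frontier (covered \<L>1)) \<longrightarrow> \<beta> * real (card S) \<le> real (card {s\<in>S. \<alpha> s x \<in> covered \<L>2})"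
    by (elim exE conjE)
  let ?Y = "\<Union>s\<in>S. \<alpha> (inv s) ` frontier (covered \<L>1)"
  have clY: "closed ?Y"
    using S by (intro closed_UN) (auto intro!: closed_act)
  have nullY: "measure \<mu> ?Y = 0" if \<mu>: "\<mu> \<in> \<M>" for \<mu>
  proof -
    interpret prob_space \<mu> by (rule inv_measureD(2)[OF \<mu>])
    have "measure \<mu> ?Y \<le> (\<Sum>s\<in>S. measure \<mu> (\<alpha> (inv s) ` frontier (covered \<L>1)))"
      using S borel_act by (intro finite_measure_subadditive_finite) (auto simp: inv_measureD(1)[OF \<mu>])
    also have "\<dots> = (\<Sum>s\<in>S. 0)"
      using 1(1) \<mu> S inv_measureD(3)[OF \<mu>, of _ "frontier (covered \<L>1)"]
      by (intro sum.cong) (auto simp: tiling_def null_boundary_def subset_iff)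
    finally show ?thesis by (simp add: measure_le_0_iff)
  qed
  have "measure \<mu> (Z \<union> ?Y) = 0" if \<mu>: "\<mu> \<in> \<M>" for \<mu>
    using inv_measure_Un_le[OF \<mu>, of Z ?Y] 1(3) clY nullY[OF \<mu>] bspec[OF 1(4) \<mu>]
    by (simp add: measure_le_0_iff)
  moreover have "\<beta> * real (card S) \<le> real (card {s\<in>S. \<alpha> s x \<in> covered \<L>2})" if x: "x \<in> \<Union>(insert Q \<Q>)" "x \<notin> Z \<union> ?Y" for x
  proof (cases "x \<in> Q")
    case True
    then show ?thesis using 2(3) x(2) by blast
  next
    case False
    then have "\<beta> * real (card S) \<le> real (card {s\<in>S. \<alpha> s x \<in> covered \<L>1})" using 1(5) x by blast
    also have "\<dots> \<le> real (card {s\<in>S. \<alpha> s x \<in> covered \<L>2})"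
      using S(1) 2(2) by (intro of_nat_mono card_mono) auto
    finally show ?thesis .
  qed
  moreover have "closed (Z \<union> ?Y)" using 1(3) clY by (rule closed_Un)
  moreover have "covered \<L> \<subseteq> covered \<L>2" using 1(2) 2(2) by (rule subset_trans)
  ultimately show ?case
    using 2(1) by (intro exI[of _ \<L>2] exI[of _ "Z \<union> ?Y"] conjI ballI impI)
qed

lemma tiling_measure_levels:
  assumes t: "tiling F \<eta> \<beta> \<delta> \<L>" and \<mu>: "\<mu> \<in> \<M>" and T': "\<And>p. p \<in> \<L> \<Longrightarrow> T' p \<subseteq> fst (snd p)"
  shows "measure \<mu> (\<Union>p\<in>\<L>. \<Union>t\<in>T' p. \<alpha> t ` snd (snd p)) = (\<Sum>p\<in>\<L>. card (T' p) * measure \<mu> (snd (snd p)))"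
proof (rule measure_sublevels[OF inv_under_carrier[OF \<mu>] subset_refl _ _ _ _ _ T'])
  show "finite \<L>" using t by (simp add: tiling_def)
  fix p assume p: "p \<in> \<L>"
  obtain S T V where e: "p = (S, T, V)" by (cases p)
  note d = tilingD[OF t p[unfolded e]]
  show "finite (fst (snd p))" "fst (snd p) \<subseteq> carrier G" "snd (snd p) \<in> sets borel"
    using d(7,10,11) by (simp_all add: e)
next
  show "disjoint_family_on (\<lambda>(p, t). \<alpha> t ` snd (snd p)) (SIGMA p:\<L>. fst (snd p))"
    using t by (simp add: tiling_def)
qed

lemma covered_eq: "covered \<L> = (\<Union>p\<in>\<L>. \<Union>t\<in>fst (snd p). \<alpha> t ` snd (snd p))"
  by (simp add: covered_def case_prod_beta)

lemma measure_covered: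
  assumes "tiling F \<eta> \<beta> \<delta> \<L>" "\<mu> \<in> \<M>"
  shows "measure \<mu> (covered \<L>) = (\<Sum>p\<in>\<L>. card (fst (snd p)) * measure \<mu> (snd (snd p)))"
  unfolding covered_eq by (rule tiling_measure_levels[OF assms subset_refl])

text \<open>Moving a point of a tile with shape S' by \<open>inv s\<close> keeps its position in the
  product of F and S'. If it stays in S' it is still covered, since full tiles are covered.
  Otherwise it is one of at most \<eta> card S' boundary positions; as card S' is at most card T /
  (1 - \<beta>) and trimmed tiles are disjoint, these weigh at most \<eta> / (1 - \<beta>).\<close>

lemma measure_saturation_le:
  assumes t: "tiling F \<eta> \<beta> \<delta> \<L>" and \<mu>: "\<mu> \<in> \<M>"
    and F: "finite F" "F \<subseteq> carrier G" and S: "finite S" "S \<subseteq> carrier G" "m_inv G ` S \<subseteq> F"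
    and \<beta>: "\<beta> < 1" and \<eta>: "0 \<le> \<eta>"
  shows "measure \<mu> (\<Union>s\<in>S. \<alpha> (inv s) ` covered \<L>) \<le> measure \<mu> (covered \<L>) + \<eta> / (1 - \<beta>)"
proof -
  interpret prob_space \<mu> by (rule inv_measureD(2)[OF \<mu>])
  note sb = inv_measureD(1)[OF \<mu>]
  define X where "X p = (\<Union>g\<in>(F <#> fst p) - fst p. \<alpha> g ` snd (snd p))" for p :: "'g set \<times> 'g set \<times> 'x set"
  have finL: "finite \<L>" using t by (simp add: tiling_def)
  have FS: "F <#> S' \<subseteq> carrier G" if "S' \<subseteq> carrier G" for S'
    using F(2) that by (rule set_mult_closed)
  have X: "X p \<in> sets borel" "measure \<mu> (X p) \<le> \<eta> / (1 - \<beta>) * (card (fst (snd p)) * measure \<mu> (snd (snd p)))"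
    if p: "p \<in> \<L>" for p
  proof -
    obtain S' T V where e: "p = (S', T, V)" by (cases p)
    note d = tilingD[OF t p[unfolded e]]
    have fin: "finite ((F <#> S') - S')" using finite_set_mult[OF F(1) d(1)] by simp
    have lev: "\<alpha> g ` V \<in> sets borel" "measure \<mu> (\<alpha> g ` V) = measure \<mu> V" if "g \<in> (F <#> S') - S'" for g
      using that FS[OF d(3)] d(7) inv_measureD(3)[OF \<mu>, of g V] borel_act[of g V] by auto
    have Xe: "X p = (\<Union>g\<in>(F <#> S') - S'. \<alpha> g ` V)" by (simp add: X_def e)
    show "X p \<in> sets borel" unfolding Xe using lev(1) fin by (intro sets.finite_UN) auto
    have "measure \<mu> (X p) \<le> (\<Sum>g\<in>(F <#> S') - S'. measure \<mu> (\<alpha> g ` V))"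
      unfolding Xe using lev(1) fin by (intro finite_measure_subadditive_finite) (auto simp: sb)
    also have "\<dots> = real (card ((F <#> S') - S')) * measure \<mu> V"
      using lev(2) by simp
    also have "\<dots> \<le> (\<eta> / (1 - \<beta>) * card T) * measure \<mu> V"
    proof (rule mult_right_mono)
      have "real (card S') \<le> card T / (1 - \<beta>)" using d(6) \<beta> by (simp add: field_simps)
      then have "\<eta> * real (card S') \<le> \<eta> * (card T / (1 - \<beta>))" using \<eta> by (rule mult_left_mono)
      then show "real (card ((F <#> S') - S')) \<le> \<eta> / (1 - \<beta>) * card T" using d(4) by simp
    qed simp
    finally show "measure \<mu> (X p) \<le> \<eta> / (1 - \<beta>) * (card (fst (snd p)) * measure \<mu> (snd (snd p)))"
      by (simp add: e mult.assoc)
  qed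
  have sub: "(\<Union>s\<in>S. \<alpha> (inv s) ` covered \<L>) \<subseteq> covered \<L> \<union> (\<Union>p\<in>\<L>. X p)"
  proof
    fix x assume "x \<in> (\<Union>s\<in>S. \<alpha> (inv s) ` covered \<L>)"
    then obtain s y where s: "s \<in> S" "x = \<alpha> (inv s) y" "y \<in> covered \<L>" by blast
    then obtain p t' v where p: "p \<in> \<L>" "t' \<in> fst (snd p)" "v \<in> snd (snd p)" "y = \<alpha> t' v"
      unfolding covered_eq by blast
    obtain S' T V where e: "p = (S', T, V)" by (cases p)
    note d = tilingD[OF t p(1)[unfolded e]]
    have t': "t' \<in> S'" "t' \<in> carrier G" using p(2) d(5,11) by (auto simp: e)
    have sG: "s \<in> carrier G" using s(1) S(2) by blast
    have xe: "x = \<alpha> (inv s \<otimes> t') v" using s(2) p(4) sG t'(2) by (simp add: act_mult)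
    have vV: "v \<in> V" using p(3) by (simp add: e)
    show "x \<in> covered \<L> \<union> (\<Union>p\<in>\<L>. X p)"
    proof (cases "inv s \<otimes> t' \<in> S'")
      case True
      have "x \<in> \<alpha> (inv s \<otimes> t') ` V" unfolding xe using vV by (rule imageI)
      then show ?thesis using d(9)[OF True] by blast
    next
      case False
      have "inv s \<in> F" using S(3) s(1) by blast
      then have "inv s \<otimes> t' \<in> (F <#> S') - S'" using t'(1) False by (auto simp: set_mult_def)
      then have "x \<in> X p" unfolding X_def e xe using vV by auto
      then show ?thesis using p(1) by blast
    qed
  qed
  have XU: "(\<Union>p\<in>\<L>. X p) \<in> sets borel" using finL X(1) by (intro sets.finite_UN) auto
  have cb: "covered \<L> \<in> sets borel" using open_covered[OF t] by simp
  have "measure \<mu> (\<Union>s\<in>S. \<alpha> (inv s) ` covered \<L>) \<le> measure \<mu> (covered \<L> \<union> (\<Union>p\<in>\<L>. X p))"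
    using XU cb by (intro inv_measure_mono[OF \<mu> sub]) auto
  also have "\<dots> \<le> measure \<mu> (covered \<L>) + measure \<mu> (\<Union>p\<in>\<L>. X p)"
    by (rule inv_measure_Un_le[OF \<mu> cb XU])
  also have "measure \<mu> (\<Union>p\<in>\<L>. X p) \<le> (\<Sum>p\<in>\<L>. measure \<mu> (X p))"
    using finL X(1) by (intro finite_measure_subadditive_finite) (auto simp: sb)
  also have "\<dots> \<le> (\<Sum>p\<in>\<L>. \<eta> / (1 - \<beta>) * (card (fst (snd p)) * measure \<mu> (snd (snd p))))"
    by (intro sum_mono X(2))
  also have "\<dots> = \<eta> / (1 - \<beta>) * measure \<mu> (covered \<L>)"
    by (simp add: measure_covered[OF t \<mu>] sum_distrib_left)
  also have "\<dots> \<le> \<eta> / (1 - \<beta>) * 1"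
    using \<eta> \<beta> prob_le_1 by (intro mult_left_mono) auto
  finally show ?thesis by simp
qed

text \<open>Let E be the points whose S-orbit segment avoids the old covered set A, minus Z. On E
  the \<beta>-fraction of visits to B are all visits to B - A, so averaging gives \<beta> \<mu>(E)
  \<le> \<mu>(B - A). By \<open>measure_saturation_le\<close>, E is almost as large as the
  complement of A.\<close>

lemma tiling_gain:
  assumes t: "tiling F \<eta> \<beta> \<delta> \<L>" and \<mu>: "\<mu> \<in> \<M>"
    and F: "finite F" "F \<subseteq> carrier G" and S: "finite S" "S \<noteq> {}" "S \<subseteq> carrier G" "m_inv G ` S \<subseteq> F"
    and \<beta>: "0 < \<beta>" "\<beta> < 1" and \<eta>: "0 \<le> \<eta>"
    and B: "B \<in> sets borel" "covered \<L> \<subseteq> B" and Z: "closed Z" "measure \<mu> Z = 0"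
    and dense: "\<And>x. x \<notin> Z \<Longrightarrow> \<beta> * real (card S) \<le> real (card {s\<in>S. \<alpha> s x \<in> B})"
  shows "1 - measure \<mu> B \<le> (1 - \<beta>) * (1 - measure \<mu> (covered \<L>)) + \<beta> * (\<eta> / (1 - \<beta>))"
proof -
  interpret prob_space \<mu> by (rule inv_measureD(2)[OF \<mu>])
  note sb = inv_measureD(1)[OF \<mu>]
  have sp: "space \<mu> = UNIV" using sets_eq_imp_space_eq[OF sb] by simp
  define A where "A = covered \<L>"
  have A: "A \<in> sets borel" using open_covered[OF t] by (simp add: A_def)
  define D where "D = (\<Union>s\<in>S. \<alpha> (inv s) ` A)"
  have D: "D \<in> sets borel" unfolding D_def using S A borel_act by (intro sets.finite_UN) auto
  define E where "E = - (D \<union> Z)"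
  have Zb: "Z \<in> sets borel" using Z(1) by simp
  have E: "E \<in> sets borel" unfolding E_def using D Zb by auto
  have c: "0 < \<beta> * real (card S)" using S \<beta> by (simp add: card_gt_0_iff)
  \<comment> \<open>The one-element index set presents a single event as a count for
    \<open>sum_prob_mono\<close>.\<close>
  have "(\<Sum>j\<in>{()}. measure \<mu> E) + 0 \<le> (1 / (\<beta> * real (card S))) * (\<Sum>s\<in>S. measure \<mu> (\<alpha> (inv s) ` (B - A)))"
  proof (rule sum_prob_mono)
    show "\<alpha> (inv s) ` (B - A) \<in> events" if "s \<in> S" for s
      using that S borel_act A B by (auto simp: sb subset_iff)
    show "real (card {j\<in>{()}. x \<in> E}) + 0 \<le> (1 / (\<beta> * real (card S))) * real (card {s\<in>S. x \<in> \<alpha> (inv s) ` (B - A)})" for x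
    proof (cases "x \<in> E")
      case True
      then have x: "x \<notin> D" "x \<notin> Z" by (auto simp: E_def)
      have "\<alpha> s x \<notin> A" if "s \<in> S" for s
      proof -
        have "x \<notin> \<alpha> (inv s) ` A" using x(1) that by (auto simp: D_def)
        then show ?thesis using that S(3) by (simp add: mem_act_inv subset_iff)
      qed
      then have "x \<in> \<alpha> (inv s) ` (B - A) \<longleftrightarrow> \<alpha> s x \<in> B" if "s \<in> S" for s
        using that S(3) by (simp add: mem_act_inv subset_iff)
      then have "{s\<in>S. x \<in> \<alpha> (inv s) ` (B - A)} = {s\<in>S. \<alpha> s x \<in> B}"
        by (intro Collect_cong conj_cong refl)
      then show ?thesis using dense[OF x(2)] c True by (simp add: field_simps)
    qed (use c in simp)
  qed (use E S in \<open>auto simp: sb\<close>)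
  also have "(\<Sum>s\<in>S. measure \<mu> (\<alpha> (inv s) ` (B - A))) = card S * measure \<mu> (B - A)"
    using S A B inv_measureD(3)[OF \<mu>] by (simp add: subset_iff)
  also have "(1 / (\<beta> * real (card S))) * (card S * measure \<mu> (B - A)) = measure \<mu> (B - A) / \<beta>"
    using S(1,2) by simp
  finally have "measure \<mu> E \<le> measure \<mu> (B - A) / \<beta>" by simp
  then have 1: "\<beta> * measure \<mu> E \<le> measure \<mu> (B - A)" using \<beta> by (simp add: field_simps)
  have 2: "measure \<mu> B = measure \<mu> A + measure \<mu> (B - A)"
    using finite_measure_Diff[of B A] A B by (simp add: sb A_def)
  have 3: "measure \<mu> E = 1 - measure \<mu> (D \<union> Z)"
    using prob_compl[of "D \<union> Z"] D Zb by (simp add: E_def sb sp Compl_eq_Diff_UNIV)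
  have 4: "measure \<mu> (D \<union> Z) \<le> measure \<mu> A + \<eta> / (1 - \<beta>)"
    using inv_measure_Un_le[OF \<mu> D Zb] Z(2) measure_saturation_le[OF t \<mu> F S(1,3,4) \<beta>(2) \<eta>]
    by (simp add: A_def D_def)
  have "\<beta> * (1 - (measure \<mu> A + \<eta> / (1 - \<beta>))) \<le> \<beta> * measure \<mu> E"
    using 3 4 \<beta> by (intro mult_left_mono) auto
  then have "\<beta> * (1 - measure \<mu> A) - \<beta> * (\<eta> / (1 - \<beta>)) \<le> measure \<mu> (B - A)"
    using 1 by (simp only: right_diff_distrib distrib_left)
  then show ?thesis using 2 by (simp only: A_def[symmetric] left_diff_distrib mult_1)
qed

text \<open>The shape S of the new round is fixed first, and its inverses then join the test set of
  the old tiling, as \<open>tiling_gain\<close> demands. For this reason \<open>hyp\<close> must be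
  available for every test set and tolerance.\<close>

lemma tiling_improve:
  assumes amen: "amenable G" and good: "good_subgroups G \<alpha>" and free: "free_action G \<alpha>"
    and \<beta>: "0 < \<beta>" "\<beta> < 1" and \<delta>: "0 < \<delta>" and \<theta>: "0 < \<theta>"
    and hyp: "\<And>F \<eta>. finite F \<Longrightarrow> F \<subseteq> carrier G \<Longrightarrow> 0 < \<eta> \<Longrightarrow>
      \<exists>\<L>. tiling F \<eta> \<beta> \<delta> \<L> \<and> (\<forall>\<mu>\<in>\<M>. 1 - measure \<mu> (covered \<L>) \<le> \<theta>)"
    and F: "finite F" "F \<subseteq> carrier G" and \<eta>: "0 < \<eta>"
  shows "\<exists>\<L>. tiling F \<eta> \<beta> \<delta> \<L> \<and> (\<forall>\<mu>\<in>\<M>. 1 - measure \<mu> (covered \<L>) \<le> (1 - \<beta> / 2) * \<theta>)"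
proof -
  \<comment> \<open>The identity keeps the Folner test set nonempty even if F is empty.\<close>
  let ?F1 = "insert \<one> F"
  have F1: "finite ?F1" "?F1 \<noteq> {}" "?F1 \<subseteq> carrier G" using F by auto
  have "\<exists>S. finite S \<and> S \<subseteq> carrier G \<and> approx_invariant G ?F1 \<eta> S"
    using amen F1 \<eta> unfolding amenable_def by simp
  then obtain S where S: "finite S" "S \<subseteq> carrier G" "approx_invariant G ?F1 \<eta> S"
    by (elim exE conjE)
  have ne: "S \<noteq> {}" using S(3) by (auto simp: approx_invariant_def)
  have "card ((F <#> S) - S) \<le> card (sym_diff S (?F1 <#> S))"
    using set_mult_mono[of F ?F1 S] finite_set_mult[OF F1(1) S(1)] S(1) by (intro card_mono) auto
  then have Sinv: "real (card ((F <#> S) - S)) \<le> \<eta> * real (card S)"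
    using S(3) unfolding approx_invariant_def by linarith
  let ?F2 = "F \<union> m_inv G ` S"
  \<comment> \<open>The second bound makes the saturation loss \<eta>2 / (1 - \<beta>) at most
    \<theta>/2, which leaves (1 - \<beta>) \<theta> + \<beta> \<theta>/2 uncovered.\<close>
  define \<eta>2 where "\<eta>2 = min \<eta> (\<theta> * (1 - \<beta>) / 2)"
  have \<eta>2: "0 < \<eta>2" "\<eta>2 \<le> \<eta>" "\<eta>2 \<le> \<theta> * (1 - \<beta>) / 2" using \<eta> \<theta> \<beta> by (auto simp: \<eta>2_def)
  have F2: "finite ?F2" "?F2 \<subseteq> carrier G" using F S by auto
  obtain \<L> where L: "tiling ?F2 \<eta>2 \<beta> \<delta> \<L>" "\<forall>\<mu>\<in>\<M>. 1 - measure \<mu> (covered \<L>) \<le> \<theta>"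
    using hyp[OF F2 \<eta>2(1)] by (elim exE conjE)
  have tF: "tiling F \<eta> \<beta> \<delta> \<L>"
    by (rule tiling_mono[OF L(1) _ F2(1) \<eta>2(2)]) simp
  obtain \<Q> where Q: "finite \<Q>" "\<Union>\<Q> = UNIV" "\<forall>Q\<in>\<Q>. open Q \<and> null_boundary Q \<and>
    (\<forall>s\<in>S. \<forall>t\<in>S. s \<noteq> t \<longrightarrow> \<alpha> s ` Q \<inter> \<alpha> t ` Q = {}) \<and> (\<forall>s\<in>S. \<forall>x\<in>Q. \<forall>y\<in>Q. dist (\<alpha> s x) (\<alpha> s y) < \<delta>)"
    using separating_cover[OF good free S(1,2) \<delta>] by (elim exE conjE)
  obtain \<L>' Z where L': "tiling F \<eta> \<beta> \<delta> \<L>'" "covered \<L> \<subseteq> covered \<L>'" "closed Z"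
    "\<forall>\<mu>\<in>\<M>. measure \<mu> Z = 0"
    "\<forall>x\<in>\<Union>\<Q>. x \<notin> Z \<longrightarrow> \<beta> * real (card S) \<le> real (card {s\<in>S. \<alpha> s x \<in> covered \<L>'})"
    using tiling_extend_cover[OF Q(1,3) tF S(1) ne S(2) Sinv less_imp_le[OF \<beta>(2)]] by (elim exE conjE)
  have "1 - measure \<mu> (covered \<L>') \<le> (1 - \<beta> / 2) * \<theta>" if \<mu>: "\<mu> \<in> \<M>" for \<mu>
  proof -
    have "1 - measure \<mu> (covered \<L>') \<le> (1 - \<beta>) * (1 - measure \<mu> (covered \<L>)) + \<beta> * (\<eta>2 / (1 - \<beta>))"
    proof (rule tiling_gain[OF L(1) \<mu> F2 S(1) ne S(2) _ \<beta> less_imp_le[OF \<eta>2(1)] _ L'(2,3)])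
      show "covered \<L>' \<in> sets borel" using open_covered[OF L'(1)] by simp
      show "measure \<mu> Z = 0" using L'(4) \<mu> by simp
      show "\<beta> * real (card S) \<le> real (card {s\<in>S. \<alpha> s x \<in> covered \<L>'})" if "x \<notin> Z" for x
        using L'(5) Q(2) that by simp
    qed simp
    also have "\<dots> \<le> (1 - \<beta>) * \<theta> + \<beta> * (\<theta> / 2)"
    proof (rule add_mono; rule mult_left_mono)
      show "1 - measure \<mu> (covered \<L>) \<le> \<theta>" using L(2) \<mu> by simp
      show "\<eta>2 / (1 - \<beta>) \<le> \<theta> / 2" using \<eta>2(3) \<beta> by (simp add: field_simps)
    qed (use \<beta> in auto)
    also have "\<dots> = (1 - \<beta> / 2) * \<theta>" by (simp add: algebra_simps)
    finally show ?thesis .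
  qed
  then show ?thesis using L'(1) by (intro exI[of _ \<L>'] conjI ballI)
qed

text \<open>Rounds of \<open>tiling_improve\<close> start from the empty tiling, with F and \<eta>
  generalised in the induction because each round asks more of its predecessor. The shrinking factor
  depends on \<beta> alone, so finitely many rounds serve all invariant measures.\<close>

lemma tiling_exists:
  assumes amen: "amenable G" and good: "good_subgroups G \<alpha>" and free: "free_action G \<alpha>"
    and \<beta>: "0 < \<beta>" "\<beta> < 1" and \<delta>: "0 < \<delta>" and \<theta>: "0 < \<theta>"
    and F: "finite F" "F \<subseteq> carrier G" and \<eta>: "0 < \<eta>"
  shows "\<exists>\<L>. tiling F \<eta> \<beta> \<delta> \<L> \<and> (\<forall>\<mu>\<in>\<M>. 1 - measure \<mu> (covered \<L>) \<le> \<theta>)"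
proof -
  have *: "\<exists>\<L>. tiling F \<eta> \<beta> \<delta> \<L> \<and> (\<forall>\<mu>\<in>\<M>. 1 - measure \<mu> (covered \<L>) \<le> (1 - \<beta> / 2) ^ n)"
    if "finite F" "F \<subseteq> carrier G" "0 < \<eta>" for n F \<eta>
    using that
  proof (induction n arbitrary: F \<eta>)
    case 0
    show ?case
      by (intro exI[of _ "{}"] conjI empty_tiling ballI) simp
  next
    case (Suc n)
    have "0 < (1 - \<beta> / 2) ^ n" using \<beta> by simp
    from tiling_improve[OF amen good free \<beta> \<delta> this Suc.IH Suc.prems]
    show ?case by simp
  qed
  obtain n where n: "(1 - \<beta> / 2) ^ n < \<theta>"
    using real_arch_pow_inv[OF \<theta>, of "1 - \<beta> / 2"] \<beta> by auto
  obtain \<L> where L: "tiling F \<eta> \<beta> \<delta> \<L>"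
    "\<forall>\<mu>\<in>\<M>. 1 - measure \<mu> (covered \<L>) \<le> (1 - \<beta> / 2) ^ n"
    using *[OF F \<eta>, of n] by (elim exE conjE)
  have "\<forall>\<mu>\<in>\<M>. 1 - measure \<mu> (covered \<L>) \<le> \<theta>"
    using L(2) n by (meson less_imp_le order_trans)
  then show ?thesis using L(1) by (intro exI[of _ \<L>] conjI)
qed

text \<open>A cover that is moved into a union of levels is refined by the level reached, and the
  part reaching level t is moved on by \<open>inv t\<close> into the base. Distinct levels use
  distinct summands, so only parts of the same level have to be disjoint, and they were so before
  the last move.\<close>

lemma subeq_sum_of_levels:
  assumes sub: "subeq G \<alpha> A (\<Union>i<n. \<Union>t\<in>T i. \<alpha> t ` V i)"
    and T: "\<And>i. i < (n::nat) \<Longrightarrow> finite (T i)" "\<And>i. i < n \<Longrightarrow> T i \<subseteq> carrier G" "\<And>i. i < n \<Longrightarrow> open (V i)"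
    and k: "\<And>i t. i < n \<Longrightarrow> t \<in> T i \<Longrightarrow> k i t < length Bs \<and> Bs ! k i t = V i"
    and inj: "\<And>i t i' t'. i < n \<Longrightarrow> t \<in> T i \<Longrightarrow> i' < n \<Longrightarrow> t' \<in> T i' \<Longrightarrow> k i t = k i' t' \<Longrightarrow> i = i' \<and> t = t'"
  shows "subeq_sum G \<alpha> [A] Bs"
proof (rule subeq_sum_singleI_indexed)
  fix C assume C: "closed C" "C \<subseteq> A"
  obtain \<U> s where U: "finite \<U>" "\<forall>U\<in>\<U>. open U" "C \<subseteq> \<Union>\<U>" "s \<in> \<U> \<rightarrow> carrier G"
    "disjoint_family_on (\<lambda>U. \<alpha> (s U) ` U) \<U>" "\<forall>U\<in>\<U>. \<alpha> (s U) ` U \<subseteq> (\<Union>i<n. \<Union>t\<in>T i. \<alpha> t ` V i)"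
    using mp[OF spec[OF sub[unfolded subeq_def], of C] conjI[OF C]] by (elim exE conjE)
  let ?I = "\<U> \<times> (SIGMA i:{..<n}. T i)"
  let ?W = "\<lambda>(U, i, t). U \<inter> \<alpha> (inv (s U)) ` \<alpha> t ` V i"
  let ?s = "\<lambda>(U, i, t). inv t \<otimes> s U"
  let ?k = "\<lambda>(U, i, t). k i t"
  have sG: "s U \<in> carrier G" if "U \<in> \<U>" for U using U(4) that by auto
  have tG: "t \<in> carrier G" if "i < n" "t \<in> T i" for i t using T(2) that by blast
  have W_im: "\<alpha> (?s (U, i, t)) ` ?W (U, i, t) \<subseteq> V i" if "U \<in> \<U>" "i < n" "t \<in> T i" for U i t
  proof -
    have "\<alpha> (inv t \<otimes> s U) ` ?W (U, i, t) \<subseteq> \<alpha> (inv t \<otimes> s U) ` \<alpha> (inv (s U)) ` \<alpha> t ` V i"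
      by (intro image_mono) auto
    also have "\<dots> = V i"
      using sG[OF that(1)] tG[OF that(2,3)] by (simp add: image_image act_mult act_inv)
    finally show ?thesis by simp
  qed
  have W_im2: "\<alpha> (?s (U, i, t)) ` ?W (U, i, t) \<subseteq> \<alpha> (inv t) ` \<alpha> (s U) ` U" if "U \<in> \<U>" "i < n" "t \<in> T i" for U i t
    using sG[OF that(1)] tG[OF that(2,3)] by (auto simp: image_image act_mult)
  have "finite ?I" using U(1) T(1) by auto
  moreover have "\<forall>p\<in>?I. open (?W p)"
  proof
    fix p assume "p \<in> ?I"
    then obtain U i t where e: "p = (U, i, t)" "U \<in> \<U>" "i < n" "t \<in> T i" by auto
    then show "open (?W p)"
      using U(2) sG tG T(3) by (auto intro!: open_Int open_act)
  qed
  moreover have "C \<subseteq> (\<Union>p\<in>?I. ?W p)"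
  proof
    fix x assume "x \<in> C"
    then obtain U where x: "U \<in> \<U>" "x \<in> U" using U(3) by blast
    then have "\<alpha> (s U) x \<in> (\<Union>i<n. \<Union>t\<in>T i. \<alpha> t ` V i)" using U(6) by blast
    then obtain i t where it: "i < n" "t \<in> T i" "\<alpha> (s U) x \<in> \<alpha> t ` V i" by blast
    have "x \<in> ?W (U, i, t)" using x it(3) sG[OF x(1)] by (simp add: mem_act_inv)
    moreover have "(U, i, t) \<in> ?I" using x it by simp
    ultimately show "x \<in> (\<Union>p\<in>?I. ?W p)" by (rule UN_I[rotated])
  qed
  moreover have "\<forall>p\<in>?I. ?s p \<in> carrier G \<and> ?k p < length Bs \<and> \<alpha> (?s p) ` ?W p \<subseteq> Bs ! ?k p"
  proof
    fix p assume "p \<in> ?I"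
    then obtain U i t where e: "p = (U, i, t)" "U \<in> \<U>" "i < n" "t \<in> T i" by auto
    show "?s p \<in> carrier G \<and> ?k p < length Bs \<and> \<alpha> (?s p) ` ?W p \<subseteq> Bs ! ?k p"
      using W_im[OF e(2-4)] k[OF e(3,4)] sG[OF e(2)] tG[OF e(3,4)] unfolding e(1) by simp
  qed
  moreover have "\<forall>p\<in>?I. \<forall>q\<in>?I. p \<noteq> q \<longrightarrow> ?k p = ?k q \<longrightarrow> \<alpha> (?s p) ` ?W p \<inter> \<alpha> (?s q) ` ?W q = {}"
  proof (intro ballI impI)
    fix p q assume p: "p \<in> ?I" and q: "q \<in> ?I" and ne: "p \<noteq> q" and eq: "?k p = ?k q"
    obtain U i t where e: "p = (U, i, t)" "U \<in> \<U>" "i < n" "t \<in> T i" using p by auto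
    obtain U' i' t' where e': "q = (U', i', t')" "U' \<in> \<U>" "i' < n" "t' \<in> T i'" using q by auto
    have it: "i = i'" "t = t'" using inj[OF e(3,4) e'(3,4)] eq e(1) e'(1) by auto
    then have "U \<noteq> U'" using ne e(1) e'(1) by auto
    then have "\<alpha> (s U) ` U \<inter> \<alpha> (s U') ` U' = {}"
      using disjoint_family_onD[OF U(5) e(2) e'(2)] by simp
    then have "\<alpha> (inv t) ` \<alpha> (s U) ` U \<inter> \<alpha> (inv t) ` \<alpha> (s U') ` U' = {}"
      using inj_act[of "inv t"] tG[OF e(3,4)] by (simp add: image_Int[symmetric])
    then show "\<alpha> (?s p) ` ?W p \<inter> \<alpha> (?s q) ` ?W q = {}"
      using W_im2[OF e(2-4)] W_im2[OF e'(2-4)] unfolding e(1) e'(1) it by blast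
  qed
  ultimately show "\<exists>(I :: ('x set \<times> nat \<times> 'g) set) W s k. finite I \<and> (\<forall>i\<in>I. open (W i)) \<and> C \<subseteq> (\<Union>i\<in>I. W i) \<and>
    (\<forall>i\<in>I. s i \<in> carrier G \<and> k i < length Bs \<and> \<alpha> (s i) ` W i \<subseteq> Bs ! k i) \<and>
    (\<forall>i\<in>I. \<forall>j\<in>I. i \<noteq> j \<longrightarrow> k i = k j \<longrightarrow> \<alpha> (s i) ` W i \<inter> \<alpha> (s j) ` W j = {})"
    by (intro exI[of _ ?I] exI[of _ ?W] exI[of _ ?s] exI[of _ ?k] conjI)
qed

end

text \<open>Here \<open>\<kappa> i r\<close> is the position of copy r from entry i in the flattened
  list; for later entries it is shifted by the number of copies of the head.\<close>

lemma concat_replicate_index: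
  "\<exists>\<kappa>. (\<forall>i<length c. \<forall>r<n (c ! i). \<kappa> i r < length (concat (map (\<lambda>p. replicate (n p) (v p)) c)) \<and>
      concat (map (\<lambda>p. replicate (n p) (v p)) c) ! \<kappa> i r = v (c ! i)) \<and>
    (\<forall>i<length c. \<forall>r<n (c ! i). \<forall>i'<length c. \<forall>r'<n (c ! i'). \<kappa> i r = \<kappa> i' r' \<longrightarrow> i = i' \<and> r = (r'::nat))"
proof (induction c)
  case Nil
  then show ?case by simp
next
  case (Cons p c)
  let ?B = "concat (map (\<lambda>p. replicate (n p) (v p)) c)"
  obtain \<kappa> where 1: "\<forall>i<length c. \<forall>r<n (c ! i). \<kappa> i r < length ?B \<and> ?B ! \<kappa> i r = v (c ! i)"
    and 2: "\<forall>i<length c. \<forall>r<n (c ! i). \<forall>i'<length c. \<forall>r'<n (c ! i'). \<kappa> i r = \<kappa> i' r' \<longrightarrow> i = i' \<and> r = r'"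
    using Cons.IH by (elim exE conjE)
  let ?\<kappa> = "\<lambda>i r. case i of 0 \<Rightarrow> r | Suc j \<Rightarrow> n p + \<kappa> j r"
  have a: "\<forall>i<length (p # c). \<forall>r<n ((p # c) ! i). ?\<kappa> i r < length (concat (map (\<lambda>p. replicate (n p) (v p)) (p # c))) \<and>
      concat (map (\<lambda>p. replicate (n p) (v p)) (p # c)) ! ?\<kappa> i r = v ((p # c) ! i)"
  proof (intro allI impI)
    fix i r assume "i < length (p # c)" "r < n ((p # c) ! i)"
    then show "?\<kappa> i r < length (concat (map (\<lambda>p. replicate (n p) (v p)) (p # c))) \<and>
      concat (map (\<lambda>p. replicate (n p) (v p)) (p # c)) ! ?\<kappa> i r = v ((p # c) ! i)"
      using 1 by (cases i) (auto simp: nth_append)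
  qed
  have b: "\<forall>i<length (p # c). \<forall>r<n ((p # c) ! i). \<forall>i'<length (p # c). \<forall>r'<n ((p # c) ! i').
      ?\<kappa> i r = ?\<kappa> i' r' \<longrightarrow> i = i' \<and> r = r'"
  proof (intro allI impI)
    fix i r i' r'
    assume "i < length (p # c)" "r < n ((p # c) ! i)" "i' < length (p # c)" "r' < n ((p # c) ! i')" "?\<kappa> i r = ?\<kappa> i' r'"
    then show "i = i' \<and> r = r'"
      using 2 by (cases i; cases i') auto
  qed
  show ?case
    by (rule exI[of _ ?\<kappa>], rule conjI[OF a b])
qed

section \<open>Almost finiteness\<close>

text \<open>The factor 1/2 makes up for the supremum, under which a strict bound on distances
  becomes a weak one.\<close>

lemma diameter_less:
  fixes A :: "'a::metric_space set"
  assumes "0 < e" "\<And>x y. x \<in> A \<Longrightarrow> y \<in> A \<Longrightarrow> dist x y \<le> e / 2"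
  shows "diameter A < e"
proof (cases "A = {}")
  case True
  then show ?thesis using assms(1) by simp
next
  case False
  then have "(SUP (x, y)\<in>A \<times> A. dist x y) \<le> e / 2"
    using assms(2) by (intro cSUP_least) auto
  then show ?thesis using False assms(1) by (simp add: diameter_def)
qed

context compact_action
begin

text \<open>Trimming costs little: what F moves out of T either leaves S or lands in S - T. This is
  at most (\<eta> + \<beta>) card S, so at most e/8 card S and, as T has at least half the elements
  of S, e/4 card T. The size bound comes from F' times S, as in
  \<open>card_le_of_approx_invariant\<close>.\<close>

lemma tiling_approx_invariant:
  assumes t: "tiling F' \<eta> \<beta> \<delta> \<L>" and p: "(S, T, V) \<in> \<L>" and F: "F \<subseteq> F'" "finite F'" "F' \<subseteq> carrier G" "F \<noteq> {}"
    and \<eta>: "0 < \<eta>" "\<eta> \<le> e / 16" and \<beta>: "0 < \<beta>" "\<beta> \<le> e / 16" and e: "e \<le> 1"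
  shows "approx_invariant G F e T" "card F' \<le> 4 * card T" "T \<noteq> {}"
proof -
  note d = tilingD[OF t p]
  have cS: "0 < real (card S)" using d(1,2) by (simp add: card_gt_0_iff)
  have half: "real (card S) \<le> 2 * real (card T)"
  proof -
    have "1 / 2 * real (card S) \<le> (1 - \<beta>) * real (card S)"
      using \<beta> e by (intro mult_right_mono) auto
    then show ?thesis using d(6) by linarith
  qed
  then have cT: "0 < real (card T)" using cS by linarith
  then show "T \<noteq> {}" by auto
  have FG: "F \<subseteq> carrier G" "finite F" using F finite_subset by auto
  have sub: "(F <#> T) - T \<subseteq> ((F' <#> S) - S) \<union> (S - T)"
    using F(1) d(5) by (auto simp: set_mult_def)
  have fin: "finite (F' <#> S)" "finite (F <#> T)"
    using finite_set_mult F(2) FG(2) d(1,10) by auto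
  have "card ((F <#> T) - T) \<le> card (((F' <#> S) - S) \<union> (S - T))"
    using sub fin d(1) by (intro card_mono) auto
  also have "\<dots> \<le> card ((F' <#> S) - S) + card (S - T)" by (rule card_Un_le)
  finally have "real (card ((F <#> T) - T)) \<le> real (card ((F' <#> S) - S)) + real (card (S - T))" by linarith
  moreover have "real (card (S - T)) \<le> \<beta> * real (card S)"
    using d(5,6,10) card_mono[OF d(1,5)] by (simp add: card_Diff_subset of_nat_diff algebra_simps)
  moreover have "\<eta> * real (card S) \<le> e / 16 * real (card S)" "\<beta> * real (card S) \<le> e / 16 * real (card S)"
    using \<eta> \<beta> by (intro mult_right_mono; simp)+
  ultimately have "real (card ((F <#> T) - T)) \<le> e / 8 * real (card S)" using d(4) by linarith
  also have "\<dots> \<le> e / 8 * (2 * real (card T))" using half \<beta> by (intro mult_left_mono) auto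
  finally have out: "real (card ((F <#> T) - T)) \<le> e / 4 * real (card T)" by linarith
  \<comment> \<open>The other half of the symmetric difference is no larger, because a single
    translate fT already has as many elements as T.\<close>
  obtain f where f: "f \<in> F" using F(4) by blast
  have "inj_on ((\<otimes>) f) T"
    using inj_on_subset[OF inj_on_cmult d(11)] f FG by blast
  then have "card ((\<otimes>) f ` T) = card T" by (rule card_image)
  then have "card (T - (\<otimes>) f ` T) = card ((\<otimes>) f ` T - T)"
    using d(10) by (simp add: card_Diff_subset_Int Int_commute)
  moreover have "card (T - (F <#> T)) \<le> card (T - (\<otimes>) f ` T)"
    using f d(10) by (intro card_mono) (auto simp: set_mult_def)
  moreover have "card ((\<otimes>) f ` T - T) \<le> card ((F <#> T) - T)"
    using f fin by (intro card_mono) (auto simp: set_mult_def)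
  ultimately have "card (T - (F <#> T)) \<le> card ((F <#> T) - T)" by linarith
  moreover have "card (sym_diff T (F <#> T)) \<le> card (T - (F <#> T)) + card ((F <#> T) - T)"
    by (rule card_Un_le)
  ultimately have "real (card (sym_diff T (F <#> T))) \<le> e / 2 * real (card T)" using out by linarith
  also have "\<dots> < e * real (card T)" using cT \<beta> by simp
  finally show "approx_invariant G F e T" by (simp add: approx_invariant_def)
  have "card F' \<le> card (F' <#> S)"
    by (rule card_le_card_set_mult[OF F(2) d(1) F(3) d(3,2)])
  also have "\<dots> \<le> card (((F' <#> S) - S) \<union> S)"
    using fin d(1) by (intro card_mono) auto
  also have "\<dots> \<le> card ((F' <#> S) - S) + card S" by (rule card_Un_le)
  finally have "real (card F') \<le> real (card ((F' <#> S) - S)) + real (card S)" by linarith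
  also have "\<dots> \<le> 1 * real (card S) + real (card S)"
    using d(4) \<eta> e mult_right_mono[of \<eta> 1 "real (card S)"] by linarith
  finally show "card F' \<le> 4 * card T" using half by linarith
qed

text \<open>
  The uncovered part is closed and smaller, for every invariant measure, than the union of a small
  proportion of the levels of each tower, so \<open>subeq_of_measure_less\<close> absorbs it there.
\<close>

lemma almost_finite_of_good_subgroups:
  assumes amen: "amenable G" and good: "good_subgroups G \<alpha>" and free: "free_action G \<alpha>"
    and inf: "infinite (carrier G)"
  shows "almost_finite G \<alpha>"
  unfolding almost_finite_def
proof (intro allI impI, elim conjE)
  fix F and \<epsilon> :: real
  assume F: "finite F" "F \<noteq> {}" "F \<subseteq> carrier G" and \<epsilon>: "0 < \<epsilon>"
  define e where "e = min \<epsilon> 1"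
  have e: "0 < e" "e \<le> \<epsilon>" "e \<le> 1" using \<epsilon> by (auto simp: e_def)
  \<comment> \<open>Infinitude of the group is used here: 4/e further test elements force card T to
    be at least 1/e, so that the integer part of \<open>e * card T\<close> is not 0.\<close>
  obtain F0 where F0: "finite F0" "card F0 = nat \<lceil>4 / e\<rceil>" "F0 \<subseteq> carrier G"
    using infinite_arbitrarily_large[OF inf] by blast
  define F' where "F' = F \<union> F0"
  have F': "finite F'" "F' \<subseteq> carrier G" "F \<subseteq> F'" using F F0 by (auto simp: F'_def)
  have "card F0 \<le> card F'" using F'(1) by (intro card_mono) (auto simp: F'_def)
  then have cF': "4 / e \<le> card F'" using F0(2) e(1) by linarith
  have e16: "0 < e / 16" "e / 16 < 1" and e8: "0 < e / 8" and \<epsilon>2: "0 < \<epsilon> / 2" using e \<epsilon> by auto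
  obtain \<L> where L: "tiling F' (e / 16) (e / 16) (\<epsilon> / 2) \<L>"
    and cov: "\<forall>\<mu>\<in>\<M>. 1 - measure \<mu> (covered \<L>) \<le> e / 8"
    using tiling_exists[OF amen good free e16 \<epsilon>2 e8 F'(1,2) e16(1)] by (elim exE conjE)
  have finL: "finite \<L>" using L by (simp add: tiling_def)
  \<comment> \<open>Disjointness is indexed by positions in this list. Entries that differ only in
    the full shape S yield equal towers in c, whose levels are then empty.\<close>
  obtain ls where ls: "set ls = \<L>" "distinct ls"
    using finite_distinct_list[OF finL] by blast
  define c where "c = map snd ls"
  let ?n = "length c"
  have len: "?n = length ls" by (simp add: c_def)
  have lsL: "ls ! i \<in> \<L>" if "i < ?n" for i using that ls(1) len by auto
  have ci: "c ! i = snd (ls ! i)" if "i < ?n" for i using that by (simp add: c_def)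
  have tile: "open (snd (c ! i))" "finite (fst (c ! i))" "fst (c ! i) \<subseteq> carrier G" "approx_invariant G F e (fst (c ! i))"
      "1 \<le> e * card (fst (c ! i))"
      "\<And>t x y. t \<in> fst (c ! i) \<Longrightarrow> x \<in> snd (c ! i) \<Longrightarrow> y \<in> snd (c ! i) \<Longrightarrow> dist (\<alpha> t x) (\<alpha> t y) < \<epsilon> / 2"
    if i: "i < ?n" for i
  proof -
    obtain S T V where s: "ls ! i = (S, T, V)" by (cases "ls ! i")
    have p: "(S, T, V) \<in> \<L>" using lsL[OF i] s by simp
    note d = tilingD[OF L p]
    note a = tiling_approx_invariant[OF L p F'(3,1,2) F(2) e16(1) order_refl e16(1) order_refl e(3)]
    have "4 / e \<le> 4 * real (card T)" using a(2) cF' by linarith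
    then have "1 \<le> e * card T" using e(1) by (simp add: field_simps)
    then show "open (snd (c ! i))" "finite (fst (c ! i))" "fst (c ! i) \<subseteq> carrier G" "approx_invariant G F e (fst (c ! i))"
      "1 \<le> e * card (fst (c ! i))"
      "\<And>t x y. t \<in> fst (c ! i) \<Longrightarrow> x \<in> snd (c ! i) \<Longrightarrow> y \<in> snd (c ! i) \<Longrightarrow> dist (\<alpha> t x) (\<alpha> t y) < \<epsilon> / 2"
      using d(7,8,10,11) a(1) by (simp_all add: ci[OF i] s)
  qed
  have Ldisj: "disjoint_family_on (\<lambda>(p, t). \<alpha> t ` snd (snd p)) (SIGMA p:\<L>. fst (snd p))"
    using L by (simp add: tiling_def)
  have disj: "disjoint_family_on (\<lambda>(i, s). \<alpha> s ` snd (c ! i)) (SIGMA i:{..<?n}. fst (c ! i))"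
    unfolding disjoint_family_on_def
  proof (intro ballI impI)
    fix x y assume x: "x \<in> (SIGMA i:{..<?n}. fst (c ! i))" and y: "y \<in> (SIGMA i:{..<?n}. fst (c ! i))" and ne: "x \<noteq> y"
    obtain i t j u where e: "x = (i, t)" "y = (j, u)" by (metis surj_pair)
    have ij: "i < ?n" "j < ?n" "t \<in> fst (c ! i)" "u \<in> fst (c ! j)" using x y e by auto
    have "(ls ! i, t) \<noteq> (ls ! j, u)"
      using ne e ij(1,2) len nth_eq_iff_index_eq[OF ls(2), of i j] by auto
    moreover have "(ls ! i, t) \<in> (SIGMA p:\<L>. fst (snd p))" "(ls ! j, u) \<in> (SIGMA p:\<L>. fst (snd p))"
      using ij lsL ci by auto
    ultimately have "\<alpha> t ` snd (snd (ls ! i)) \<inter> \<alpha> u ` snd (snd (ls ! j)) = {}"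
      using disjoint_family_onD[OF Ldisj, of "(ls ! i, t)" "(ls ! j, u)"] by simp
    then show "(case x of (i, s) \<Rightarrow> \<alpha> s ` snd (c ! i)) \<inter> (case y of (i, s) \<Rightarrow> \<alpha> s ` snd (c ! i)) = {}"
      using ij by (simp add: e ci)
  qed
  have in_c: "\<exists>i<?n. c ! i = p" if "p \<in> set c" for p
    using that by (simp add: in_set_conv_nth)
  have towers: "tower G \<alpha> T V" if TV: "(T, V) \<in> set c" for T V
  proof -
    obtain i where i: "i < ?n" "c ! i = (T, V)" using in_c[OF TV] by blast
    have "disjoint_family_on (\<lambda>s. \<alpha> s ` V) T"
      unfolding disjoint_family_on_def
    proof (intro ballI impI)
      fix s t assume st: "s \<in> T" "t \<in> T" "s \<noteq> t"
      show "\<alpha> s ` V \<inter> \<alpha> t ` V = {}"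
        using disjoint_family_onD[OF disj, of "(i, s)" "(i, t)"] i st by simp
    qed
    then show ?thesis using tile(1-3)[OF i(1)] i(2) by (simp add: tower_def)
  qed
  have castle: "castle G \<alpha> c"
    using towers disj by (auto simp: castle_def)
  have shapes: "\<forall>(S, V)\<in>set c. approx_invariant G F \<epsilon> S \<and> (\<forall>s\<in>S. diameter (\<alpha> s ` V) < \<epsilon>)"
  proof (intro ballI)
    fix p assume "p \<in> set c"
    then obtain i where i: "i < ?n" "c ! i = p" using in_c by blast
    obtain T V where p: "p = (T, V)" by (cases p)
    have "e * real (card T) \<le> \<epsilon> * real (card T)" using e(2) by (intro mult_right_mono) auto
    then have "approx_invariant G F \<epsilon> T"
      using tile(4)[OF i(1)] i(2) p by (simp add: approx_invariant_def)
    moreover have "diameter (\<alpha> s ` V) < \<epsilon>" if s: "s \<in> T" for s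
    proof (rule diameter_less[OF \<epsilon>])
      fix x y assume "x \<in> \<alpha> s ` V" "y \<in> \<alpha> s ` V"
      then show "dist x y \<le> \<epsilon> / 2"
        using tile(6)[OF i(1)] i(2) p s by (auto intro: less_imp_le)
    qed
    ultimately show "case p of (S, V) \<Rightarrow> approx_invariant G F \<epsilon> S \<and> (\<forall>s\<in>S. diameter (\<alpha> s ` V) < \<epsilon>)"
      unfolding p prod.case by (intro conjI ballI)
  qed
  \<comment> \<open>The number of levels set aside in each tower for absorbing the
    remainder.\<close>
  define m where "m i = nat \<lfloor>e * real (card (fst (c ! i)))\<rfloor>" for i
  have "\<forall>i. \<exists>T'. i < ?n \<longrightarrow> T' \<subseteq> fst (c ! i) \<and> card T' = m i"
  proof (intro allI)
    fix i
    have "e * real (card (fst (c ! i))) \<le> 1 * real (card (fst (c ! i)))" using e(3) by (intro mult_right_mono) auto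
    then have "m i \<le> card (fst (c ! i))" unfolding m_def by linarith
    then obtain T' where "T' \<subseteq> fst (c ! i)" "card T' = m i" using obtain_subset_with_card_n by metis
    then show "\<exists>T'. i < ?n \<longrightarrow> T' \<subseteq> fst (c ! i) \<and> card T' = m i" by blast
  qed
  then obtain T' where T'0: "\<forall>i. i < ?n \<longrightarrow> T' i \<subseteq> fst (c ! i) \<and> card (T' i) = m i"
    by (elim exE[OF choice])
  then have T': "T' i \<subseteq> fst (c ! i)" "card (T' i) = m i" if "i < ?n" for i using that by simp_all
  let ?R = "UNIV - (\<Union>(S, V)\<in>set c. \<Union>s\<in>S. \<alpha> s ` V)"
  have covc: "(\<Union>(S, V)\<in>set c. \<Union>s\<in>S. \<alpha> s ` V) = covered \<L>"
    unfolding covered_def c_def by (simp add: ls(1) case_prod_beta)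
  have Vb: "snd (c ! i) \<in> sets borel" if "i \<in> {..<?n}" for i using tile(1) that by simp
  have Tf: "finite (fst (c ! i))" "fst (c ! i) \<subseteq> carrier G" if "i \<in> {..<?n}" for i using tile(2,3) that by auto
  have "measure \<mu> ?R < measure \<mu> (\<Union>i<?n. \<Union>t\<in>T' i. \<alpha> t ` snd (c ! i))"
    if \<mu>: "\<mu> \<in> \<M>" for \<mu>
  proof -
    interpret prob_space \<mu> by (rule inv_measureD(2)[OF \<mu>])
    note sb = inv_measureD(1)[OF \<mu>]
    have sp: "space \<mu> = UNIV" using sets_eq_imp_space_eq[OF sb] by simp
    have cb: "covered \<L> \<in> sets \<mu>" using open_covered[OF L] by (simp add: sb)
    have R: "measure \<mu> ?R = 1 - measure \<mu> (covered \<L>)"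
      unfolding covc using prob_compl[OF cb] by (simp add: sp)
    have all: "measure \<mu> (covered \<L>) = (\<Sum>i<?n. card (fst (c ! i)) * measure \<mu> (snd (c ! i)))"
    proof -
      have "covered \<L> = (\<Union>i<?n. \<Union>t\<in>fst (c ! i). \<alpha> t ` snd (c ! i))"
      proof -
        have "set c = (!) c ` {..<?n}" by (auto simp: set_conv_nth)
        then show ?thesis unfolding covc[symmetric] by (simp add: case_prod_beta)
      qed
      then show ?thesis
        using measure_levels[OF inv_under_carrier[OF \<mu>] subset_refl _ Tf Vb disj] by simp
    qed
    have sel: "measure \<mu> (\<Union>i<?n. \<Union>t\<in>T' i. \<alpha> t ` snd (c ! i)) = (\<Sum>i<?n. card (T' i) * measure \<mu> (snd (c ! i)))"
      by (rule measure_sublevels[OF inv_under_carrier[OF \<mu>] subset_refl _ Tf Vb disj]) (use T'(1) in auto)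
    have "e / 2 * measure \<mu> (covered \<L>) \<le> (\<Sum>i<?n. card (T' i) * measure \<mu> (snd (c ! i)))"
      unfolding all sum_distrib_left
    proof (rule sum_mono)
      fix i assume "i \<in> {..<?n}"
      then have i: "i < ?n" by simp
      let ?y = "e * card (fst (c ! i))"
      \<comment> \<open>A real number that is at least 1 has an integer part of at least half its
        size, so the reserved levels make up at least an e/2 proportion of each tower.\<close>
      have "1 \<le> \<lfloor>?y\<rfloor>" using tile(5)[OF i] by (simp add: le_floor_iff)
      then have "?y \<le> 2 * real (m i)"
        using floor_correct[of ?y] unfolding m_def by linarith
      then have "e / 2 * card (fst (c ! i)) \<le> real (m i)" by linarith
      then have "(e / 2 * card (fst (c ! i))) * measure \<mu> (snd (c ! i)) \<le> real (m i) * measure \<mu> (snd (c ! i))"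
        by (rule mult_right_mono) simp
      then show "e / 2 * (card (fst (c ! i)) * measure \<mu> (snd (c ! i))) \<le> card (T' i) * measure \<mu> (snd (c ! i))"
        using T'(2)[OF i] by (simp add: mult.assoc)
    qed
    \<comment> \<open>The reserved levels weigh at least 7e/16, the remainder at most e/8.\<close>
    moreover have "e / 2 * (7 / 8) \<le> e / 2 * measure \<mu> (covered \<L>)"
    proof (rule mult_left_mono)
      have "1 - measure \<mu> (covered \<L>) \<le> e / 8" using cov \<mu> by simp
      then show "7 / 8 \<le> measure \<mu> (covered \<L>)" using e(3) by linarith
    qed (use e in simp)
    moreover have "1 - measure \<mu> (covered \<L>) \<le> e / 8" using cov \<mu> by simp
    ultimately show ?thesis unfolding R sel using e(1) by linarith
  qed
  then have lt: "\<forall>\<mu>\<in>\<M>. measure \<mu> ?R < measure \<mu> (\<Union>i<?n. \<Union>t\<in>T' i. \<alpha> t ` snd (c ! i))"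
    by (rule ballI)
  have clR: "closed ?R" unfolding covc using open_covered[OF L] by (intro closed_Diff) auto
  have T'G: "t \<in> carrier G" if "i < ?n" "t \<in> T' i" for i t using T'(1)[OF that(1)] tile(3)[OF that(1)] that(2) by blast
  have opV: "open (\<Union>i<?n. \<Union>t\<in>T' i. \<alpha> t ` snd (c ! i))"
    using tile(1) T'G by (auto intro!: open_UN open_act)
  have sub: "subeq G \<alpha> ?R (\<Union>i<?n. \<Union>t\<in>T' i. \<alpha> t ` snd (c ! i))"
    by (rule subeq_of_measure_less[OF amen good borel_closed[OF clR] opV lt])
  let ?N = "\<lambda>p :: 'g set \<times> 'x set. nat \<lfloor>\<epsilon> * real (card (fst p))\<rfloor>"
  let ?Bs = "concat (map (\<lambda>p. replicate (?N p) (snd p)) c)"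
  obtain \<kappa> where k1: "\<forall>i<?n. \<forall>r<?N (c ! i). \<kappa> i r < length ?Bs \<and> ?Bs ! \<kappa> i r = snd (c ! i)"
    and k2: "\<forall>i<?n. \<forall>r<?N (c ! i). \<forall>i'<?n. \<forall>r'<?N (c ! i'). \<kappa> i r = \<kappa> i' r' \<longrightarrow> i = i' \<and> r = r'"
    using concat_replicate_index[of c ?N snd] by (elim exE conjE)
  have T'fin: "finite (T' i)" if "i < ?n" for i using finite_subset[OF T'(1)[OF that] tile(2)[OF that]] .
  have "\<forall>i. \<exists>h. i < ?n \<longrightarrow> bij_betw h (T' i) {0..<m i}"
    using ex_bij_betw_finite_nat[OF T'fin] T'(2) by (intro allI) force
  then obtain h where h0: "\<forall>i. i < ?n \<longrightarrow> bij_betw (h i) (T' i) {0..<m i}"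
    by (elim exE[OF choice])
  \<comment> \<open>Since e \<le> \<epsilon>, each tower offers at least as many copies of its base
    in the formal sum as it has reserved levels.\<close>
  have mN: "m i \<le> ?N (c ! i)" for i
    unfolding m_def using e(2) by (intro nat_mono floor_mono mult_right_mono) auto
  have hN: "h i t < ?N (c ! i)" if "i < ?n" "t \<in> T' i" for i t
    using bij_betwE[OF h0[rule_format, OF that(1)]] that(2) mN[of i] by force
  have "subeq_sum G \<alpha> [?R] ?Bs"
  proof (rule subeq_sum_of_levels[OF sub, where k = "\<lambda>i t. \<kappa> i (h i t)"])
    show "finite (T' i)" "T' i \<subseteq> carrier G" "open (snd (c ! i))" if "i < ?n" for i
      using T'fin T'G tile(1) that by auto
    show "\<kappa> i (h i t) < length ?Bs \<and> ?Bs ! \<kappa> i (h i t) = snd (c ! i)" if "i < ?n" "t \<in> T' i" for i t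
      using k1 that hN by simp
    show "i = i' \<and> t = t'"
      if a: "i < ?n" "t \<in> T' i" "i' < ?n" "t' \<in> T' i'" "\<kappa> i (h i t) = \<kappa> i' (h i' t')" for i t i' t'
    proof -
      have "i = i' \<and> h i t = h i' t'"
        using k2[rule_format, OF a(1) hN[OF a(1,2)] a(3) hN[OF a(3,4)] a(5)] .
      then show ?thesis
        using bij_betw_imp_inj_on[OF h0[rule_format, OF a(1)]] a(2,4) by (auto simp: inj_on_def)
    qed
  qed
  then have "subeq_sum G \<alpha> [?R] (concat (map (\<lambda>(S, V). replicate (nat \<lfloor>\<epsilon> * real (card S)\<rfloor>) V) c))"
    by (simp add: case_prod_beta')
  then show "\<exists>c. castle G \<alpha> c \<and>
        (\<forall>(S, V)\<in>set c. approx_invariant G F \<epsilon> S \<and> (\<forall>s\<in>S. diameter (\<alpha> s ` V) < \<epsilon>)) \<and>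
        subeq_sum G \<alpha>
          [UNIV - (\<Union>(S, V)\<in>set c. \<Union>s\<in>S. \<alpha> s ` V)]
          (concat (map (\<lambda>(S, V). replicate (nat \<lfloor>\<epsilon> * real (card S)\<rfloor>) V) c))"
    using castle shapes by (intro exI[of _ c] conjI)
qed

end

theorem theorem3p6:
  fixes \<Gamma> :: "('g, 'm) monoid_scheme"
    and \<alpha> :: "'g \<Rightarrow> 'x::metric_space \<Rightarrow> 'x"
  assumes "group \<Gamma>" "countable (carrier \<Gamma>)" "infinite (carrier \<Gamma>)" "amenable \<Gamma>"
    and "compact (UNIV :: 'x set)"
    and "homeo_action \<Gamma> \<alpha>"
    and "good_subgroups \<Gamma> \<alpha>"
  shows "comparison \<Gamma> \<alpha> \<and> (free_action \<Gamma> \<alpha> \<longrightarrow> almost_finite \<Gamma> \<alpha>)"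
proof -
  interpret compact_action \<Gamma> \<alpha>
    using assms(5,6) by unfold_locales
  show ?thesis
    using comparison_of_good_subgroups[OF assms(4,7)] almost_finite_of_good_subgroups[OF assms(4,7) _ assms(3)]
    by blast
qed

end
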